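(* Let $(M,g_{\mu\nu})$ be a 4-dimensional spacetime and let $P\subset M$ be a future converging achronal spacelike submanifold of codimension $2$, with mean normal curvature vector field $H^\mu=H\hat H^\mu$, where $\hat H^\mu$ is a future-pointing timelike unit vector. Let $\gamma:[0,\ell]\to M$ be a future-directed null geodesic emanating normally from $P$ at $\gamma(0)\in P$, with affine parameter $\lambda$ normalized so that $\hat H_\mu\, d\gamma^\mu/d\lambda=1$, where $\hat H_\mu$ is extended along $\gamma$ by parallel transport. Let $\rho(\lambda)=R_{kk}(\gamma(\lambda))=R_{\mu\nu}k^\mu k^\nu$ with $k^\mu=d\gamma^\mu/d\lambda$. Let $B>0$ and $Q_1=32\pi B$, and suppose that $$\int_0^{\ell} g(\lambda)^2\rho(\lambda)\,d\lambda\;\ge\;-Q_1\int_0^{\ell} g'(\lambda)^2\,d\lambda$$ for every real-valued $C^1$ function $g$ with compact support in $(0,\ell)$. Suppose further that there are $0<\ell_0<\ell$ and $\rho_0\ge 0$ with $\rho(\lambda)\ge\rho_0$ for all $\lambda\in[0,\ell_0]$. If $$-2H|_{\gamma(0)}\;\ge\;\nu^*\;\equiv\;-\frac23\rho_0\ell_0+\frac{Q_1}{\ell_0}+\frac{2+Q_1}{\ell-\ell_0},$$ then $\gamma$ contains a focal point to $P$ before $\lambda=\ell$.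
   Context: Conventions: metric signature is $(+,-,-,-)$, and the Ricci tensor sign is such that Einstein's equation reads $G_{\mu\nu}=8\pi G_N T_{\mu\nu}$ and the Raychaudhuri equation for a twist-free null congruence reads $d\theta/d\lambda=-\tfrac12\theta^2-\sigma_{ab}\sigma^{ab}-R_{kk}$. Mean normal curvature: $H^\mu=\frac12\sum_{i=1}^{2}\mathrm{II}(e_i,e_i)^\mu$, where $e_1,e_2$ is a local orthonormal frame of $TP$ (so $g(e_i,e_i)=-1$) and $\mathrm{II}(V,W)=(\nabla_VW)^{\perp}$ is the second fundamental form. $P$ is future converging if $H^\mu$ is everywhere past-pointing timelike; hence $H<0$ when one writes $H^\mu=H\hat H^\mu$ with $\hat H^\mu$ future-pointing timelike unit. With the normalization $\hat H_\mu k^\mu=1$, the initial expansion at $\gamma(0)$ of the null geodesic congruence normal to $P$ containing $\gamma$ is $\theta(0)=2H|_{\gamma(0)}$. A focal point to $P$ along $\gamma$ is a point $\gamma(\lambda)$, $\lambda>0$, at which some nontrivial $P$-Jacobi field along $\gamma$ vanishes. The integral inequality assumed on $\rho$ is the geometric form (via the semiclassical Einstein equation $8\pi G_N\langle T_{\mu\nu}\rangle=G_{\mu\nu}$) of the smeared null energy condition $\int g^2\langle T_{kk}\rangle d\lambda\ge-\frac{4B}{G_N}\int (g')^2d\lambda$. *)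

theory Defs
  imports "HOL-Analysis.Analysis"
begin

text \<open>
  Smooth manifolds and Lorentzian metrics are set up here from an explicit atlas.  The manifold is
  the whole type \<open>'a\<close>; Hausdorffness and second countability are imposed by the classes
  \<open>t2_space\<close> and \<open>second_countable_topology\<close>.  The metric signature is \<open>(+,-,-,-)\<close>.
\<close>

subsection \<open>Smooth maps\<close>

fun Ck_on :: "nat \<Rightarrow> 'a::real_normed_vector set \<Rightarrow> ('a \<Rightarrow> 'b::real_normed_vector) \<Rightarrow> bool" where
  "Ck_on 0 S f \<longleftrightarrow> continuous_on S f"
| "Ck_on (Suc n) S f \<longleftrightarrow> (\<forall>x\<in>S. f differentiable (at x)) \<and>
     (\<forall>v. Ck_on n S (\<lambda>x. frechet_derivative f (at x) v))"

text \<open>Only used for open \<open>S\<close>.\<close>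

definition smooth_on :: "'a::real_normed_vector set \<Rightarrow> ('a \<Rightarrow> 'b::real_normed_vector) \<Rightarrow> bool" where
  "smooth_on S f \<longleftrightarrow> (\<forall>n. Ck_on n S f)"

subsection \<open>Charts, atlases and tangent vectors\<close>

datatype 'a chart = Chart (cdom: "'a set") (cmap: "'a \<Rightarrow> real^4")

definition transition :: "'a chart \<Rightarrow> 'a chart \<Rightarrow> real^4 \<Rightarrow> real^4" where
  "transition c d = cmap d \<circ> inv_into (cdom c) (cmap c)"

definition smooth_atlas :: "'a::topological_space chart set \<Rightarrow> bool" where
  "smooth_atlas A \<longleftrightarrow>
     (\<Union>c\<in>A. cdom c) = UNIV \<and>
     (\<forall>c\<in>A. open (cdom c) \<and> open (cmap c ` cdom c) \<and>
        (\<exists>\<psi>. homeomorphism (cdom c) (cmap c ` cdom c) (cmap c) \<psi>)) \<and>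
     (\<forall>c\<in>A. \<forall>d\<in>A. smooth_on (cmap c ` (cdom c \<inter> cdom d)) (transition c d))"

text \<open>
  A tangent vector is the family of its components in all charts around its base point
  (see \<open>tangent\<close> below); components in other charts are irrelevant.
\<close>

type_synonym 'a tvec = "'a chart \<Rightarrow> real^4"

text \<open>
  \<open>metric M c x\<close> is the matrix of components of the metric in the chart \<open>c\<close> at the point with
  coordinates \<open>x\<close>; \<open>time_dir M\<close> is a vector field representing the time orientation.
\<close>

record 'a spacetime =
  atlas :: "'a chart set"
  metric :: "'a chart \<Rightarrow> real^4 \<Rightarrow> real^4^4"
  time_dir :: "'a \<Rightarrow> 'a tvec"

definition charts_at :: "'a spacetime \<Rightarrow> 'a \<Rightarrow> 'a chart set" where
  "charts_at M p = {c \<in> atlas M. p \<in> cdom c}"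

text \<open>Scalars, which do not depend on the chart, are evaluated in this one.\<close>

definition chart_at :: "'a spacetime \<Rightarrow> 'a \<Rightarrow> 'a chart" where
  "chart_at M p = (SOME c. c \<in> charts_at M p)"

definition tangent :: "'a spacetime \<Rightarrow> 'a \<Rightarrow> 'a tvec \<Rightarrow> bool" where
  "tangent M p v \<longleftrightarrow> (\<forall>c\<in>charts_at M p. \<forall>d\<in>charts_at M p.
     v d = frechet_derivative (transition c d) (at (cmap c p)) (v c))"

definition vec_eq :: "'a spacetime \<Rightarrow> 'a \<Rightarrow> 'a tvec \<Rightarrow> 'a tvec \<Rightarrow> bool" where
  "vec_eq M p v w \<longleftrightarrow> (\<forall>c\<in>charts_at M p. v c = w c)"

definition vec_zero :: "'a spacetime \<Rightarrow> 'a \<Rightarrow> 'a tvec \<Rightarrow> bool" where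
  "vec_zero M p v \<longleftrightarrow> (\<forall>c\<in>charts_at M p. v c = 0)"

subsection \<open>Lorentzian metric and causal character\<close>

definition metric_form :: "'a spacetime \<Rightarrow> 'a chart \<Rightarrow> real^4 \<Rightarrow> real^4 \<Rightarrow> real^4 \<Rightarrow> real" where
  "metric_form M c x u v = u \<bullet> (metric M c x *v v)"

definition ip :: "'a spacetime \<Rightarrow> 'a \<Rightarrow> 'a tvec \<Rightarrow> 'a tvec \<Rightarrow> real" where
  "ip M p v w = (let c = chart_at M p in metric_form M c (cmap c p) (v c) (w c))"

definition lorentz_metric :: "'a spacetime \<Rightarrow> bool" where
  "lorentz_metric M \<longleftrightarrow>
     (\<forall>c\<in>atlas M. smooth_on (cmap c ` cdom c) (metric M c)) \<and>
     (\<forall>c\<in>atlas M. \<forall>x\<in>cmap c ` cdom c.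
        transpose (metric M c x) = metric M c x \<and>
        (\<exists>e :: 4 \<Rightarrow> real^4. \<forall>i j. metric_form M c x (e i) (e j) =
           (if i \<noteq> j then 0 else if i = 0 then 1 else -1))) \<and>
     (\<forall>p. \<forall>c\<in>charts_at M p. \<forall>d\<in>charts_at M p. \<forall>u v.
        let J = frechet_derivative (transition c d) (at (cmap c p))
        in metric_form M c (cmap c p) u v = metric_form M d (cmap d p) (J u) (J v))"

definition time_oriented :: "'a::topological_space spacetime \<Rightarrow> bool" where
  "time_oriented M \<longleftrightarrow>
     (\<forall>p. tangent M p (time_dir M p) \<and> ip M p (time_dir M p) (time_dir M p) > 0) \<and>
     (\<forall>c\<in>atlas M. continuous_on (cdom c) (\<lambda>p. time_dir M p c))"

definition is_spacetime :: "'a::{t2_space,second_countable_topology} spacetime \<Rightarrow> bool" where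
  "is_spacetime M \<longleftrightarrow> connected (UNIV :: 'a set) \<and> smooth_atlas (atlas M) \<and>
     lorentz_metric M \<and> time_oriented M"

definition timelike :: "'a spacetime \<Rightarrow> 'a \<Rightarrow> 'a tvec \<Rightarrow> bool" where
  "timelike M p v \<longleftrightarrow> ip M p v v > 0"

definition null_vec :: "'a spacetime \<Rightarrow> 'a \<Rightarrow> 'a tvec \<Rightarrow> bool" where
  "null_vec M p v \<longleftrightarrow> ip M p v v = 0 \<and> \<not> vec_zero M p v"

text \<open>The next two are meant for nonzero causal vectors.\<close>

definition future_pointing :: "'a spacetime \<Rightarrow> 'a \<Rightarrow> 'a tvec \<Rightarrow> bool" where
  "future_pointing M p v \<longleftrightarrow> ip M p v (time_dir M p) > 0"

definition past_pointing :: "'a spacetime \<Rightarrow> 'a \<Rightarrow> 'a tvec \<Rightarrow> bool" where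
  "past_pointing M p v \<longleftrightarrow> ip M p v (time_dir M p) < 0"

subsection \<open>Levi-Civita connection and curvature in coordinates\<close>

definition pderiv_at :: "4 \<Rightarrow> (real^4 \<Rightarrow> real) \<Rightarrow> real^4 \<Rightarrow> real" where
  "pderiv_at i f x = frechet_derivative f (at x) (axis i 1)"

text \<open>\<open>christoffel M c x i j k\<close> is \<open>\<Gamma>\<^sup>i\<^sub>j\<^sub>k\<close>.\<close>

definition christoffel :: "'a spacetime \<Rightarrow> 'a chart \<Rightarrow> real^4 \<Rightarrow> 4 \<Rightarrow> 4 \<Rightarrow> 4 \<Rightarrow> real" where
  "christoffel M c x i j k = 1/2 * (\<Sum>l\<in>UNIV. matrix_inv (metric M c x) $ i $ l *
     (pderiv_at j (\<lambda>y. metric M c y $ l $ k) x + pderiv_at k (\<lambda>y. metric M c y $ l $ j) x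
      - pderiv_at l (\<lambda>y. metric M c y $ j $ k) x))"

definition Gam :: "'a spacetime \<Rightarrow> 'a chart \<Rightarrow> real^4 \<Rightarrow> real^4 \<Rightarrow> real^4 \<Rightarrow> real^4" where
  "Gam M c x u v = (\<chi> i. \<Sum>j\<in>UNIV. \<Sum>k\<in>UNIV. christoffel M c x i j k * u $ j * v $ k)"

text \<open>\<open>riemann M c x i j k l\<close> is \<open>R\<^sup>i\<^sub>j\<^sub>k\<^sub>l\<close>, the \<open>i\<close>-th component of
  \<open>R(\<partial>\<^sub>k,\<partial>\<^sub>l)\<partial>\<^sub>j\<close> with \<open>R(X,Y) = [\<nabla>\<^sub>X,\<nabla>\<^sub>Y] - \<nabla>\<^bsub>[X,Y]\<^esub>\<close>.  With the Ricci
  tensor \<open>R\<^sup>i\<^sub>j\<^sub>i\<^sub>l\<close>, the Raychaudhuri equation contains the term \<open>- R\<^sub>k\<^sub>k\<close>.\<close>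

definition riemann :: "'a spacetime \<Rightarrow> 'a chart \<Rightarrow> real^4 \<Rightarrow> 4 \<Rightarrow> 4 \<Rightarrow> 4 \<Rightarrow> 4 \<Rightarrow> real" where
  "riemann M c x i j k l =
     pderiv_at k (\<lambda>y. christoffel M c y i l j) x - pderiv_at l (\<lambda>y. christoffel M c y i k j) x
     + (\<Sum>m\<in>UNIV. christoffel M c x i k m * christoffel M c x m l j
                  - christoffel M c x i l m * christoffel M c x m k j)"

text \<open>\<open>R(u,v)w\<close>\<close>

definition curv :: "'a spacetime \<Rightarrow> 'a chart \<Rightarrow> real^4 \<Rightarrow> real^4 \<Rightarrow> real^4 \<Rightarrow> real^4 \<Rightarrow> real^4" where
  "curv M c x u v w =
     (\<chi> i. \<Sum>j\<in>UNIV. \<Sum>k\<in>UNIV. \<Sum>l\<in>UNIV. riemann M c x i j k l * w $ j * u $ k * v $ l)"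

definition ricci :: "'a spacetime \<Rightarrow> 'a \<Rightarrow> 'a tvec \<Rightarrow> 'a tvec \<Rightarrow> real" where
  "ricci M p v w = (let c = chart_at M p in
     \<Sum>j\<in>UNIV. \<Sum>l\<in>UNIV. (\<Sum>i\<in>UNIV. riemann M c (cmap c p) i j i l) * v c $ j * w c $ l)"

subsection \<open>Curves and vector fields along curves\<close>

text \<open>A curve with parameter interval \<open>S\<close> is a function on \<open>real\<close> of which only the
  restriction to \<open>S\<close> matters; derivatives at end points of \<open>S\<close> are one-sided.\<close>

definition velocity :: "real set \<Rightarrow> (real \<Rightarrow> 'a) \<Rightarrow> real \<Rightarrow> 'a tvec" where
  "velocity S \<gamma> t = (\<lambda>c. vector_derivative (cmap c \<circ> \<gamma>) (at t within S))"

definition differentiable_curve ::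
    "'a::topological_space spacetime \<Rightarrow> real set \<Rightarrow> (real \<Rightarrow> 'a) \<Rightarrow> bool" where
  "differentiable_curve M S \<gamma> \<longleftrightarrow> continuous_on S \<gamma> \<and>
     (\<forall>t\<in>S. \<forall>c\<in>charts_at M (\<gamma> t). (cmap c \<circ> \<gamma>) differentiable (at t within S))"

definition differentiable_field ::
    "'a spacetime \<Rightarrow> real set \<Rightarrow> (real \<Rightarrow> 'a) \<Rightarrow> (real \<Rightarrow> 'a tvec) \<Rightarrow> bool" where
  "differentiable_field M S \<gamma> V \<longleftrightarrow> (\<forall>t\<in>S. tangent M (\<gamma> t) (V t) \<and>
     (\<forall>c\<in>charts_at M (\<gamma> t). (\<lambda>s. V s c) differentiable (at t within S)))"

text \<open>The covariant derivative \<open>DV/dt\<close>\<close>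

definition cov_deriv ::
    "'a spacetime \<Rightarrow> real set \<Rightarrow> (real \<Rightarrow> 'a) \<Rightarrow> (real \<Rightarrow> 'a tvec) \<Rightarrow> real \<Rightarrow> 'a tvec" where
  "cov_deriv M S \<gamma> V t = (\<lambda>c. vector_derivative (\<lambda>s. V s c) (at t within S)
     + Gam M c (cmap c (\<gamma> t)) (velocity S \<gamma> t c) (V t c))"

definition parallel_field ::
    "'a spacetime \<Rightarrow> real set \<Rightarrow> (real \<Rightarrow> 'a) \<Rightarrow> (real \<Rightarrow> 'a tvec) \<Rightarrow> bool" where
  "parallel_field M S \<gamma> V \<longleftrightarrow> differentiable_field M S \<gamma> V \<and>
     (\<forall>t\<in>S. vec_zero M (\<gamma> t) (cov_deriv M S \<gamma> V t))"

text \<open>Affinely parametrized geodesics\<close>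

definition geodesic :: "'a::topological_space spacetime \<Rightarrow> real set \<Rightarrow> (real \<Rightarrow> 'a) \<Rightarrow> bool" where
  "geodesic M S \<gamma> \<longleftrightarrow> differentiable_curve M S \<gamma> \<and> parallel_field M S \<gamma> (velocity S \<gamma>)"

definition jacobi_field ::
    "'a spacetime \<Rightarrow> real set \<Rightarrow> (real \<Rightarrow> 'a) \<Rightarrow> (real \<Rightarrow> 'a tvec) \<Rightarrow> bool" where
  "jacobi_field M S \<gamma> V \<longleftrightarrow>
     differentiable_field M S \<gamma> V \<and> differentiable_field M S \<gamma> (cov_deriv M S \<gamma> V) \<and>
     (\<forall>t\<in>S. \<forall>c\<in>charts_at M (\<gamma> t).
        cov_deriv M S \<gamma> (cov_deriv M S \<gamma> V) t c
        + curv M c (cmap c (\<gamma> t)) (V t c) (velocity S \<gamma> t c) (velocity S \<gamma> t c) = 0)"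

subsection \<open>Achronality\<close>

definition timelike_curve :: "'a::topological_space spacetime \<Rightarrow> (real \<Rightarrow> 'a) \<Rightarrow> bool" where
  "timelike_curve M \<alpha> \<longleftrightarrow> differentiable_curve M {0..1} \<alpha> \<and>
     (\<forall>c\<in>atlas M. continuous_on ({0..1} \<inter> \<alpha> -` cdom c) (\<lambda>t. velocity {0..1} \<alpha> t c)) \<and>
     (\<forall>t\<in>{0..1}. timelike M (\<alpha> t) (velocity {0..1} \<alpha> t) \<and>
                  future_pointing M (\<alpha> t) (velocity {0..1} \<alpha> t))"

text \<open>The transitive closure accounts for piecewise \<open>C\<^sup>1\<close> curves.\<close>

definition chron :: "'a::topological_space spacetime \<Rightarrow> ('a \<times> 'a) set" where
  "chron M = {(p, q). \<exists>\<alpha>. timelike_curve M \<alpha> \<and> \<alpha> 0 = p \<and> \<alpha> 1 = q}\<^sup>+"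

definition achronal :: "'a::topological_space spacetime \<Rightarrow> 'a set \<Rightarrow> bool" where
  "achronal M P \<longleftrightarrow> (\<forall>p\<in>P. \<forall>q\<in>P. (p, q) \<notin> chron M)"

subsection \<open>Submanifolds of codimension 2\<close>

definition local_param ::
    "'a::topological_space spacetime \<Rightarrow> 'a set \<Rightarrow> (real^2) set \<Rightarrow> (real^2 \<Rightarrow> 'a) \<Rightarrow> bool" where
  "local_param M P W X \<longleftrightarrow>
     open W \<and> openin (top_of_set P) (X ` W) \<and> (\<exists>\<psi>. homeomorphism W (X ` W) X \<psi>) \<and>
     (\<forall>c\<in>atlas M. smooth_on (W \<inter> X -` cdom c) (cmap c \<circ> X) \<and>
        (\<forall>u\<in>W \<inter> X -` cdom c. inj (frechet_derivative (cmap c \<circ> X) (at u))))"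

definition codim2_submanifold :: "'a::topological_space spacetime \<Rightarrow> 'a set \<Rightarrow> bool" where
  "codim2_submanifold M P \<longleftrightarrow> (\<forall>p\<in>P. \<exists>W X. local_param M P W X \<and> p \<in> X ` W)"

text \<open>
  A parametrization around \<open>p\<close>, together with the parameter value of \<open>p\<close>, is chosen once and for
  all.  Tangent vectors of \<open>P\<close> at \<open>p\<close> are given by their components \<open>a :: real^2\<close> with respect to
  it; \<open>surf_tan M P p a\<close> is the vector itself and \<open>T\<^sub>pP = range (surf_tan M P p)\<close>.
  The resulting notions do not depend on the choice.
\<close>

definition param_at :: "'a::topological_space spacetime \<Rightarrow> 'a set \<Rightarrow> 'a \<Rightarrow> (real^2 \<Rightarrow> 'a) \<times> (real^2)" where
  "param_at M P p = (SOME (X, u). \<exists>W. local_param M P W X \<and> u \<in> W \<and> X u = p)"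

definition surf_tan ::
    "'a::topological_space spacetime \<Rightarrow> 'a set \<Rightarrow> 'a \<Rightarrow> real^2 \<Rightarrow> 'a tvec" where
  "surf_tan M P p a = (\<lambda>c. let (X, u) = param_at M P p
     in frechet_derivative (cmap c \<circ> X) (at u) a)"

definition spacelike_submanifold :: "'a::topological_space spacetime \<Rightarrow> 'a set \<Rightarrow> bool" where
  "spacelike_submanifold M P \<longleftrightarrow> codim2_submanifold M P \<and>
     (\<forall>p\<in>P. \<forall>a. a \<noteq> 0 \<longrightarrow> ip M p (surf_tan M P p a) (surf_tan M P p a) < 0)"

text \<open>\<open>\<nabla>\<^sub>V W\<close> at \<open>p\<close>, where \<open>V\<close>, \<open>W\<close> are the vector fields on \<open>P\<close> whose components with respect to
  the parametrization are constantly \<open>a\<close> and \<open>b\<close>\<close>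

definition surf_cov ::
    "'a::topological_space spacetime \<Rightarrow> 'a set \<Rightarrow> 'a \<Rightarrow> real^2 \<Rightarrow> real^2 \<Rightarrow> 'a tvec" where
  "surf_cov M P p a b = (\<lambda>c. let (X, u) = param_at M P p
     in frechet_derivative (\<lambda>w. frechet_derivative (cmap c \<circ> X) (at w) b) (at u) a
        + Gam M c (cmap c p) (surf_tan M P p a c) (surf_tan M P p b c))"

text \<open>An orthonormal frame of \<open>T\<^sub>pP\<close>\<close>

definition surf_frame ::
    "'a::topological_space spacetime \<Rightarrow> 'a set \<Rightarrow> 'a \<Rightarrow> (real^2) \<times> (real^2)" where
  "surf_frame M P p = (SOME (a, b).
     ip M p (surf_tan M P p a) (surf_tan M P p a) = -1 \<and>
     ip M p (surf_tan M P p b) (surf_tan M P p b) = -1 \<and>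
     ip M p (surf_tan M P p a) (surf_tan M P p b) = 0)"

text \<open>Projection onto the normal space of \<open>P\<close>; the sign is due to \<open>g(e\<^sub>i,e\<^sub>i) = -1\<close>.\<close>

definition normal_part :: "'a::topological_space spacetime \<Rightarrow> 'a set \<Rightarrow> 'a \<Rightarrow> 'a tvec \<Rightarrow> 'a tvec" where
  "normal_part M P p v = (\<lambda>c. let (a, b) = surf_frame M P p;
       e1 = surf_tan M P p a; e2 = surf_tan M P p b
     in v c + ip M p v e1 *\<^sub>R e1 c + ip M p v e2 *\<^sub>R e2 c)"

definition second_ff ::
    "'a::topological_space spacetime \<Rightarrow> 'a set \<Rightarrow> 'a \<Rightarrow> real^2 \<Rightarrow> real^2 \<Rightarrow> 'a tvec" where
  "second_ff M P p a b = normal_part M P p (surf_cov M P p a b)"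

definition mean_curvature :: "'a::topological_space spacetime \<Rightarrow> 'a set \<Rightarrow> 'a \<Rightarrow> 'a tvec" where
  "mean_curvature M P p = (\<lambda>c. let (a, b) = surf_frame M P p
     in (1/2) *\<^sub>R (second_ff M P p a a c + second_ff M P p b b c))"

definition future_converging :: "'a::topological_space spacetime \<Rightarrow> 'a set \<Rightarrow> bool" where
  "future_converging M P \<longleftrightarrow> (\<forall>p\<in>P. timelike M p (mean_curvature M P p) \<and>
     past_pointing M p (mean_curvature M P p))"

definition normal_to :: "'a::topological_space spacetime \<Rightarrow> 'a set \<Rightarrow> 'a \<Rightarrow> 'a tvec \<Rightarrow> bool" where
  "normal_to M P p v \<longleftrightarrow> (\<forall>a. ip M p v (surf_tan M P p a) = 0)"

subsection \<open>Focal points\<close>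

text \<open>
  \<open>P\<close>-Jacobi fields are the variation fields of variations of \<open>\<gamma>\<close> through geodesics normal to \<open>P\<close>:
  \<open>V(0)\<close> is tangent to \<open>P\<close> and the part of \<open>V'(0)\<close> tangent to \<open>P\<close> is that of \<open>\<nabla>\<^sub>V\<^sub>(\<^sub>0\<^sub>)Z\<close>, where \<open>Z\<close> is a
  normal field extending \<open>\<gamma>'(0)\<close>; that is, \<open>g(V'(0),w) = - g(II(V(0),w),\<gamma>'(0))\<close> for all \<open>w\<close>
  tangent to \<open>P\<close>.
\<close>

definition P_jacobi_field ::
    "'a::topological_space spacetime \<Rightarrow> 'a set \<Rightarrow> real \<Rightarrow> (real \<Rightarrow> 'a) \<Rightarrow> (real \<Rightarrow> 'a tvec) \<Rightarrow> bool" where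
  "P_jacobi_field M P L \<gamma> V \<longleftrightarrow> jacobi_field M {0..L} \<gamma> V \<and>
     (\<exists>a. vec_eq M (\<gamma> 0) (V 0) (surf_tan M P (\<gamma> 0) a) \<and>
       (\<forall>b. ip M (\<gamma> 0) (cov_deriv M {0..L} \<gamma> V 0) (surf_tan M P (\<gamma> 0) b) =
            - ip M (\<gamma> 0) (second_ff M P (\<gamma> 0) a b) (velocity {0..L} \<gamma> 0)))"

definition focal_point ::
    "'a::topological_space spacetime \<Rightarrow> 'a set \<Rightarrow> real \<Rightarrow> (real \<Rightarrow> 'a) \<Rightarrow> real \<Rightarrow> bool" where
  "focal_point M P L \<gamma> r \<longleftrightarrow> 0 < r \<and> r \<le> L \<and>
     (\<exists>V. P_jacobi_field M P L \<gamma> V \<and> (\<exists>t\<in>{0..L}. \<not> vec_zero M (\<gamma> t) (V t)) \<and>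
          vec_zero M (\<gamma> r) (V r))"

end

theory Submission
  imports Defs
begin

text \<open>
  In a parallel frame \<open>e\<^sub>1, e\<^sub>2, k\<close> along \<open>\<gamma>\<close> the \<open>P\<close>-Jacobi fields are given by the solutions of
  \<open>f'' = - K f\<close> for a symmetric \<open>2 \<times> 2\<close> matrix \<open>K\<close> with trace \<open>\<rho>\<close>; the component along \<open>k\<close> can always be
  adjusted, so a focal point is a zero of the determinant of the matrix solution. Without such a zero before \<open>L\<close>
  the expansion \<open>\<theta>\<close> satisfies \<open>\<theta>' \<le> - \<rho> - \<theta>\<^sup>2 / 2\<close> on \<open>[0, L)\<close>. Multiply by \<open>g\<^sup>2\<close>, where \<open>g = 1\<close> on
  \<open>[0, L\<^sub>0]\<close> and \<open>g\<close> decreases linearly to \<open>0\<close> on \<open>[L\<^sub>0, T]\<close> with \<open>T < L\<close>, integrate, and estimate \<open>\<rho>\<close> from below by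
  \<open>\<rho>\<^sub>0\<close> and the smeared condition for the tent function with peak at \<open>L\<^sub>0\<close>. Since \<open>\<theta>\<close> does not vanish at \<open>0\<close>,
  the term \<open>\<theta>\<^sup>2 / 2\<close> on \<open>[0, L\<^sub>0]\<close> gives a gain independent of \<open>T\<close>, so the inequality is still strict in the limit
  \<open>T \<rightarrow> L\<close>.
\<close>

section \<open>Directional derivatives and smooth functions\<close>

text \<open>Two obstacles shape the proof. Tensors are given by components in charts and scalars are
  read off in one chosen chart, whereas \<gamma> may cross many charts. So the Koszul formula is
  established in each chart, the transformation laws of connection and curvature are derived from
  it, and only then do transport, frame and tidal matrix make sense along all of \<gamma>. The other
  obstacle is the class of test functions: the tent is neither differentiable nor supported inside
  the open interval, so it has to be a limit of admissible functions.

  Three frame fields suffice because R(u,k)k is orthogonal to k, hence has no component along a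
  fourth, transverse vector, and because R(k,k)k = 0, so that the component along k is driven by the
  other two without acting back on them.

  The constants: completing the square on [l,T] costs 2/(T-l); the squared slopes of the tent
  integrate to 1/l and 1/(T-l), each with the factor Q; on [0,l] the weight 1 exceeds the squared
  tent by 1-(t/l)^2, whose integral is 2l/3.\<close>

abbreviation dirder :: "'a::real_normed_vector \<Rightarrow> ('a \<Rightarrow> 'b::real_normed_vector) \<Rightarrow> 'a \<Rightarrow> 'b" where
  "dirder v f \<equiv> \<lambda>x. frechet_derivative f (at x) v"

lemma has_derivative_cong_open:
  assumes "open S" "x \<in> S" "\<And>y. y \<in> S \<Longrightarrow> f y = g y"
  shows "(f has_derivative D) (at x) \<longleftrightarrow> (g has_derivative D) (at x)"
  using assms has_derivative_transform_within_open[of _ _ x UNIV S] by (metis)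

lemma frechet_derivative_cong_open:
  assumes "open S" "x \<in> S" "\<And>y. y \<in> S \<Longrightarrow> f y = g y"
  shows "frechet_derivative f (at x) = frechet_derivative g (at x)"
  unfolding frechet_derivative_def using has_derivative_cong_open[OF assms] by simp

text \<open>A derivative at \<open>x\<close> sees a whole neighbourhood, which is why
  \<open>S\<close> is open: agreement on \<open>S\<close> passes to the directional derivatives, and
  the induction repeats with these.\<close>

lemma Ck_on_cong:
  assumes "open S" "\<And>y. y \<in> S \<Longrightarrow> f y = g y" "Ck_on n S f"
  shows "Ck_on n S g"
  using assms(2,3)
proof (induction n arbitrary: f g)
  case 0 then show ?case using continuous_on_cong by fastforce
next
  case (Suc n)
  have "g differentiable (at x)" if "x \<in> S" for x
    using Suc.prems that has_derivative_cong_open[OF assms(1) that, of f g]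
    unfolding Ck_on.simps differentiable_def by blast
  moreover have "Ck_on n S (dirder v g)" for v
    by (rule Suc.IH[of "dirder v f"])
      (use Suc.prems frechet_derivative_cong_open[OF assms(1), of _ f g] in \<open>auto\<close>)
  ultimately show ?case by simp
qed

lemma Ck_on_Suc_D: "Ck_on (Suc n) S f \<Longrightarrow> Ck_on n S f"
proof (induction n arbitrary: f)
  case 0 then show ?case
    by (auto intro!: continuous_at_imp_continuous_on differentiable_imp_continuous_within)
next
  case (Suc n) then show ?case by simp
qed

lemma Ck_on_subset: "Ck_on n S f \<Longrightarrow> T \<subseteq> S \<Longrightarrow> Ck_on n T f"
  by (induction n arbitrary: f) (auto intro: continuous_on_subset)

lemma Ck_on_const: "Ck_on n S (\<lambda>x. c)"
  by (induction n arbitrary: c) auto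

lemma Ck_on_bounded_linear:
  assumes "open S" "bounded_linear h" "Ck_on n S f"
  shows "Ck_on n S (\<lambda>x. h (f x))"
  using assms(3)
proof (induction n arbitrary: f)
  case 0 then show ?case using bounded_linear.continuous_on[OF assms(2)] by auto
next
  case (Suc n)
  have D: "((\<lambda>x. h (f x)) has_derivative (\<lambda>v. h (frechet_derivative f (at x) v))) (at x)" if "x \<in> S" for x
    using Suc.prems that by (auto intro!: bounded_linear.has_derivative[OF assms(2)] simp: frechet_derivative_works[symmetric])
  have "dirder v (\<lambda>x. h (f x)) x = h (dirder v f x)" if "x \<in> S" for x v
    using frechet_derivative_at[OF D[OF that]] by metis
  then show ?case using D Suc Ck_on_cong[OF assms(1)] unfolding Ck_on.simps differentiable_def
    by (smt (verit) )
qed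

lemma Ck_on_add:
  assumes "open S" "Ck_on n S f" "Ck_on n S g"
  shows "Ck_on n S (\<lambda>x. f x + g x)"
  using assms(2,3)
proof (induction n arbitrary: f g)
  case 0 then show ?case by (auto intro: continuous_intros)
next
  case (Suc n)
  have D: "((\<lambda>x. f x + g x) has_derivative (\<lambda>v. frechet_derivative f (at x) v + frechet_derivative g (at x) v)) (at x)" if "x \<in> S" for x
    using Suc.prems that by (auto intro!: derivative_intros simp: frechet_derivative_works[symmetric])
  have E: "dirder v f x + dirder v g x = dirder v (\<lambda>x. f x + g x) x" if "x \<in> S" for x v
    using frechet_derivative_at[OF D[OF that]] by metis
  have "Ck_on n S (dirder v (\<lambda>x. f x + g x))" for v
    by (rule Ck_on_cong[OF assms(1) E Suc.IH]) (use Suc.prems in auto)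
  then show ?case using D unfolding Ck_on.simps differentiable_def by blast
qed

text \<open>The product rule leaves one factor undifferentiated; \<open>Ck_on_Suc_D\<close> lowers
  its order so that the induction hypothesis applies.\<close>

lemma Ck_on_mult:
  fixes f g :: "'a::real_normed_vector \<Rightarrow> real"
  assumes "open S" "Ck_on n S f" "Ck_on n S g"
  shows "Ck_on n S (\<lambda>x. f x * g x)"
  using assms(2,3)
proof (induction n arbitrary: f g)
  case 0 then show ?case by (auto intro: continuous_intros)
next
  case (Suc n)
  have D: "((\<lambda>x. f x * g x) has_derivative (\<lambda>v. f x * frechet_derivative g (at x) v + frechet_derivative f (at x) v * g x)) (at x)" if "x \<in> S" for x
    using Suc.prems that by (intro has_derivative_mult) (auto simp: frechet_derivative_works[symmetric])
  have E: "f x * dirder v g x + dirder v f x * g x = dirder v (\<lambda>x. f x * g x) x" if "x \<in> S" for x v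
    using frechet_derivative_at[OF D[OF that]] by metis
  have "Ck_on n S (dirder v (\<lambda>x. f x * g x))" for v
    by (rule Ck_on_cong[OF assms(1) E Ck_on_add[OF assms(1) Suc.IH Suc.IH]])
      (use Suc.prems Ck_on_Suc_D in auto)
  then show ?case using D unfolding Ck_on.simps differentiable_def by blast
qed

text \<open>The derivative is a product of two copies of the inverse and a derivative of
  \<open>f\<close>, so the inverse itself is needed only one order lower and \<open>f\<close> can
  stay fixed in the induction.\<close>

lemma Ck_on_inverse:
  fixes f :: "'a::real_normed_vector \<Rightarrow> real"
  assumes "open S" "Ck_on n S f" "\<And>x. x \<in> S \<Longrightarrow> f x \<noteq> 0"
  shows "Ck_on n S (\<lambda>x. inverse (f x))"
  using assms(2)
proof (induction n)
  case 0 then show ?case using assms(3) by (auto intro: continuous_intros)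
next
  case (Suc n)
  have D: "((\<lambda>x. inverse (f x)) has_derivative (\<lambda>v. - (inverse (f x) * frechet_derivative f (at x) v * inverse (f x)))) (at x)" if "x \<in> S" for x
    using Suc.prems that assms(3) by (auto intro!: has_derivative_inverse simp: frechet_derivative_works[symmetric])
  have E: "(-1) * (inverse (f x) * dirder v f x * inverse (f x)) = dirder v (\<lambda>x. inverse (f x)) x" if "x \<in> S" for x v
    using frechet_derivative_at[OF D[OF that]] by (metis mult_minus1)
  have IH: "Ck_on n S (\<lambda>x. inverse (f x))" using Suc Ck_on_Suc_D by blast
  have "Ck_on n S (dirder v (\<lambda>x. inverse (f x)))" for v
  proof (rule Ck_on_cong[OF assms(1) E])
    have "Ck_on n S (dirder v f)" using Suc.prems by simp
    then show "Ck_on n S (\<lambda>x. - 1 * (inverse (f x) * dirder v f x * inverse (f x)))"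
      by (intro Ck_on_mult Ck_on_const assms(1) IH)
  qed
  then show ?case using D unfolding Ck_on.simps differentiable_def by blast
qed

lemma smooth_on_cong:
  "open S \<Longrightarrow> (\<And>y. y \<in> S \<Longrightarrow> f y = g y) \<Longrightarrow> smooth_on S f \<Longrightarrow> smooth_on S g"
  unfolding smooth_on_def using Ck_on_cong by blast

lemma smooth_on_subset: "smooth_on S f \<Longrightarrow> T \<subseteq> S \<Longrightarrow> smooth_on T f"
  unfolding smooth_on_def using Ck_on_subset by blast

lemma smooth_on_const: "smooth_on S (\<lambda>x. c)"
  unfolding smooth_on_def using Ck_on_const by blast

lemma smooth_on_bounded_linear:
  "open S \<Longrightarrow> bounded_linear h \<Longrightarrow> smooth_on S f \<Longrightarrow> smooth_on S (\<lambda>x. h (f x))"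
  unfolding smooth_on_def using Ck_on_bounded_linear by blast

lemma smooth_on_add: "open S \<Longrightarrow> smooth_on S f \<Longrightarrow> smooth_on S g \<Longrightarrow> smooth_on S (\<lambda>x. f x + g x)"
  unfolding smooth_on_def using Ck_on_add by blast

lemma smooth_on_mult:
  fixes f g :: "'a::real_normed_vector \<Rightarrow> real"
  shows "open S \<Longrightarrow> smooth_on S f \<Longrightarrow> smooth_on S g \<Longrightarrow> smooth_on S (\<lambda>x. f x * g x)"
  unfolding smooth_on_def using Ck_on_mult by blast

lemma smooth_on_inverse:
  fixes f :: "'a::real_normed_vector \<Rightarrow> real"
  shows "open S \<Longrightarrow> smooth_on S f \<Longrightarrow> (\<And>x. x \<in> S \<Longrightarrow> f x \<noteq> 0) \<Longrightarrow> smooth_on S (\<lambda>x. inverse (f x))"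
  unfolding smooth_on_def using Ck_on_inverse by blast

lemma smooth_on_diff:
  assumes "open S" "smooth_on S f" "smooth_on S g" shows "smooth_on S (\<lambda>x. f x - g x)"
  using smooth_on_add[OF assms(1,2) smooth_on_bounded_linear[OF assms(1) bounded_linear_minus[OF bounded_linear_ident] assms(3)]]
  by simp

lemma smooth_on_sum:
  assumes "open S" "\<And>i. i \<in> I \<Longrightarrow> smooth_on S (f i)"
  shows "smooth_on S (\<lambda>x. \<Sum>i\<in>I. f i x)"
  using assms(2) by (induction I rule: infinite_finite_induct) (auto simp: smooth_on_const intro: smooth_on_add assms(1))

lemma smooth_on_prod:
  fixes f :: "'i \<Rightarrow> 'a::real_normed_vector \<Rightarrow> real"
  assumes "open S" "\<And>i. i \<in> I \<Longrightarrow> smooth_on S (f i)"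
  shows "smooth_on S (\<lambda>x. \<Prod>i\<in>I. f i x)"
  using assms(2) by (induction I rule: infinite_finite_induct) (auto simp: smooth_on_const intro: smooth_on_mult assms(1))

lemma smooth_on_dirder: "smooth_on S f \<Longrightarrow> smooth_on S (dirder v f)"
  unfolding smooth_on_def by (metis Ck_on.simps(2))

lemma smooth_on_has_derivative:
  "smooth_on S f \<Longrightarrow> x \<in> S \<Longrightarrow> (f has_derivative frechet_derivative f (at x)) (at x)"
  unfolding smooth_on_def by (metis Ck_on.simps(2) frechet_derivative_works)

lemma smooth_on_linear:
  "smooth_on S f \<Longrightarrow> x \<in> S \<Longrightarrow> linear (frechet_derivative f (at x))"
  using smooth_on_has_derivative has_derivative_linear by blast

lemma smooth_on_continuous: "smooth_on S f \<Longrightarrow> continuous_on S f"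
  unfolding smooth_on_def by (metis Ck_on.simps(1))

lemma smooth_on_isCont: "smooth_on S f \<Longrightarrow> x \<in> S \<Longrightarrow> isCont f x"
  using smooth_on_has_derivative has_derivative_continuous by blast

lemma smooth_on_vec_nth:
  "open S \<Longrightarrow> smooth_on S f \<Longrightarrow> smooth_on S (\<lambda>x. f x $ i)"
  by (rule smooth_on_bounded_linear[OF _ bounded_linear_vec_nth])

lemma smooth_on_scaleR_const:
  "open S \<Longrightarrow> smooth_on S f \<Longrightarrow> smooth_on S (\<lambda>x. f x *\<^sub>R c)"
  by (rule smooth_on_bounded_linear[OF _ bounded_linear_scaleR_left])

lemma dirder_inner:
  assumes "smooth_on S f" "x \<in> S"
  shows "dirder v (\<lambda>y. f y \<bullet> b) x = dirder v f x \<bullet> b"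
  using frechet_derivative_at[OF has_derivative_inner_left[OF smooth_on_has_derivative[OF assms], of b]]
  by metis

text \<open>Two applications of the mean value theorem to the second difference of \<open>f\<close>.\<close>

lemma second_difference:
  fixes f :: "'a::real_normed_vector \<Rightarrow> real"
  assumes "open S" "smooth_on S f" "t > 0"
    and S: "\<And>a b. a \<in> {0..t} \<Longrightarrow> b \<in> {0..t} \<Longrightarrow> x + a *\<^sub>R u + b *\<^sub>R v \<in> S"
  obtains a b where "a \<in> {0..t}" "b \<in> {0..t}"
    "f (x + t *\<^sub>R u + t *\<^sub>R v) - f (x + t *\<^sub>R u) - f (x + t *\<^sub>R v) + f x
      = t * t * dirder v (dirder u f) (x + a *\<^sub>R u + b *\<^sub>R v)"
proof -
  define p where "p a = f (x + a *\<^sub>R u + t *\<^sub>R v) - f (x + a *\<^sub>R u + 0 *\<^sub>R v)" for a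
  have d1: "((\<lambda>a. f (x + a *\<^sub>R u + b *\<^sub>R v)) has_derivative
       (\<lambda>h. h * dirder u f (x + a *\<^sub>R u + b *\<^sub>R v))) (at a)"
    if "a \<in> {0..t}" "b \<in> {0..t}" for a b
  proof -
    have "((\<lambda>a. f (x + a *\<^sub>R u + b *\<^sub>R v)) has_derivative
       (\<lambda>h. frechet_derivative f (at (x + a *\<^sub>R u + b *\<^sub>R v)) (h *\<^sub>R u))) (at a)"
      by (rule has_derivative_compose[where f="\<lambda>a. x + a *\<^sub>R u + b *\<^sub>R v" and g=f, OF _ smooth_on_has_derivative[OF assms(2) S[OF that]]])
        (auto intro!: derivative_eq_intros)
    then show ?thesis using smooth_on_linear[OF assms(2) S[OF that]] by (simp add: linear_cmul)
  qed
  have d2: "((\<lambda>b. dirder u f (x + a *\<^sub>R u + b *\<^sub>R v)) has_derivative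
       (\<lambda>h. h * dirder v (dirder u f) (x + a *\<^sub>R u + b *\<^sub>R v))) (at b)"
    if "a \<in> {0..t}" "b \<in> {0..t}" for a b
  proof -
    note sm = smooth_on_dirder[OF assms(2), of u]
    have "((\<lambda>b. dirder u f (x + a *\<^sub>R u + b *\<^sub>R v)) has_derivative
       (\<lambda>h. frechet_derivative (dirder u f) (at (x + a *\<^sub>R u + b *\<^sub>R v)) (h *\<^sub>R v))) (at b)"
      by (rule has_derivative_compose[where f="\<lambda>b. x + a *\<^sub>R u + b *\<^sub>R v" and g="dirder u f", OF _ smooth_on_has_derivative[OF sm S[OF that]]])
        (auto intro!: derivative_eq_intros)
    then show ?thesis using smooth_on_linear[OF sm S[OF that]] by (simp add: linear_cmul)
  qed
  have "\<exists>a\<in>{0..t}. p t - p 0 = (t - 0) *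
      (dirder u f (x + a *\<^sub>R u + t *\<^sub>R v) - dirder u f (x + a *\<^sub>R u + 0 *\<^sub>R v))"
  proof -
    have "\<exists>a\<in>{0..t}. p t - p 0 = (\<lambda>h. h * dirder u f (x + a *\<^sub>R u + t *\<^sub>R v) - h * dirder u f (x + a *\<^sub>R u + 0 *\<^sub>R v)) (t - 0)"
      unfolding p_def
    proof (rule mvt_very_simple[OF less_imp_le[OF assms(3)]])
      fix a assume a: "0 \<le> a" "a \<le> t"
      show "((\<lambda>a. f (x + a *\<^sub>R u + t *\<^sub>R v) - f (x + a *\<^sub>R u + 0 *\<^sub>R v)) has_derivative
        (\<lambda>h. h * dirder u f (x + a *\<^sub>R u + t *\<^sub>R v) - h * dirder u f (x + a *\<^sub>R u + 0 *\<^sub>R v)))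
        (at a within {0..t})"
        by (rule has_derivative_at_withinI[OF has_derivative_diff[OF d1 d1]]) (use a assms(3) in auto)
    qed
    then show ?thesis by (simp add: algebra_simps)
  qed
  then obtain a where a: "a \<in> {0..t}" "p t - p 0 = t *
      (dirder u f (x + a *\<^sub>R u + t *\<^sub>R v) - dirder u f (x + a *\<^sub>R u + 0 *\<^sub>R v))" by auto
  have "\<exists>b\<in>{0..t}. dirder u f (x + a *\<^sub>R u + t *\<^sub>R v) - dirder u f (x + a *\<^sub>R u + 0 *\<^sub>R v) =
     (\<lambda>h. h * dirder v (dirder u f) (x + a *\<^sub>R u + b *\<^sub>R v)) (t - 0)"
    using a assms(3) by (intro mvt_very_simple has_derivative_at_withinI[OF d2]) auto
  then obtain b where "b \<in> {0..t}" "dirder u f (x + a *\<^sub>R u + t *\<^sub>R v) - dirder u f (x + a *\<^sub>R u + 0 *\<^sub>R v) =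
     t * dirder v (dirder u f) (x + a *\<^sub>R u + b *\<^sub>R v)" by auto
  with a show thesis by (intro that[of a b]) (auto simp: p_def algebra_simps)
qed

text \<open>Both mixed derivatives are limits of one quotient: the second difference over the
  parallelogram spanned by \<open>t *\<^sub>R u\<close> and \<open>t *\<^sub>R v\<close>, which is
  symmetric in \<open>u\<close> and \<open>v\<close>, divided by \<open>t * t\<close>. Were they
  different at \<open>x\<close>, continuity would keep them apart at the two intermediate points,
  where they coincide.\<close>

lemma dirder_commute_real:
  fixes f :: "'a::real_normed_vector \<Rightarrow> real"
  assumes S: "open S" "smooth_on S f" "x \<in> S"
  shows "dirder u (dirder v f) x = dirder v (dirder u f) x"
proof (rule ccontr)
  let ?F = "dirder v (dirder u f)" and ?G = "dirder u (dirder v f)"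
  assume ne: "?G x \<noteq> ?F x"
  define e where "e = dist (?G x) (?F x) / 2"
  have e: "e > 0" using ne by (simp add: e_def)
  have "isCont ?F x" "isCont ?G x" by (metis S(2,3) smooth_on_dirder smooth_on_isCont)+
  then obtain d1 d2 where d: "d1 > 0" "\<And>y. dist y x < d1 \<Longrightarrow> dist (?F y) (?F x) < e"
     "d2 > 0" "\<And>y. dist y x < d2 \<Longrightarrow> dist (?G y) (?G x) < e"
    unfolding continuous_at_eps_delta using e by metis
  obtain d3 where d3: "d3 > 0" "ball x d3 \<subseteq> S" using S openE by blast
  define d where "d = min d1 (min d2 d3)"
  \<comment> \<open>Small enough for the whole parallelogram to lie within \<open>d\<close> of
    \<open>x\<close>; the summand 1 covers \<open>u = v = 0\<close>.\<close>
  define t where "t = d / (2 * (norm u + norm v + 1))"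
  have dp: "d > 0" using d d3 by (simp add: d_def)
  have nn: "norm u + norm v + 1 > 0" by (simp add: add_nonneg_pos)
  have tp: "t > 0" using dp nn by (simp add: t_def)
  have near: "dist (x + a *\<^sub>R u' + b *\<^sub>R v') x < d" if "a \<in> {0..t}" "b \<in> {0..t}"
    "norm u' + norm v' = norm u + norm v" for a b u' v'
  proof -
    have "dist (x + a *\<^sub>R u' + b *\<^sub>R v') x = norm (a *\<^sub>R u' + b *\<^sub>R v')" by (simp add: dist_norm)
    also have "\<dots> \<le> a * norm u' + b * norm v'" using that by (metis norm_triangle_mono norm_scaleR abs_of_nonneg atLeastAtMost_iff order_refl)
    also have "\<dots> \<le> t * norm u' + t * norm v'" using that by (intro add_mono mult_right_mono) auto
    also have "\<dots> = t * (norm u + norm v)" using that by (metis distrib_left)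
    also have "\<dots> < t * (2 * (norm u + norm v + 1))" using tp by (intro mult_strict_left_mono) (smt (verit) norm_ge_zero)+
    also have "\<dots> = d" using nn by (simp add: t_def)
    finally show ?thesis .
  qed
  have inS: "x + a *\<^sub>R u' + b *\<^sub>R v' \<in> S" if "a \<in> {0..t}" "b \<in> {0..t}"
    "norm u' + norm v' = norm u + norm v" for a b u' v'
    using near[OF that] d3(2) by (auto simp: d_def dist_commute)
  obtain a b where 1: "a \<in> {0..t}" "b \<in> {0..t}"
    "f (x + t *\<^sub>R u + t *\<^sub>R v) - f (x + t *\<^sub>R u) - f (x + t *\<^sub>R v) + f x
      = t * t * ?F (x + a *\<^sub>R u + b *\<^sub>R v)"
    using second_difference[OF S(1,2) tp, of x u v] inS by blast
  obtain a' b' where 2: "a' \<in> {0..t}" "b' \<in> {0..t}"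
    "f (x + t *\<^sub>R v + t *\<^sub>R u) - f (x + t *\<^sub>R v) - f (x + t *\<^sub>R u) + f x
      = t * t * ?G (x + a' *\<^sub>R v + b' *\<^sub>R u)"
    using second_difference[OF S(1,2) tp, of x v u] inS by (metis add.commute)
  have "t * t * ?F (x + a *\<^sub>R u + b *\<^sub>R v) = t * t * ?G (x + a' *\<^sub>R v + b' *\<^sub>R u)"
    using 1 2 by (simp add: algebra_simps)
  then have "?F (x + a *\<^sub>R u + b *\<^sub>R v) = ?G (x + a' *\<^sub>R v + b' *\<^sub>R u)" using tp by simp
  moreover have "dist (?F (x + a *\<^sub>R u + b *\<^sub>R v)) (?F x) < e" using near[OF 1(1,2)] by (intro d(2)) (auto simp: d_def)
  moreover have "dist (?G (x + a' *\<^sub>R v + b' *\<^sub>R u)) (?G x) < e" using near[OF 2(1,2)] by (intro d(4)) (auto simp: d_def)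
  ultimately show False unfolding e_def by (smt (verit) dist_commute dist_triangle field_sum_of_halves)
qed

lemma dirder_commute:
  fixes f :: "'a::real_normed_vector \<Rightarrow> 'b::euclidean_space"
  assumes S: "open S" "smooth_on S f" "x \<in> S"
  shows "dirder u (dirder v f) x = dirder v (dirder u f) x"
proof (rule euclidean_eqI)
  fix b :: 'b
  have sm: "smooth_on S (\<lambda>y. f y \<bullet> b)"
    by (rule smooth_on_bounded_linear[OF S(1) bounded_linear_inner_left S(2)])
  have *: "dirder u (dirder v f) x \<bullet> b = dirder u (dirder v (\<lambda>y. f y \<bullet> b)) x" for u v
    unfolding dirder_inner[OF smooth_on_dirder[OF S(2)] S(3), symmetric]
    by (rule fun_cong[OF frechet_derivative_cong_open[OF S(1,3)]]) (simp add: dirder_inner[OF S(2)])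
  show "dirder u (dirder v f) x \<bullet> b = dirder v (dirder u f) x \<bullet> b"
    unfolding * by (rule dirder_commute_real[OF S(1) sm S(3)])
qed

text \<open>Splitting \<open>B y (u y) = B y (u x) + B y (u y - u x)\<close> avoids differentiating \<open>B\<close> in an operator space.\<close>

lemma has_derivative_apply_linear:
  fixes B :: "'a::real_normed_vector \<Rightarrow> 'b::euclidean_space \<Rightarrow> 'c::real_normed_vector"
  assumes B: "\<And>v. ((\<lambda>y. B y v) has_derivative B' v) (at x within S)"
    and lin: "\<And>y. y \<in> S \<Longrightarrow> linear (B y)" "x \<in> S"
    and u: "(u has_derivative u') (at x within S)"
  shows "((\<lambda>y. B y (u y)) has_derivative (\<lambda>h. B' (u x) h + B x (u' h))) (at x within S)"
proof -
  have rep: "B y w = (\<Sum>i\<in>Basis. (w \<bullet> i) *\<^sub>R B y i)" if "y \<in> S" for y w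
    using linear_sum[OF lin(1)[OF that], of "\<lambda>i. (w \<bullet> i) *\<^sub>R i" Basis] linear_cmul[OF lin(1)[OF that]]
    by (simp add: euclidean_representation)
  have "((\<lambda>y. B y (u x) + (\<Sum>i\<in>Basis. ((u y - u x) \<bullet> i) *\<^sub>R B y i)) has_derivative
     (\<lambda>h. B' (u x) h + (\<Sum>i\<in>Basis. (((u x - u x) \<bullet> i) *\<^sub>R B' i h + (u' h \<bullet> i) *\<^sub>R B x i)))) (at x within S)"
    by (intro has_derivative_add has_derivative_sum has_derivative_scaleR B has_derivative_inner_left)
      (auto intro!: derivative_eq_intros u)
  then have "((\<lambda>y. B y (u x) + B y (u y - u x)) has_derivative
     (\<lambda>h. B' (u x) h + B x (u' h))) (at x within S)"
    by (rule has_derivative_transform[rotated 2, OF has_derivative_eq_rhs]) (simp_all add: rep lin(2))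
  then show ?thesis
    by (rule has_derivative_transform[rotated 2]) (simp_all add: linear_add[OF lin(1), symmetric] lin(2))
qed

text \<open>The linear version applied twice, once per argument, with the other argument
  frozen.\<close>

lemma has_derivative_apply_bilinear:
  fixes B :: "'a::real_normed_vector \<Rightarrow> 'b::euclidean_space \<Rightarrow> 'b \<Rightarrow> 'c::real_normed_vector"
  assumes B: "\<And>v w. ((\<lambda>y. B y v w) has_derivative B' v w) (at x within S)"
    and bil: "\<And>y. y \<in> S \<Longrightarrow> bilinear (B y)" "x \<in> S"
    and u: "(u has_derivative u') (at x within S)" and v: "(v has_derivative v') (at x within S)"
  shows "((\<lambda>y. B y (u y) (v y)) has_derivative
     (\<lambda>h. B' (u x) (v x) h + B x (u' h) (v x) + B x (u x) (v' h))) (at x within S)"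
proof -
  have "((\<lambda>y. B y (u y) w) has_derivative (\<lambda>h. B' (u x) w h + B x (u' h) w)) (at x within S)" for w
    by (rule has_derivative_apply_linear[of "\<lambda>y a. B y a w" "\<lambda>a h. B' a w h"])
      (use B bil u in \<open>auto simp: bilinear_def\<close>)
  then show ?thesis
    by (rule has_derivative_apply_linear[of "\<lambda>y b. B y (u y) b" "\<lambda>b h. B' (u x) b h + B x (u' h) b"])
      (use bil v in \<open>auto simp: bilinear_def\<close>)
qed

section \<open>The Levi-Civita connection in coordinates\<close>

text \<open>One chart, described by bilinear maps instead of index arrays. The link between
  \<open>g\<close> and \<open>G\<close> is the Koszul formula for constant coordinate fields;
  torsion freeness and metric compatibility are consequences of it.\<close>

locale coord_metric =
  fixes S :: "'e::euclidean_space set" and g :: "'e \<Rightarrow> 'e \<Rightarrow> 'e \<Rightarrow> real" and G :: "'e \<Rightarrow> 'e \<Rightarrow> 'e \<Rightarrow> 'e"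
  assumes open_S: "open S"
    and g_bil: "\<And>x. bilinear (g x)" and G_bil: "\<And>x. bilinear (G x)"
    and g_sym: "\<And>x u v. x \<in> S \<Longrightarrow> g x u v = g x v u"
    and nondeg: "\<And>x u. x \<in> S \<Longrightarrow> (\<And>v. g x u v = 0) \<Longrightarrow> u = 0"
    and g_smooth: "\<And>u v. smooth_on S (\<lambda>x. g x u v)"
    and G_smooth: "\<And>u v. smooth_on S (\<lambda>x. G x u v)"
    and koszul: "\<And>x u v w. x \<in> S \<Longrightarrow> 2 * g x (G x u v) w =
       dirder u (\<lambda>y. g y v w) x + dirder v (\<lambda>y. g y u w) x - dirder w (\<lambda>y. g y u v) x"
begin

abbreviation dg where "dg x w u v \<equiv> dirder w (\<lambda>y. g y u v) x"
abbreviation dG where "dG x w u v \<equiv> dirder w (\<lambda>y. G y u v) x"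

text \<open>The covariant derivative of a constant field \<open>w\<close> along \<open>v\<close> is
  \<open>G y v w\<close>, and constant fields have vanishing brackets, so this is the commutator of
  covariant derivatives.\<close>

definition Rm where "Rm x u v w = dG x u v w - dG x v u w + G x u (G x v w) - G x v (G x u w)"

lemmas g_simps = bilinear_ladd[OF g_bil] bilinear_radd[OF g_bil] bilinear_lsub[OF g_bil]
  bilinear_rsub[OF g_bil] bilinear_lneg[OF g_bil] bilinear_rneg[OF g_bil]
  bilinear_lmul[OF g_bil] bilinear_rmul[OF g_bil] bilinear_lzero[OF g_bil] bilinear_rzero[OF g_bil]

lemmas G_simps = bilinear_ladd[OF G_bil] bilinear_radd[OF G_bil] bilinear_lsub[OF G_bil]
  bilinear_rsub[OF G_bil] bilinear_lneg[OF G_bil] bilinear_rneg[OF G_bil]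
  bilinear_lmul[OF G_bil] bilinear_rmul[OF G_bil] bilinear_lzero[OF G_bil] bilinear_rzero[OF G_bil]

lemma g_cancel:
  assumes "x \<in> S" "\<And>w. g x u w = g x v w"
  shows "u = v"
proof -
  have "u - v = 0" by (rule nondeg[OF assms(1)]) (simp add: g_simps assms(2))
  then show ?thesis by simp
qed

lemma dg_sym: "x \<in> S \<Longrightarrow> dg x w u v = dg x w v u"
  using frechet_derivative_cong_open[OF open_S, of x "\<lambda>y. g y u v" "\<lambda>y. g y v u"] g_sym by auto

text \<open>Torsion freeness: the right-hand side of the Koszul formula is symmetric in
  \<open>u\<close> and \<open>v\<close>.\<close>

lemma G_sym:
  assumes "x \<in> S" shows "G x u v = G x v u"
proof (rule g_cancel[OF assms])
  fix w
  show "g x (G x u v) w = g x (G x v u) w"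
    using koszul[OF assms, of u v w] koszul[OF assms, of v u w] dg_sym[OF assms, of u v w] by linarith
qed

lemma dG_sym: "x \<in> S \<Longrightarrow> dG x w u v = dG x w v u"
  using frechet_derivative_cong_open[OF open_S, of x "\<lambda>y. G y u v" "\<lambda>y. G y v u"] G_sym by auto

text \<open>Adding two instances of the Koszul formula with the last two vectors exchanged cancels
  all derivatives except the one along \<open>w\<close>.\<close>

lemma compat:
  assumes "x \<in> S" shows "dg x w u v = g x (G x w u) v + g x u (G x w v)"
  using koszul[OF assms, of w u v] koszul[OF assms, of w v u] g_sym[OF assms, of u "G x w v"]
    dg_sym[OF assms, of u v w] by linarith

lemma g_deriv:
  assumes "x \<in> S" "(u has_derivative u') (at x)" "(v has_derivative v') (at x)"
  shows "((\<lambda>y. g y (u y) (v y)) has_derivative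
     (\<lambda>h. dg x h (u x) (v x) + g x (u' h) (v x) + g x (u x) (v' h))) (at x)"
  by (rule has_derivative_apply_bilinear[of g "\<lambda>a b h. dg x h a b"])
    (use smooth_on_has_derivative[OF g_smooth assms(1)] g_bil assms in auto)

lemma Rm_anti12: "Rm x u v w = - Rm x v u w"
  by (simp add: Rm_def)

lemma Rm_bianchi: "x \<in> S \<Longrightarrow> Rm x u v w + Rm x v w u + Rm x w u v = 0"
  unfolding Rm_def using dG_sym[of x v w u] dG_sym[of x w u v] dG_sym[of x u v w]
    G_sym[of x v w] G_sym[of x w u] G_sym[of x u v] by simp

text \<open>Compatibility, differentiated once more, expresses the second derivatives of
  \<open>g x a b\<close> by the connection. They commute in \<open>u\<close> and \<open>w\<close>,
  and what remains of this equation is the antisymmetry.\<close>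

lemma Rm_anti34:
  assumes x: "x \<in> S" shows "g x (Rm x u w a) b = - g x a (Rm x u w b)"
proof -
  have D: "dirder u (\<lambda>y. dg y w a b) x = dg x u (G x w a) b + g x (dG x u w a) b
     + (dg x u a (G x w b) + g x a (dG x u w b))" for u w
  proof -
    have *: "dirder u (\<lambda>y. dg y w a b) x = dirder u (\<lambda>y. g y (G y w a) b + g y a (G y w b)) x"
      by (rule fun_cong[OF frechet_derivative_cong_open[OF open_S x compat]])
    have "((\<lambda>y. g y (G y w a) b + g y a (G y w b)) has_derivative
       (\<lambda>h. dg x h (G x w a) b + g x (dG x h w a) b + g x (G x w a) 0
         + (dg x h a (G x w b) + g x 0 (G x w b) + g x a (dG x h w b)))) (at x)"
      using smooth_on_has_derivative[OF G_smooth x]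
      by (intro has_derivative_add g_deriv[OF x] has_derivative_const) auto
    from this[THEN frechet_derivative_at, THEN fun_cong, of u] * show ?thesis
      by (simp add: g_simps)
  qed
  have "dirder u (\<lambda>y. dg y w a b) x = dirder w (\<lambda>y. dg y u a b) x"
    using dirder_commute[OF open_S g_smooth x] by blast
  then show ?thesis
    unfolding D Rm_def compat[OF x] by (simp add: g_simps)
qed

text \<open>The classical octahedron argument: four instances of the Bianchi identity, combined
  linearly with the two antisymmetries.\<close>

lemma Rm_pair:
  assumes x: "x \<in> S" shows "g x (Rm x a b c) d = g x (Rm x c d a) b"
proof -
  have B: "g x (Rm x u v w) z + g x (Rm x v w u) z + g x (Rm x w u v) z = 0" for u v w z
    using Rm_bianchi[OF x, of u v w] by (metis g_simps(1,9))
  have A: "g x (Rm x u v w) z = - g x (Rm x v u w) z" for u v w z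
    using Rm_anti12[of x u v w] by (metis g_simps(5))
  have C: "g x (Rm x u v w) z = - g x (Rm x u v z) w" for u v w z
    using Rm_anti34[OF x, of u v w z] g_sym[OF x] by metis
  show ?thesis
    using B[of b c a d] B[of c a d b] B[of a d b c] B[of d b c a]
      C[of b c a d] C[of c a d b] C[of a b c d] C[of a d b c] C[of d b c a] C[of d c a b]
      A[of b a d c] A[of c d b a] A[of d c a b]
    by linarith
qed

end

section \<open>Change of coordinates\<close>

text \<open>A transition map \<open>T\<close> on the overlap \<open>U\<close>, known to be an
  isometry between two coordinate expressions of the metric. How \<open>G\<close> and
  \<open>Rm\<close> transform is forced by this.\<close>

locale coord_change = A: coord_metric S g G + B: coord_metric S' g' G'
  for S :: "'e::euclidean_space set" and g :: "'e \<Rightarrow> 'e \<Rightarrow> 'e \<Rightarrow> real" and G :: "'e \<Rightarrow> 'e \<Rightarrow> 'e \<Rightarrow> 'e"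
  and S' :: "'e set" and g' :: "'e \<Rightarrow> 'e \<Rightarrow> 'e \<Rightarrow> real" and G' :: "'e \<Rightarrow> 'e \<Rightarrow> 'e \<Rightarrow> 'e" +
  fixes U :: "'e set" and T :: "'e \<Rightarrow> 'e"
  assumes open_U: "open U" and U_sub: "U \<subseteq> S" and T_sub: "T ` U \<subseteq> S'"
    and T_smooth: "smooth_on U T"
    and T_isom: "\<And>x u v. x \<in> U \<Longrightarrow> g x u v = g' (T x) (dirder u T x) (dirder v T x)"
begin

abbreviation DT where "DT x u \<equiv> dirder u T x"
abbreviation D2T where "D2T x u v \<equiv> dirder u (dirder v T) x"

lemma DT_linear: "x \<in> U \<Longrightarrow> linear (DT x)"
  using smooth_on_linear[OF T_smooth] .

text \<open>An isometry out of a nondegenerate form is injective, and the dimensions agree. This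
  allows testing equations between vectors on images of \<open>DT x\<close> only.\<close>

lemma DT_surj:
  assumes x: "x \<in> U" obtains u where "DT x u = w"
proof -
  have "inj (DT x)"
    unfolding linear_injective_0[OF DT_linear[OF x]]
  proof safe
    fix u assume "DT x u = 0"
    then show "u = 0" using T_isom[OF x, of u] x U_sub A.nondeg B.g_simps by (metis subsetD)
  qed
  then have "surj (DT x)" by (rule linear_inj_imp_surj[OF DT_linear[OF x]])
  then show thesis using that by (metis surjD)
qed

lemma DT_deriv: "x \<in> U \<Longrightarrow> ((\<lambda>y. DT y u) has_derivative (\<lambda>h. D2T x h u)) (at x)"
  using smooth_on_has_derivative[OF smooth_on_dirder[OF T_smooth]] .

lemma D2T_sym: "x \<in> U \<Longrightarrow> D2T x u v = D2T x v u"
  using dirder_commute[OF open_U T_smooth] .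

lemma T_deriv: "x \<in> U \<Longrightarrow> (T has_derivative DT x) (at x)"
  using smooth_on_has_derivative[OF T_smooth] .

lemma compose_T:
  assumes "x \<in> U" "smooth_on S' f"
  shows "((\<lambda>y. f (T y)) has_derivative (\<lambda>h. dirder (DT x h) f (T x))) (at x)"
  using has_derivative_compose[OF T_deriv[OF assms(1)], of f "frechet_derivative f (at (T x))"]
    smooth_on_has_derivative[OF assms(2)] T_sub assms(1) by blast

text \<open>The two terms with \<open>D2T\<close> arise because \<open>DT y u\<close> varies with
  \<open>y\<close> although \<open>u\<close> is constant.\<close>

lemma dg_change:
  assumes x: "x \<in> U"
  shows "A.dg x w u v = B.dg (T x) (DT x w) (DT x u) (DT x v)
    + g' (T x) (D2T x w u) (DT x v) + g' (T x) (DT x u) (D2T x w v)"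
proof -
  have *: "((\<lambda>y. g' (T y) (DT y u) (DT y v)) has_derivative
     (\<lambda>h. B.dg (T x) (DT x h) (DT x u) (DT x v)
    + g' (T x) (D2T x h u) (DT x v) + g' (T x) (DT x u) (D2T x h v))) (at x)"
    by (rule has_derivative_apply_bilinear[of "\<lambda>y. g' (T y)" "\<lambda>a b h. B.dg (T x) (DT x h) a b"])
      (use B.g_bil DT_deriv[OF x] compose_T[OF x B.g_smooth] in auto)
  have "A.dg x w u v = dirder w (\<lambda>y. g' (T y) (DT y u) (DT y v)) x"
    by (rule fun_cong[OF frechet_derivative_cong_open[OF open_U x T_isom]])
  then show ?thesis using *[THEN frechet_derivative_at, THEN fun_cong, of w] by simp
qed

text \<open>The inhomogeneous law of a connection. Inserting \<open>dg_change\<close> into the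
  Koszul formula yields six terms with \<open>D2T\<close>; by symmetry of second derivatives four of
  them cancel and the other two are equal.\<close>

theorem G_change:
  assumes x: "x \<in> U"
  shows "DT x (G x u v) = G' (T x) (DT x u) (DT x v) + D2T x u v"
proof -
  have Tx: "T x \<in> S'" and xS: "x \<in> S" using x T_sub U_sub by auto
  show ?thesis
  proof (rule B.g_cancel[OF Tx])
    fix w'
    obtain w where w: "w' = DT x w" using DT_surj[OF x] by metis
    have "2 * g' (T x) (DT x (G x u v)) w' = 2 * g x (G x u v) w"
      using T_isom[OF x] w by simp
    also have "\<dots> = 2 * g' (T x) (G' (T x) (DT x u) (DT x v)) w' + 2 * g' (T x) (D2T x u v) w'"
      unfolding A.koszul[OF xS] B.koszul[OF Tx] dg_change[OF x] w
      by (simp add: D2T_sym[OF x, of v u] D2T_sym[OF x, of w u] D2T_sym[OF x, of w v]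
        B.g_sym[OF Tx, of "DT x v"] B.g_sym[OF Tx, of "DT x u"])
    finally show "g' (T x) (DT x (G x u v)) w' = g' (T x) (G' (T x) (DT x u) (DT x v) + D2T x u v) w'"
      by (simp add: B.g_simps)
  qed
qed

text \<open>Differentiating \<open>G_change\<close> produces third derivatives of \<open>T\<close>
  and products with \<open>D2T\<close>; antisymmetrization in \<open>u\<close> and \<open>v\<close>
  removes all of them, which makes the curvature a tensor.\<close>

theorem Rm_change:
  assumes x: "x \<in> U"
  shows "DT x (A.Rm x u v w) = B.Rm (T x) (DT x u) (DT x v) (DT x w)"
proof -
  have Tx: "T x \<in> S'" and xS: "x \<in> S" using x T_sub U_sub by auto
  have D: "D2T x u (G x v w) + DT x (A.dG x u v w) =
     B.dG (T x) (DT x u) (DT x v) (DT x w) + G' (T x) (D2T x u v) (DT x w) + G' (T x) (DT x v) (D2T x u w)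
     + dirder u (\<lambda>y. D2T y v w) x" for u v w
  proof -
    \<comment> \<open>Taken within \<open>U\<close>, since \<open>DT y\<close> is known to be linear
      only there; \<open>U\<close> is open, so the restriction is lifted in
      \<open>L'\<close>.\<close>
    have L: "((\<lambda>y. DT y (G y v w)) has_derivative
       (\<lambda>h. D2T x h (G x v w) + DT x (A.dG x h v w))) (at x within U)"
      by (rule has_derivative_apply_linear[of DT "\<lambda>a h. D2T x h a"])
        (use DT_linear x has_derivative_at_withinI[OF DT_deriv[OF x]]
           has_derivative_at_withinI[OF smooth_on_has_derivative[OF A.G_smooth xS]] in auto)
    have R: "((\<lambda>y. G' (T y) (DT y v) (DT y w) + D2T y v w) has_derivative
       (\<lambda>h. B.dG (T x) (DT x h) (DT x v) (DT x w) + G' (T x) (D2T x h v) (DT x w)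
         + G' (T x) (DT x v) (D2T x h w) + dirder h (\<lambda>y. D2T y v w) x)) (at x)"
      by (intro has_derivative_add smooth_on_has_derivative[OF _ x] smooth_on_dirder T_smooth
          has_derivative_apply_bilinear[of "\<lambda>y. G' (T y)" "\<lambda>a b h. B.dG (T x) (DT x h) a b"])
        (use B.G_bil DT_deriv[OF x] compose_T[OF x B.G_smooth] in auto)
    have L': "((\<lambda>y. DT y (G y v w)) has_derivative
       (\<lambda>h. D2T x h (G x v w) + DT x (A.dG x h v w))) (at x)"
      using L at_within_open[OF x open_U] by simp
    have "((\<lambda>y. G' (T y) (DT y v) (DT y w) + D2T y v w) has_derivative
       (\<lambda>h. D2T x h (G x v w) + DT x (A.dG x h v w))) (at x)"
      by (rule has_derivative_transform_within_open[OF L' open_U x]) (rule G_change)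
    from fun_cong[OF has_derivative_unique[OF this R], of u] show ?thesis by simp
  qed
  have D': "DT x (A.dG x u v w) =
     B.dG (T x) (DT x u) (DT x v) (DT x w) + G' (T x) (D2T x u v) (DT x w) + G' (T x) (DT x v) (D2T x u w)
     + dirder u (\<lambda>y. D2T y v w) x - D2T x u (G x v w)" for u v w
    using D[of v w u] by (simp add: eq_diff_eq add.commute)
  have s: "dirder u (\<lambda>y. D2T y v w) x = dirder v (\<lambda>y. D2T y u w) x" for u v
    \<comment> \<open>Third derivatives commute by applying the symmetry of second derivatives to a
      first derivative of \<open>T\<close>.\<close>
    using dirder_commute[OF open_U smooth_on_dirder[OF T_smooth] x] .
  have GG: "DT x (G x u (G x v w)) = G' (T x) (DT x u) (G' (T x) (DT x v) (DT x w))
     + G' (T x) (DT x u) (D2T x v w) + D2T x u (G x v w)" for u v w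
    by (simp add: G_change[OF x] B.G_simps)
  show ?thesis
    by (simp add: A.Rm_def B.Rm_def linear_add[OF DT_linear[OF x]] linear_diff[OF DT_linear[OF x]]
        D' GG s[of u v] D2T_sym[OF x, of u v])
qed

end

section \<open>Charts of a spacetime\<close>

lemma bilinear_metric_form: "bilinear (metric_form M c x)"
  by (auto simp: bilinear_def metric_form_def inner_add_left inner_add_right
      matrix_vector_right_distrib matrix_vector_mult_scaleR intro!: linearI)

lemma bilinear_Gam: "bilinear (Gam M c x)"
  by (auto simp: bilinear_def Gam_def vec_eq_iff sum.distrib algebra_simps sum_distrib_left intro!: linearI)

lemma linear_curv: "linear (\<lambda>u. curv M c x u v w)"
  by (auto intro!: linearI simp: curv_def vec_eq_iff sum.distrib algebra_simps sum_distrib_left)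

lemma dirder_sum_axis:
  assumes "smooth_on S f" "x \<in> S"
  shows "dirder (w :: real^4) f x = (\<Sum>l\<in>UNIV. w $ l *\<^sub>R dirder (axis l 1) f x)"
proof -
  have "dirder w f x = frechet_derivative f (at x) (\<Sum>l\<in>UNIV. w $ l *\<^sub>R axis l 1)"
    using basis_expansion[of w] by (simp add: scalar_mult_eq_scaleR)
  then show ?thesis
    by (simp add: linear_sum[OF smooth_on_linear[OF assms]] linear_cmul[OF smooth_on_linear[OF assms]])
qed

lemma sum_swap3: "(\<Sum>i\<in>A. \<Sum>j\<in>B. \<Sum>k\<in>C. f i j k) = (\<Sum>j\<in>B. \<Sum>k\<in>C. \<Sum>i\<in>A. f i j k)"
  by (subst sum.swap) (intro sum.cong refl sum.swap)

section \<open>Smoothness of determinants and inverse matrices\<close>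

lemma smooth_on_det:
  fixes A :: "'a::real_normed_vector \<Rightarrow> real^'n^'n"
  assumes "open S" "\<And>i j. smooth_on S (\<lambda>x. A x $ i $ j)"
  shows "smooth_on S (\<lambda>x. det (A x))"
  unfolding det_def
  by (intro smooth_on_sum smooth_on_mult smooth_on_prod smooth_on_const assms)

lemma matrix_inv_right: "invertible A \<Longrightarrow> A ** matrix_inv A = mat 1"
  unfolding invertible_def matrix_inv_def by (rule someI2_ex) auto

text \<open>By Cramer's rule the entries of the inverse are quotients of polynomials in the entries,
  so their smoothness reduces to sums, products and one reciprocal.\<close>

lemma matrix_inv_cramer:
  fixes A :: "real^'n^'n"
  assumes "det A \<noteq> 0"
  shows "matrix_inv A $ i $ l = det (\<chi> r s. if s = i then axis l 1 $ r else A $ r $ s) / det A"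
proof -
  have "A *v (matrix_inv A *v axis l 1) = axis l 1"
    using assms by (simp add: matrix_vector_mul_assoc matrix_inv_right invertible_det_nz)
  then have "matrix_inv A *v axis l 1 = (\<chi> k. det (\<chi> r s. if s = k then axis l 1 $ r else A $ r $ s) / det A)"
    by (simp add: cramer[OF assms])
  then show ?thesis by (simp add: matrix_vector_mult_basis vec_eq_iff column_def)
qed

lemma smooth_on_matrix_inv:
  fixes A :: "'a::real_normed_vector \<Rightarrow> real^'n^'n"
  assumes S: "open S" and A: "\<And>i j. smooth_on S (\<lambda>x. A x $ i $ j)" and nz: "\<And>x. x \<in> S \<Longrightarrow> det (A x) \<noteq> 0"
  shows "smooth_on S (\<lambda>x. matrix_inv (A x) $ i $ l)"
proof (rule smooth_on_cong[OF S])
  show "smooth_on S (\<lambda>x. det (\<chi> r s. if s = i then axis l 1 $ r else A x $ r $ s) * inverse (det (A x)))"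
  proof (intro smooth_on_mult smooth_on_inverse smooth_on_det S A nz)
    show "smooth_on S (\<lambda>x. (\<chi> r s. if s = i then axis l 1 $ r else A x $ r $ s) $ r $ s)" for r s
      using A smooth_on_const by (cases "s = i") auto
  qed
qed (simp only: matrix_inv_cramer[OF nz] divide_inverse)

section \<open>Charts and the coordinate expressions of metric, connection and curvature\<close>

locale spacetime =
  fixes M :: "'a::{t2_space,second_countable_topology} spacetime"
  assumes st: "is_spacetime M"
begin

abbreviation cimg where "cimg c \<equiv> cmap c ` cdom c"

lemma atlas: "smooth_atlas (atlas M)" and lorentz: "lorentz_metric M"
  using st by (auto simp: is_spacetime_def)

lemma charts_at_iff: "c \<in> charts_at M p \<longleftrightarrow> c \<in> atlas M \<and> p \<in> cdom c"
  by (auto simp: charts_at_def)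

lemma chart_at: "chart_at M p \<in> charts_at M p"
proof -
  obtain c where "c \<in> charts_at M p"
    using atlas unfolding smooth_atlas_def charts_at_iff by blast
  then show ?thesis unfolding chart_at_def by (rule someI)
qed

lemma open_cdom: "c \<in> atlas M \<Longrightarrow> open (cdom c)" and open_cimg: "c \<in> atlas M \<Longrightarrow> open (cimg c)"
  using atlas unfolding smooth_atlas_def by auto

lemma chart_homeo:
  assumes "c \<in> atlas M" obtains \<psi> where "homeomorphism (cdom c) (cimg c) (cmap c) \<psi>"
  using atlas assms unfolding smooth_atlas_def by blast

lemma inj_on_cmap: "c \<in> atlas M \<Longrightarrow> inj_on (cmap c) (cdom c)"
  by (erule chart_homeo) (auto simp: homeomorphism_def inj_on_def, metis)

lemma continuous_on_cmap: "c \<in> atlas M \<Longrightarrow> continuous_on (cdom c) (cmap c)"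
  by (erule chart_homeo) (rule homeomorphism_cont1)

lemma transition_cmap: "c \<in> atlas M \<Longrightarrow> p \<in> cdom c \<Longrightarrow> transition c d (cmap c p) = cmap d p"
  using inv_into_f_f[OF inj_on_cmap] by (simp add: transition_def)

lemma open_cmap_image:
  assumes "c \<in> atlas M" "open W" shows "open (cmap c ` (cdom c \<inter> W))"
proof -
  obtain \<psi> where "homeomorphism (cdom c) (cimg c) (cmap c) \<psi>" using chart_homeo[OF assms(1)] .
  then have "openin (top_of_set (cimg c)) (cmap c ` (cdom c \<inter> W))"
    by (rule homeomorphism_imp_open_map) (simp add: assms(2) openin_open_Int)
  then show ?thesis using open_cimg[OF assms(1)] openin_open_trans by blast
qed

lemma smooth_transition:
  "c \<in> atlas M \<Longrightarrow> d \<in> atlas M \<Longrightarrow> smooth_on (cmap c ` (cdom c \<inter> cdom d)) (transition c d)"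
  using atlas unfolding smooth_atlas_def by blast

lemma metric_sym:
  assumes "c \<in> atlas M" "x \<in> cimg c" shows "transpose (metric M c x) = metric M c x"
  using assms lorentz unfolding lorentz_metric_def by blast

lemma metric_form_sym:
  assumes "c \<in> atlas M" "x \<in> cimg c" shows "metric_form M c x u v = metric_form M c x v u"
  unfolding metric_form_def
  by (metis dot_lmul_matrix inner_commute metric_sym[OF assms] transpose_matrix_vector)

text \<open>Pairing with a pseudo-orthonormal frame \<open>e\<close> recovers the coefficients of a
  combination of the \<open>e i\<close> up to sign. So \<open>e\<close> is a basis, and the
  coefficients of \<open>u\<close> in it vanish.\<close>

lemma metric_nondeg:
  assumes c: "c \<in> atlas M" "x \<in> cimg c" and z: "\<And>v. metric_form M c x u v = 0"
  shows "u = 0"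
proof -
  note b = bilinear_metric_form[of M c x]
  obtain e :: "4 \<Rightarrow> real^4" where e: "\<And>i j. metric_form M c x (e i) (e j) =
           (if i \<noteq> j then 0 else if i = 0 then 1 else -1)"
    using lorentz c unfolding lorentz_metric_def by blast
  let ?F = "\<lambda>a :: real^4. \<Sum>i\<in>UNIV. (a $ i) *\<^sub>R e i"
  have L: "linear ?F" by (auto intro!: linearI simp: algebra_simps sum.distrib scaleR_sum_right)
  have m: "metric_form M c x (?F a) (e j) = (if j = 0 then a $ j else - a $ j)" for a j
  proof -
    have l: "linear (\<lambda>v. metric_form M c x v (e j))" using b by (simp add: bilinear_def)
    have "metric_form M c x (?F a) (e j) = (\<Sum>i\<in>UNIV. a $ i * metric_form M c x (e i) (e j))"
      using linear_sum[OF l, of "\<lambda>i. (a $ i) *\<^sub>R e i" UNIV] by (simp add: linear_cmul[OF l])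
    also have "\<dots> = (\<Sum>i\<in>UNIV. if j = i then (if j = 0 then a $ j else - a $ j) else 0)"
      by (intro sum.cong) (auto simp: e)
    finally show ?thesis by simp
  qed
  have "inj ?F"
    unfolding linear_injective_0[OF L]
  proof safe
    fix a assume "?F a = 0"
    then have "(if j = 0 then a $ j else - a $ j) = 0" for j
      using m[of a j] by (simp add: bilinear_lzero[OF b])
    then have "a $ j = 0" for j by (metis neg_equal_0_iff_equal)
    then show "a = 0" by (simp add: vec_eq_iff)
  qed
  then obtain a where a: "u = ?F a"
    using surjD[OF linear_inj_imp_surj[OF L], of u] by blast
  have "(if j = 0 then a $ j else - a $ j) = 0" for j
    using m[of a j] z[of "e j"] a by simp
  then have "a $ j = 0" for j by (metis neg_equal_0_iff_equal)
  then have "a = 0" by (simp add: vec_eq_iff)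
  then show ?thesis using a by simp
qed

lemma det_metric_nz:
  assumes c: "c \<in> atlas M" "x \<in> cimg c" shows "det (metric M c x) \<noteq> 0"
proof -
  have "v = 0" if "metric M c x *v v = 0" for v
    using metric_nondeg[OF c, of v] metric_form_sym[OF c, of v] that by (simp add: metric_form_def)
  then show ?thesis
    by (simp add: invertible_det_nz[symmetric] invertible_left_inverse matrix_left_invertible_ker)
qed

lemma smooth_metric: "c \<in> atlas M \<Longrightarrow> smooth_on (cimg c) (\<lambda>x. metric M c x $ i $ j)"
  using lorentz unfolding lorentz_metric_def
  by (intro smooth_on_vec_nth open_cimg) auto

lemma metric_form_sum: "metric_form M c x u v = (\<Sum>i\<in>UNIV. \<Sum>j\<in>UNIV. metric M c x $ i $ j * (u $ i * v $ j))"
  unfolding metric_form_def inner_vec_def matrix_vector_mult_def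
  by (simp add: sum_distrib_left algebra_simps)

lemma smooth_metric_form: "c \<in> atlas M \<Longrightarrow> smooth_on (cimg c) (\<lambda>x. metric_form M c x u v)"
  unfolding metric_form_sum
  by (intro smooth_on_sum smooth_on_mult smooth_on_const smooth_metric open_cimg)

lemma smooth_christoffel: "c \<in> atlas M \<Longrightarrow> smooth_on (cimg c) (\<lambda>x. christoffel M c x i j k)"
  unfolding christoffel_def pderiv_at_def
  by (intro smooth_on_sum smooth_on_mult smooth_on_const smooth_on_add smooth_on_diff smooth_on_dirder
     smooth_on_matrix_inv smooth_metric det_metric_nz open_cimg)

lemma Gam_sum: "Gam M c x u v = (\<Sum>i\<in>UNIV. (\<Sum>j\<in>UNIV. \<Sum>k\<in>UNIV. christoffel M c x i j k * (u $ j * v $ k)) *\<^sub>R axis i 1)"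
  using basis_expansion[of "Gam M c x u v"] by (simp add: scalar_mult_eq_scaleR Gam_def mult.assoc)

lemma smooth_Gam: "c \<in> atlas M \<Longrightarrow> smooth_on (cimg c) (\<lambda>x. Gam M c x u v)"
  unfolding Gam_sum
  by (intro smooth_on_sum smooth_on_scaleR_const smooth_on_mult smooth_on_const smooth_christoffel open_cimg)

lemma dirder_metric_form:
  assumes c: "c \<in> atlas M" "x \<in> cimg c"
  shows "dirder w (\<lambda>y. metric_form M c y u v) x =
     (\<Sum>l\<in>UNIV. \<Sum>i\<in>UNIV. \<Sum>j\<in>UNIV. pderiv_at l (\<lambda>y. metric M c y $ i $ j) x * (w $ l * u $ i * v $ j))"
proof -
  have "((\<lambda>y. metric_form M c y u v) has_derivative
     (\<lambda>h. \<Sum>i\<in>UNIV. \<Sum>j\<in>UNIV. dirder h (\<lambda>y. metric M c y $ i $ j) x * (u $ i * v $ j))) (at x)"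
    unfolding metric_form_sum
    by (intro has_derivative_sum has_derivative_mult_left smooth_on_has_derivative[OF smooth_metric[OF c(1)] c(2)])
  from frechet_derivative_at[OF this, THEN fun_cong, of w]
  have "dirder w (\<lambda>y. metric_form M c y u v) x =
    (\<Sum>i\<in>UNIV. \<Sum>j\<in>UNIV. \<Sum>l\<in>UNIV. pderiv_at l (\<lambda>y. metric M c y $ i $ j) x * (w $ l * u $ i * v $ j))"
    by (simp add: dirder_sum_axis[OF smooth_metric[OF c(1)] c(2), where w=w] pderiv_at_def sum_distrib_left sum_distrib_right algebra_simps)
  also have "\<dots> = (\<Sum>l\<in>UNIV. \<Sum>i\<in>UNIV. \<Sum>j\<in>UNIV. pderiv_at l (\<lambda>y. metric M c y $ i $ j) x * (w $ l * u $ i * v $ j))"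
    by (rule sum_swap3[symmetric])
  finally show ?thesis .
qed

text \<open>Lowering the upper index cancels \<open>matrix_inv\<close> and leaves Christoffel
  symbols of the first kind, in which the Koszul formula can be recognized.\<close>

lemma metric_Gam:
  assumes c: "c \<in> atlas M" "x \<in> cimg c"
  shows "2 * metric_form M c x w (Gam M c x u v) =
    (\<Sum>l\<in>UNIV. \<Sum>j\<in>UNIV. \<Sum>k\<in>UNIV. (pderiv_at j (\<lambda>y. metric M c y $ l $ k) x
      + pderiv_at k (\<lambda>y. metric M c y $ l $ j) x - pderiv_at l (\<lambda>y. metric M c y $ j $ k) x) * (w $ l * u $ j * v $ k))"
proof -
  let ?A = "metric M c x"
  define C where "C l j k = pderiv_at j (\<lambda>y. metric M c y $ l $ k) x
      + pderiv_at k (\<lambda>y. metric M c y $ l $ j) x - pderiv_at l (\<lambda>y. metric M c y $ j $ k) x" for l j k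
  have "Gam M c x u v = matrix_inv ?A *v (\<chi> l. \<Sum>j\<in>UNIV. \<Sum>k\<in>UNIV. (1/2 * C l j k) * (u $ j * v $ k))"
  proof -
    have "Gam M c x u v $ i = (\<Sum>j\<in>UNIV. \<Sum>k\<in>UNIV. \<Sum>l\<in>UNIV. matrix_inv ?A $ i $ l * ((1/2 * C l j k) * (u $ j * v $ k)))" for i
      by (simp add: Gam_def christoffel_def C_def[symmetric] sum_distrib_left sum_distrib_right algebra_simps)
    also have "\<dots> i = (\<Sum>l\<in>UNIV. \<Sum>j\<in>UNIV. \<Sum>k\<in>UNIV. matrix_inv ?A $ i $ l * ((1/2 * C l j k) * (u $ j * v $ k)))" for i
      by (rule sum_swap3[symmetric])
    finally show ?thesis
      by (simp add: vec_eq_iff matrix_vector_mult_def sum_distrib_left)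
  qed
  then have "?A *v Gam M c x u v = (\<chi> l. \<Sum>j\<in>UNIV. \<Sum>k\<in>UNIV. (1/2 * C l j k) * (u $ j * v $ k))"
    using det_metric_nz[OF c] by (simp add: matrix_vector_mul_assoc matrix_inv_right invertible_det_nz)
  then show ?thesis
    by (simp add: metric_form_def inner_vec_def C_def[symmetric] sum_distrib_left algebra_simps)
qed

lemma koszul_chart:
  assumes c: "c \<in> atlas M" "x \<in> cimg c"
  shows "2 * metric_form M c x (Gam M c x u v) w =
    dirder u (\<lambda>y. metric_form M c y v w) x + dirder v (\<lambda>y. metric_form M c y u w) x
     - dirder w (\<lambda>y. metric_form M c y u v) x"
proof -
  let ?d = "\<lambda>l i j. pderiv_at l (\<lambda>y. metric M c y $ i $ j) x"
  have s: "?d l i j = ?d l j i" for l i j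
  proof -
    have "metric M c y $ i $ j = metric M c y $ j $ i" if "y \<in> cimg c" for y
      using arg_cong[OF metric_sym[OF c(1) that], of "\<lambda>A. A $ j $ i"] by (simp add: transpose_def)
    then show ?thesis
      unfolding pderiv_at_def by (intro fun_cong[OF frechet_derivative_cong_open[OF open_cimg[OF c(1)] c(2)]])
  qed
  have 1: "dirder u (\<lambda>y. metric_form M c y v w) x = (\<Sum>l\<in>UNIV. \<Sum>j\<in>UNIV. \<Sum>k\<in>UNIV. ?d j l k * (w $ l * u $ j * v $ k))"
    unfolding dirder_metric_form[OF c] by (subst sum_swap3[symmetric]) (simp add: algebra_simps s)
  have 2: "dirder v (\<lambda>y. metric_form M c y u w) x = (\<Sum>l\<in>UNIV. \<Sum>j\<in>UNIV. \<Sum>k\<in>UNIV. ?d k l j * (w $ l * u $ j * v $ k))"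
    \<comment> \<open>The sums are permuted until the differentiated index comes last, the order in
      which \<open>metric_Gam\<close> is written.\<close>
    unfolding dirder_metric_form[OF c] by (subst sum_swap3, subst sum.swap, subst sum_swap3[symmetric], intro sum.cong refl) (simp add: algebra_simps s)
  show ?thesis
    unfolding metric_form_sym[OF c, of "Gam M c x u v" w] metric_Gam[OF c] 1 2 dirder_metric_form[OF c, where w=w]
    by (simp add: sum.distrib sum_subtractf algebra_simps)
qed

lemma coord_metric:
  assumes c: "c \<in> atlas M" shows "coord_metric (cimg c) (metric_form M c) (Gam M c)"
proof
qed (use c open_cimg bilinear_metric_form bilinear_Gam metric_form_sym metric_nondeg
     smooth_metric_form smooth_Gam koszul_chart in auto)

text \<open>Identifies the index formula for the curvature with the invariant \<open>Rm\<close>, so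
  that its symmetries and its transformation law become available.\<close>

lemma curv_eq_Rm:
  assumes c: "c \<in> atlas M" "x \<in> cimg c"
  shows "curv M c x u v w = coord_metric.Rm (Gam M c) x u v w"
proof -
  interpret coord_metric "cimg c" "metric_form M c" "Gam M c" by (rule coord_metric[OF c(1)])
  have dG: "dG x u v w $ i = (\<Sum>j\<in>UNIV. \<Sum>k\<in>UNIV. \<Sum>l\<in>UNIV.
      pderiv_at k (\<lambda>y. christoffel M c y i l j) x * (w $ j * u $ k * v $ l))" for u v w i
  proof -
    have 1: "((\<lambda>y. Gam M c y v w $ i) has_derivative (\<lambda>h. dG x h v w $ i)) (at x)"
      by (rule bounded_linear.has_derivative[OF bounded_linear_vec_nth smooth_on_has_derivative[OF smooth_Gam[OF c(1)] c(2)]])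
    have "((\<lambda>y. \<Sum>l\<in>UNIV. \<Sum>j\<in>UNIV. christoffel M c y i l j * v $ l * w $ j) has_derivative
     (\<lambda>h. \<Sum>l\<in>UNIV. \<Sum>j\<in>UNIV. dirder h (\<lambda>y. christoffel M c y i l j) x * v $ l * w $ j)) (at x)"
      by (intro has_derivative_sum has_derivative_mult_left smooth_on_has_derivative[OF smooth_christoffel[OF c(1)] c(2)])
    then have "((\<lambda>y. Gam M c y v w $ i) has_derivative
     (\<lambda>h. \<Sum>l\<in>UNIV. \<Sum>j\<in>UNIV. dirder h (\<lambda>y. christoffel M c y i l j) x * v $ l * w $ j)) (at x)"
      by (simp add: Gam_def)
    from fun_cong[OF has_derivative_unique[OF 1 this], of u]
    have "dG x u v w $ i = (\<Sum>l\<in>UNIV. \<Sum>j\<in>UNIV. \<Sum>k\<in>UNIV.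
      pderiv_at k (\<lambda>y. christoffel M c y i l j) x * (w $ j * u $ k * v $ l))"
      by (simp add: dirder_sum_axis[OF smooth_christoffel[OF c(1)] c(2), where w=u] pderiv_at_def sum_distrib_left sum_distrib_right algebra_simps)
    also have "\<dots> = (\<Sum>j\<in>UNIV. \<Sum>k\<in>UNIV. \<Sum>l\<in>UNIV.
      pderiv_at k (\<lambda>y. christoffel M c y i l j) x * (w $ j * u $ k * v $ l))"
      by (rule sum_swap3)
    finally show ?thesis .
  qed
  have GG: "Gam M c x u (Gam M c x v w) $ i = (\<Sum>j\<in>UNIV. \<Sum>k\<in>UNIV. \<Sum>l\<in>UNIV.
     (\<Sum>m\<in>UNIV. christoffel M c x i k m * christoffel M c x m l j) * (w $ j * u $ k * v $ l))" for u v w i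
  proof -
    have "Gam M c x u (Gam M c x v w) $ i = (\<Sum>k\<in>UNIV. \<Sum>m\<in>UNIV. \<Sum>l\<in>UNIV. \<Sum>j\<in>UNIV.
      christoffel M c x i k m * christoffel M c x m l j * (w $ j * u $ k * v $ l))"
      by (simp add: Gam_def sum_distrib_left algebra_simps)
    also have "\<dots> = (\<Sum>k\<in>UNIV. \<Sum>l\<in>UNIV. \<Sum>j\<in>UNIV. \<Sum>m\<in>UNIV.
      christoffel M c x i k m * christoffel M c x m l j * (w $ j * u $ k * v $ l))"
      by (intro sum.cong refl sum_swap3)
    also have "\<dots> = (\<Sum>j\<in>UNIV. \<Sum>k\<in>UNIV. \<Sum>l\<in>UNIV. \<Sum>m\<in>UNIV.
      christoffel M c x i k m * christoffel M c x m l j * (w $ j * u $ k * v $ l))"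
      by (rule sum_swap3[symmetric])
    finally show ?thesis by (simp add: sum_distrib_right)
  qed
  \<comment> \<open>Exchanging \<open>u\<close> and \<open>v\<close> amounts to exchanging the
    summation indices \<open>k\<close> and \<open>l\<close>.\<close>
  have d2: "dG x v u w $ i = (\<Sum>j\<in>UNIV. \<Sum>k\<in>UNIV. \<Sum>l\<in>UNIV.
      pderiv_at l (\<lambda>y. christoffel M c y i k j) x * (w $ j * u $ k * v $ l))" for i
    unfolding dG by (rule sum.cong[OF refl], subst sum.swap) (simp add: mult_ac)
  have g2: "Gam M c x v (Gam M c x u w) $ i = (\<Sum>j\<in>UNIV. \<Sum>k\<in>UNIV. \<Sum>l\<in>UNIV.
     (\<Sum>m\<in>UNIV. christoffel M c x i l m * christoffel M c x m k j) * (w $ j * u $ k * v $ l))" for i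
    unfolding GG by (rule sum.cong[OF refl], subst sum.swap) (simp add: mult_ac)
  show ?thesis
  proof (rule vec_eq_iff[THEN iffD2, rule_format])
    fix i
    have "curv M c x u v w $ i = (\<Sum>j\<in>UNIV. \<Sum>k\<in>UNIV. \<Sum>l\<in>UNIV.
        pderiv_at k (\<lambda>y. christoffel M c y i l j) x * (w $ j * u $ k * v $ l)
      - pderiv_at l (\<lambda>y. christoffel M c y i k j) x * (w $ j * u $ k * v $ l)
      + ((\<Sum>m\<in>UNIV. christoffel M c x i k m * christoffel M c x m l j) * (w $ j * u $ k * v $ l)
       - (\<Sum>m\<in>UNIV. christoffel M c x i l m * christoffel M c x m k j) * (w $ j * u $ k * v $ l)))"
      unfolding curv_def riemann_def sum_subtractf vec_lambda_beta
      by (simp only: mult.assoc distrib_right left_diff_distrib)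
    then show "curv M c x u v w $ i = Rm x u v w $ i"
      unfolding Rm_def vector_minus_component vector_add_component dG[where u=u and v=v and w=w] d2
        GG[of u v w] g2 sum.distrib sum_subtractf by simp
  qed
qed

lemma coord_change:
  assumes c: "c \<in> atlas M" and d: "d \<in> atlas M"
  shows "coord_change (cimg c) (metric_form M c) (Gam M c) (cimg d) (metric_form M d) (Gam M d)
    (cmap c ` (cdom c \<inter> cdom d)) (transition c d)"
  unfolding coord_change_def coord_change_axioms_def
proof (intro conjI allI impI coord_metric c d open_cmap_image open_cdom smooth_transition)
  show "transition c d ` cmap c ` (cdom c \<inter> cdom d) \<subseteq> cimg d"
    using transition_cmap[OF c] by auto
  fix x u v assume "x \<in> cmap c ` (cdom c \<inter> cdom d)"
  then obtain p where p: "x = cmap c p" "c \<in> charts_at M p" "d \<in> charts_at M p"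
    using c d by (auto simp: charts_at_iff)
  have "transition c d x = cmap d p" using transition_cmap[OF c, of p d] p by (simp add: charts_at_iff)
  moreover have "metric_form M c (cmap c p) u v = metric_form M d (cmap d p)
    (dirder u (transition c d) (cmap c p)) (dirder v (transition c d) (cmap c p))"
    using lorentz p(2,3) unfolding lorentz_metric_def Let_def by blast
  ultimately show "metric_form M c x u v = metric_form M d (transition c d x) (dirder u (transition c d) x) (dirder v (transition c d) x)"
    using p(1) by simp
qed blast

end

section \<open>Linear ordinary differential equations\<close>

text \<open>Continuity is assumed for each fixed vector only. Bounds on the finitely many basis
  vectors add up to a bound on the operators that is uniform in \<open>t\<close>.\<close>

lemma linear_bound_on_interval:
  fixes A :: "real \<Rightarrow> 'e::euclidean_space \<Rightarrow> 'e"
  assumes lin: "\<And>t. t \<in> {a..b} \<Longrightarrow> linear (A t)" and cont: "\<And>v. continuous_on {a..b} (\<lambda>t. A t v)"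
  obtains K where "K \<ge> 0" "\<And>t v. t \<in> {a..b} \<Longrightarrow> norm (A t v) \<le> K * norm v"
proof -
  have "\<exists>B\<ge>0. \<forall>t\<in>{a..b}. norm (A t i) \<le> B" for i
  proof -
    have "bounded ((\<lambda>t. A t i) ` {a..b})"
      by (intro compact_imp_bounded compact_continuous_image cont) simp
    then obtain B where "\<forall>t\<in>{a..b}. norm (A t i) \<le> B" unfolding bounded_iff by auto
    then show ?thesis by (intro exI[of _ "max 0 B"]) auto
  qed
  then obtain B where B: "\<And>i. B i \<ge> 0" "\<And>i t. t \<in> {a..b} \<Longrightarrow> norm (A t i) \<le> B i" by metis
  show thesis
  proof
    show "(\<Sum>i\<in>Basis. B i) \<ge> 0" by (simp add: B sum_nonneg)
    fix t v assume t: "t \<in> {a..b}"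
    have "A t v = (\<Sum>i\<in>Basis. (v \<bullet> i) *\<^sub>R A t i)"
      using linear_sum[OF lin[OF t], of "\<lambda>i. (v \<bullet> i) *\<^sub>R i" Basis] linear_cmul[OF lin[OF t]]
      by (simp add: euclidean_representation)
    also have "norm \<dots> \<le> (\<Sum>i\<in>Basis. norm v * B i)"
      by (intro order_trans[OF norm_sum] sum_mono) (simp add: mult_mono B(2)[OF t] Basis_le_norm)
    finally show "norm (A t v) \<le> (\<Sum>i\<in>Basis. B i) * norm v"
      by (simp add: sum_distrib_left mult.commute)
  qed
qed

lemma continuous_on_apply_linear:
  fixes A :: "'t::topological_space \<Rightarrow> 'e::euclidean_space \<Rightarrow> 'c::real_normed_vector"
  assumes lin: "\<And>t. t \<in> S \<Longrightarrow> linear (A t)" and cont: "\<And>v. continuous_on S (\<lambda>t. A t v)"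
    and x: "continuous_on S x"
  shows "continuous_on S (\<lambda>t. A t (x t))"
proof -
  have "continuous_on S (\<lambda>t. \<Sum>i\<in>Basis. (x t \<bullet> i) *\<^sub>R A t i)"
    by (intro continuous_intros x cont)
  then show ?thesis
  proof (rule continuous_on_eq)
    fix t assume t: "t \<in> S"
    show "(\<Sum>i\<in>Basis. (x t \<bullet> i) *\<^sub>R A t i) = A t (x t)"
      using linear_sum[OF lin[OF t], of "\<lambda>i. (x t \<bullet> i) *\<^sub>R i" Basis] linear_cmul[OF lin[OF t]]
      by (simp add: euclidean_representation)
  qed
qed

text \<open>Picard iteration. By linearity the corrections are bounded by
  \<open>norm x0 * ((K * (t - a)) ^ n / fact n)\<close>, so they sum up on the whole interval,
  however long, and no continuation argument arises.\<close>

theorem linear_ode_exists: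
  fixes A :: "real \<Rightarrow> 'e::euclidean_space \<Rightarrow> 'e"
  assumes ab: "a \<le> b" and lin: "\<And>t. t \<in> {a..b} \<Longrightarrow> linear (A t)"
    and cont: "\<And>v. continuous_on {a..b} (\<lambda>t. A t v)"
  obtains x where "x a = x0" "\<And>t. t \<in> {a..b} \<Longrightarrow> (x has_vector_derivative A t (x t)) (at t within {a..b})"
proof -
  obtain K where K: "K \<ge> 0" "\<And>t v. t \<in> {a..b} \<Longrightarrow> norm (A t v) \<le> K * norm v"
    using linear_bound_on_interval[of a b A] lin cont by blast
  have contA: "continuous_on {a..b} (\<lambda>t. A t (x t))" if "continuous_on {a..b} x" for x
    by (rule continuous_on_apply_linear[OF lin cont that])
  \<comment> \<open>\<open>X n\<close> is the n-th correction, not the n-th iterate; the iterates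
    are the partial sums.\<close>
  define X where "X = rec_nat (\<lambda>t. x0) (\<lambda>_ f t. integral {a..t} (\<lambda>s. A s (f s)))"
  have X0: "X 0 = (\<lambda>t. x0)" and XS: "X (Suc n) = (\<lambda>t. integral {a..t} (\<lambda>s. A s (X n s)))" for n
    by (simp_all add: X_def)
  have cX: "continuous_on {a..b} (X n)" for n
  proof (induction n)
    case (Suc n)
    then show ?case unfolding XS
      by (intro indefinite_integral_continuous_1 integrable_continuous_interval contA)
  qed (simp add: X0)
  have sub: "continuous_on {a..t} f" if "continuous_on {a..b} f" "t \<in> {a..b}" for t and f :: "real \<Rightarrow> 'e"
    using that by (auto intro: continuous_on_subset)
  have bX: "norm (X n t) \<le> norm x0 * ((K * (t - a)) ^ n / fact n)" if "t \<in> {a..b}" for n t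
    using that
  proof (induction n arbitrary: t)
    case (Suc n)
    let ?g = "\<lambda>s. norm x0 * ((K * (s - a)) ^ n / fact n * K)"
    have "((\<lambda>s. norm x0 * ((K * (s - a)) ^ Suc n / fact (Suc n))) has_real_derivative ?g s) (at s within {a..t})" for s
    proof -
      have "((\<lambda>s. norm x0 * ((K * (s - a)) ^ Suc n / fact (Suc n))) has_real_derivative
         norm x0 * ((1 + real n) * (K * (s - a)) ^ n * K / fact (Suc n))) (at s within {a..t})"
        by (auto intro!: derivative_eq_intros simp del: fact_Suc power_Suc)
      moreover have "(1 + real n) * (K * (s - a)) ^ n * K / fact (Suc n) = (K * (s - a)) ^ n / fact n * K"
        using nonzero_mult_divide_mult_cancel_left[of "1 + real n" "(K * (s - a)) ^ n * K" "fact n"]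
        by (simp add: mult.assoc)
      ultimately show ?thesis by simp
    qed
    then have I: "(?g has_integral norm x0 * ((K * (t - a)) ^ Suc n / fact (Suc n)) - norm x0 * ((K * (a - a)) ^ Suc n / fact (Suc n))) {a..t}"
      using Suc.prems by (intro fundamental_theorem_of_calculus) (auto simp: has_real_derivative_iff_has_vector_derivative)
    have "norm (X (Suc n) t) \<le> integral {a..t} ?g"
      unfolding XS
    proof (rule integral_norm_bound_integral)
      show "(\<lambda>s. A s (X n s)) integrable_on {a..t}"
        by (intro integrable_continuous_interval sub[OF contA[OF cX] Suc.prems])
      show "?g integrable_on {a..t}" using I by blast
      fix s assume s: "s \<in> {a..t}"
      have "norm (A s (X n s)) \<le> K * norm (X n s)" using K(2) s Suc.prems by auto
      also have "\<dots> \<le> K * (norm x0 * ((K * (s - a)) ^ n / fact n))"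
        using Suc s by (intro mult_left_mono K) auto
      finally show "norm (A s (X n s)) \<le> ?g s" by (simp add: algebra_simps)
    qed
    then show ?case using integral_unique[OF I] by simp
  qed (simp add: X0)
  define x where "x t = (\<Sum>n. X n t)" for t
  have U: "uniform_limit {a..b} (\<lambda>n t. \<Sum>i<n. X i t) x sequentially"
    unfolding x_def
  proof (rule Weierstrass_m_test)
    show "summable (\<lambda>n. norm x0 * ((K * (b - a)) ^ n / fact n))"
      using summable_exp[of "K * (b - a)"] by (intro summable_mult) (simp add: field_simps)
    fix n t assume t: "t \<in> {a..b}"
    have "norm x0 * ((K * (t - a)) ^ n / fact n) \<le> norm x0 * ((K * (b - a)) ^ n / fact n)"
      using t K(1) by (intro mult_left_mono divide_right_mono power_mono) auto
    then show "norm (X n t) \<le> norm x0 * ((K * (b - a)) ^ n / fact n)" using bX[OF t, of n] by simp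
  qed
  have cx: "continuous_on {a..b} x"
    by (rule uniform_limit_theorem[OF _ U]) (auto intro!: always_eventually continuous_intros cX)
  have step: "(\<Sum>i<Suc n. X i t) = x0 + integral {a..t} (\<lambda>s. A s (\<Sum>i<n. X i s))" if t: "t \<in> {a..b}" for n t
  proof (induction n)
    case 0
    have "integral {a..t} (\<lambda>s. A s 0) = integral {a..t} (\<lambda>s. 0)"
      using t by (intro integral_cong) (auto simp: linear_0[OF lin])
    then show ?case by (simp add: X0)
  next
    case (Suc n)
    have "integral {a..t} (\<lambda>s. A s (\<Sum>i<Suc n. X i s)) =
        integral {a..t} (\<lambda>s. A s (\<Sum>i<n. X i s) + A s (X n s))"
      using t by (intro integral_cong) (auto simp: linear_add[OF lin])
    also have "\<dots> = integral {a..t} (\<lambda>s. A s (\<Sum>i<n. X i s)) + X (Suc n) t"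
      unfolding XS
      by (intro integral_add integrable_continuous_interval sub[OF _ t] contA cX continuous_intros)
    finally show ?case using Suc by simp
  qed
  have eq: "x t = x0 + integral {a..t} (\<lambda>s. A s (x s))" if t: "t \<in> {a..b}" for t
  proof -
    have "uniform_limit {a..t} (\<lambda>n s. A s (\<Sum>i<n. X i s)) (\<lambda>s. A s (x s)) sequentially"
    proof (rule uniform_limitI)
      fix e :: real assume e: "e > 0"
      \<comment> \<open>Dividing by \<open>K + 1\<close> keeps the quotient meaningful for
        \<open>K = 0\<close> and the final inequality strict.\<close>
      have ev: "\<forall>\<^sub>F n in sequentially. \<forall>s\<in>{a..b}. dist (\<Sum>i<n. X i s) (x s) < e / (K + 1)"
        using uniform_limitD[OF U] e K(1) by simp
      then show "\<forall>\<^sub>F n in sequentially. \<forall>s\<in>{a..t}. dist (A s (\<Sum>i<n. X i s)) (A s (x s)) < e"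
      proof (rule eventually_mono, intro ballI)
        fix n s assume n: "\<forall>s\<in>{a..b}. dist (\<Sum>i<n. X i s) (x s) < e / (K + 1)" and s: "s \<in> {a..t}"
        have sb: "s \<in> {a..b}" using s t by auto
        have "dist (A s (\<Sum>i<n. X i s)) (A s (x s)) = norm (A s ((\<Sum>i<n. X i s) - x s))"
          by (simp add: dist_norm linear_diff[OF lin[OF sb]])
        also have "\<dots> \<le> K * norm ((\<Sum>i<n. X i s) - x s)" by (rule K(2)[OF sb])
        also have "\<dots> \<le> K * (e / (K + 1))"
          using n sb K(1) by (intro mult_left_mono) (auto simp: dist_norm less_imp_le)
        also have "\<dots> < e" using K(1) e by (simp add: field_simps)
        finally show "dist (A s (\<Sum>i<n. X i s)) (A s (x s)) < e" .
      qed
    qed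
    then obtain I J where IJ: "\<And>n. ((\<lambda>s. A s (\<Sum>i<n. X i s)) has_integral I n) {a..t}"
      "((\<lambda>s. A s (x s)) has_integral J) {a..t}" "(I \<longlongrightarrow> J) sequentially"
      by (rule uniform_limit_integral)
        (auto intro!: sub[OF _ t] contA cX continuous_intros)
    have "(\<lambda>n. x0 + I n) \<longlonglongrightarrow> x0 + J" by (intro tendsto_intros IJ)
    moreover have "x0 + I n = (\<Sum>i<Suc n. X i t)" for n
      using step[OF t, of n] integral_unique[OF IJ(1)] by simp
    moreover have "(\<lambda>n. \<Sum>i<n. X i t) \<longlonglongrightarrow> x t"
      using tendsto_uniform_limitI[OF U t] .
    then have "(\<lambda>n. \<Sum>i<Suc n. X i t) \<longlonglongrightarrow> x t" by (rule LIMSEQ_Suc)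
    ultimately have "x t = x0 + J" using LIMSEQ_unique by (metis (no_types, lifting) ext)
    then show ?thesis using integral_unique[OF IJ(2)] by simp
  qed
  show thesis
  proof
    show "x a = x0" using eq[of a] ab by simp
    fix t assume t: "t \<in> {a..b}"
    have "((\<lambda>t. x0 + integral {a..t} (\<lambda>s. A s (x s))) has_vector_derivative A t (x t)) (at t within {a..b})"
      using has_vector_derivative_add[OF has_vector_derivative_const integral_has_vector_derivative[OF contA[OF cx] t]] by simp
    then show "(x has_vector_derivative A t (x t)) (at t within {a..b})"
      by (rule has_vector_derivative_transform[OF t eq, rotated])
  qed
qed

section \<open>The smeared energy condition for a tent function\<close>

lemma has_real_derivative_max_0_sq:
  "((\<lambda>y. (max 0 y)\<^sup>2) has_real_derivative 2 * max 0 x) (at (x::real))"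
proof -
  consider "x > 0" | "x < 0" | "x = 0" by linarith
  then show ?thesis
  proof cases
    case 1
    have "((\<lambda>y. y\<^sup>2) has_real_derivative 2 * max 0 x) (at x)"
      using 1 by (auto intro!: derivative_eq_intros)
    then show ?thesis
      by (rule has_field_derivative_transform_within_open[of _ _ _ "{0<..}"]) (use 1 in auto)
  next
    case 2
    have "((\<lambda>y. 0) has_real_derivative 2 * max 0 x) (at x)" using 2 by simp
    then show ?thesis
      by (rule has_field_derivative_transform_within_open[of _ _ _ "{..<0}"]) (use 2 in auto)
  next
    case 3
    have "((\<lambda>h. (max 0 h)\<^sup>2 / h) \<longlongrightarrow> 0) (at (0::real))"
    proof (rule Lim_null_comparison)
      show "\<forall>\<^sub>F h in at (0::real). norm ((max 0 h)\<^sup>2 / h) \<le> \<bar>h\<bar>"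
        by (intro always_eventually allI) (auto simp: max_def power2_eq_square)
      show "((\<lambda>h::real. \<bar>h\<bar>) \<longlongrightarrow> 0) (at 0)" by (rule tendsto_eq_intros refl)+ simp
    qed
    then show ?thesis unfolding DERIV_def using 3 by simp
  qed
qed

text \<open>A continuously differentiable approximation of \<open>max 0\<close> vanishing up to \<open>e\<close> and affine from \<open>2 * e\<close> on.\<close>

definition smooth_pos :: "real \<Rightarrow> real \<Rightarrow> real" where
  "smooth_pos e z = ((max 0 (z - e))\<^sup>2 - (max 0 (z - 2 * e))\<^sup>2) / (2 * e)"

definition smooth_pos' :: "real \<Rightarrow> real \<Rightarrow> real" where
  "smooth_pos' e z = (max 0 (z - e) - max 0 (z - 2 * e)) / e"

lemma smooth_pos_deriv:
  assumes "e > 0" shows "(smooth_pos e has_real_derivative smooth_pos' e z) (at z)"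
proof -
  have *: "((\<lambda>z. (max 0 (z - c))\<^sup>2) has_real_derivative 2 * max 0 (z - c) * 1) (at z)" for c
    by (rule DERIV_chain2[OF has_real_derivative_max_0_sq]) (auto intro!: derivative_eq_intros)
  have "((\<lambda>z. ((max 0 (z - e))\<^sup>2 - (max 0 (z - 2 * e))\<^sup>2) / (2 * e)) has_real_derivative
    (2 * max 0 (z - e) * 1 - 2 * max 0 (z - 2 * e) * 1) / (2 * e)) (at z)"
    by (intro DERIV_cdivide DERIV_diff *)
  moreover have "(2 * max 0 (z - e) * 1 - 2 * max 0 (z - 2 * e) * 1) / (2 * e) = smooth_pos' e z"
    using assms by (simp add: smooth_pos'_def field_simps)
  ultimately show ?thesis unfolding smooth_pos_def[abs_def] by simp
qed

lemma continuous_on_smooth_pos': "continuous_on UNIV (smooth_pos' e)"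
  unfolding smooth_pos'_def[abs_def] by (cases "e = 0") (auto intro!: continuous_intros)

text \<open>The slope rises linearly from 0 at \<open>e\<close> to 1 at \<open>2 * e\<close>, so the
  asymptotic line meets the axis at the midpoint \<open>3 * e / 2\<close>.\<close>

lemma smooth_pos_affine: "e > 0 \<Longrightarrow> z \<ge> 2 * e \<Longrightarrow> smooth_pos e z = z - 3 * e / 2"
  by (simp add: smooth_pos_def power2_eq_square field_simps)

lemma smooth_pos_0: "e > 0 \<Longrightarrow> z \<le> e \<Longrightarrow> smooth_pos e z = 0"
  by (simp add: smooth_pos_def)

lemma smooth_pos'_1: "e > 0 \<Longrightarrow> z \<ge> 2 * e \<Longrightarrow> smooth_pos' e z = 1"
  by (simp add: smooth_pos'_def)

lemma smooth_pos'_0: "e > 0 \<Longrightarrow> z \<le> e \<Longrightarrow> smooth_pos' e z = 0"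
  by (simp add: smooth_pos'_def)

lemma smooth_pos'_bounds: "e > 0 \<Longrightarrow> 0 \<le> smooth_pos' e z \<and> smooth_pos' e z \<le> 1"
  by (auto simp: smooth_pos'_def max_def)

lemma smooth_pos_bounds:
  assumes "e > 0"
  shows "smooth_pos e z \<ge> 0" "smooth_pos e z \<ge> z - 3 * e / 2" "smooth_pos e z \<le> max 0 z"
proof -
  consider "z \<le> e" | "e \<le> z" "z \<le> 2 * e" | "2 * e \<le> z" by linarith
  then have "smooth_pos e z \<ge> 0 \<and> smooth_pos e z \<ge> z - 3 * e / 2 \<and> smooth_pos e z \<le> max 0 z"
  proof cases
    case 1 then show ?thesis using assms by (simp add: smooth_pos_0)
  next
    case 2
    then have q: "smooth_pos e z = (z - e)\<^sup>2 / (2 * e)" by (simp add: smooth_pos_def)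
    \<comment> \<open>The parabola is tangent to the asymptotic line at \<open>z = 2 * e\<close>:
      this square is, up to a factor, their difference.\<close>
    have "(z - 2 * e)\<^sup>2 \<ge> 0" by simp
    then have "(z - 3 * e / 2) * (2 * e) \<le> (z - e)\<^sup>2" by (simp add: power2_eq_square algebra_simps)
    moreover have "(z - e)\<^sup>2 \<le> z * (2 * e)"
      using 2 assms mult_mono[of "z - e" z "z - e" "2 * e"] by (simp add: power2_eq_square)
    ultimately show ?thesis using 2 assms by (simp add: q pos_le_divide_eq pos_divide_le_eq)
  next
    case 3 then show ?thesis using assms by (simp add: smooth_pos_affine)
  qed
  then show "smooth_pos e z \<ge> 0" "smooth_pos e z \<ge> z - 3 * e / 2" "smooth_pos e z \<le> max 0 z" by auto
qed

text \<open>The tent is \<open>max 0 (min x y)\<close> for two affine functions \<open>x\<close>,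
  \<open>y\<close>, and \<open>min x y = y - max 0 (y - x)\<close>. Replacing both maxima by
  \<open>smooth_pos\<close> gives admissible functions; dominated convergence passes to the limit in
  both integrals.\<close>

lemma smeared_tent:
  fixes \<rho> :: "real \<Rightarrow> real"
  assumes cont: "continuous_on {0..L} \<rho>"
    and smeared: "\<And>g g' :: real \<Rightarrow> real.
           (\<And>t. (g has_real_derivative g' t) (at t)) \<Longrightarrow> continuous_on UNIV g' \<Longrightarrow>
           compact (closure {t. g t \<noteq> 0}) \<Longrightarrow> closure {t. g t \<noteq> 0} \<subseteq> {0<..<L} \<Longrightarrow>
           integral {0..L} (\<lambda>t. (g t)\<^sup>2 * \<rho> t) \<ge> - Q * integral {0..L} (\<lambda>t. (g' t)\<^sup>2)"
    and l: "0 < l" "l < T" "T \<le> L"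
  shows "integral {0..l} (\<lambda>t. (t / l)\<^sup>2 * \<rho> t) + integral {l..T} (\<lambda>t. ((T - t) / (T - l))\<^sup>2 * \<rho> t)
     \<ge> - Q * (1 / l + 1 / (T - l))"
proof -
  define x y where "x t = t / l" and "y t = (T - t) / (T - l)" for t
  define x' y' where "x' = 1 / l" and "y' = - 1 / (T - l)"
  have dx: "(x has_real_derivative x') (at t)" and dy: "(y has_real_derivative y') (at t)" for t
    unfolding x_def[abs_def] y_def[abs_def] x'_def y'_def
    using DERIV_cdivide[OF DERIV_ident, where c=l]
      DERIV_cdivide[OF DERIV_diff[OF DERIV_const DERIV_ident], where c="T - l"] by force+
  define e where "e n = 1 / (real n + 1)" for n
  have e: "e n > 0" "e n \<le> 1" for n by (auto simp: e_def)
  have e0: "e \<longlonglongrightarrow> 0" unfolding e_def using LIMSEQ_inverse_real_of_nat by (simp add: inverse_eq_divide add.commute)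
  have ev: "\<forall>\<^sub>F n in sequentially. e n < \<epsilon>" if "\<epsilon> > 0" for \<epsilon>
    using order_tendstoD(2)[OF e0 that] .
  define w where "w n t = y t - smooth_pos (e n) (y t - x t)" for n t
  \<comment> \<open>The outer parameter is twice the inner one because \<open>w n\<close> may exceed
    \<open>x\<close> by up to \<open>3 * e n / 2\<close>: where \<open>F n\<close> is nonzero,
    \<open>w n t > 2 * e n\<close>, hence \<open>x t > e n / 2\<close>, and the support stays away
    from 0.\<close>
  define F where "F n t = smooth_pos (2 * e n) (w n t)" for n t
  define F' where "F' n t = smooth_pos' (2 * e n) (w n t) * (y' - smooth_pos' (e n) (y t - x t) * (y' - x'))" for n t
  define f where "f t = max 0 (min (x t) (y t))" for t
  \<comment> \<open>The slope of the tent. At its kinks the value is the one to which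
    \<open>F' n\<close> converges there: 0 at 0, where \<open>w n\<close> is only
    \<open>3 * e n / 2\<close>, \<open>y'\<close> at \<open>l\<close>, and 0 at
    \<open>T\<close>.\<close>
  define s where "s t = (if t = 0 then 0 else if t < l then x' else if t < T then y' else 0)" for t
  have dF: "(F n has_real_derivative F' n t) (at t)" for n t
    unfolding F_def[abs_def] F'_def w_def using e[of n]
    by (intro DERIV_chain2[OF smooth_pos_deriv] DERIV_diff dx dy) auto
  have cx: "continuous_on A x" "continuous_on A y" for A
    using DERIV_isCont[OF dx] DERIV_isCont[OF dy] by (auto intro: continuous_at_imp_continuous_on)
  have cq: "continuous_on A (smooth_pos (e n))" for A n
    using DERIV_isCont[OF smooth_pos_deriv[OF e(1)]] by (auto intro: continuous_at_imp_continuous_on)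
  have cF': "continuous_on UNIV (F' n)" for n
    unfolding F'_def w_def
    by (intro continuous_intros cx continuous_on_compose2[OF continuous_on_smooth_pos']
       continuous_on_compose2[OF cq[of UNIV]]) auto
  have cF: "continuous_on UNIV (F n)" for n
    using DERIV_isCont[OF dF] by (auto intro: continuous_at_imp_continuous_on)
  have wle: "w n t \<le> y t" "w n t \<le> x t + 3 * e n / 2" for n t
    using smooth_pos_bounds(1,2)[of "e n" "y t - x t", OF e(1)] unfolding w_def by linarith+
  have supp: "closure {t. F n t \<noteq> 0} \<subseteq> {e n * l / 2..T - 2 * e n * (T - l)}" for n
  proof (rule closure_minimal)
    show "{t. F n t \<noteq> 0} \<subseteq> {e n * l / 2..T - 2 * e n * (T - l)}"
    proof safe
      fix t assume "F n t \<noteq> 0"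
      then have "w n t > 2 * e n" using smooth_pos_0[of "2 * e n" "w n t"] e[of n] unfolding F_def by fastforce
      then have "y t > 2 * e n" "x t > e n / 2" using wle[of n t] by linarith+
      then show "t \<in> {e n * l / 2..T - 2 * e n * (T - l)}"
        using l by (simp add: x_def y_def field_simps)
    qed
  qed simp
  have snec: "integral {0..L} (\<lambda>t. (F n t)\<^sup>2 * \<rho> t) \<ge> - Q * integral {0..L} (\<lambda>t. (F' n t)\<^sup>2)" for n
  proof (rule smeared[OF dF cF'])
    show "compact (closure {t. F n t \<noteq> 0})"
      unfolding compact_closure using supp[of n] bounded_subset[OF bounded_closed_interval] closure_subset by blast
    have "e n * l / 2 > 0" "2 * e n * (T - l) > 0" using e[of n] l by auto
    then show "closure {t. F n t \<noteq> 0} \<subseteq> {0<..<L}" using supp[of n] l by force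
  qed
  \<comment> \<open>The error of \<open>smooth_pos e\<close> against \<open>max 0\<close> is at most
    \<open>3 * e / 2\<close>; the outer smoothing contributes \<open>3 * e n\<close>, the inner one
    \<open>3 * e n / 2\<close>.\<close>
  have near: "\<bar>F n t - f t\<bar> \<le> 9 * e n / 2" for n t
  proof -
    have "\<bar>smooth_pos (2 * e n) (w n t) - max 0 (w n t)\<bar> \<le> 3 * e n"
      using smooth_pos_bounds[of "2 * e n" "w n t"] e[of n] by (auto simp: max_def abs_if)
    moreover have "\<bar>w n t - min (x t) (y t)\<bar> \<le> 3 * e n / 2"
      using smooth_pos_bounds[of "e n" "y t - x t"] e[of n] unfolding w_def by (auto simp: max_def min_def abs_if split: if_splits)
    then have "\<bar>max 0 (w n t) - f t\<bar> \<le> 3 * e n / 2" unfolding f_def by (auto simp: max_def abs_if split: if_splits)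
    ultimately show ?thesis unfolding F_def by linarith
  qed
  have f1: "0 \<le> f t" "f t \<le> 1" for t
  proof -
    have "min (x t) (y t) \<le> 1"
      using l by (cases "t \<le> l") (auto simp: x_def y_def min_le_iff_disj divide_simps)
    then show "0 \<le> f t" "f t \<le> 1" by (auto simp: f_def)
  qed
  have F_lim: "(\<lambda>n. F n t) \<longlonglongrightarrow> f t" for t
  proof -
    have "(\<lambda>n. 9 * e n / 2) \<longlonglongrightarrow> 9 * 0 / 2" by (intro tendsto_intros e0) simp
    then have "(\<lambda>n. F n t - f t) \<longlonglongrightarrow> 0"
      by (intro Lim_null_comparison[of "\<lambda>n. F n t - f t" "\<lambda>n. 9 * e n / 2"]) (use near in auto)
    then show ?thesis by (rule LIM_zero_cancel)
  qed
  have F_bd: "\<bar>F n t\<bar> \<le> 6" for n t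
    using near[of n t] f1[of t] e(2)[of n] by linarith
  have "integral {0..L} (\<lambda>t. (f t)\<^sup>2 * \<rho> t) \<ge> - Q * integral {0..L} (\<lambda>t. (s t)\<^sup>2)"
  proof (rule LIMSEQ_le)
    show "\<exists>N. \<forall>n\<ge>N. - Q * integral {0..L} (\<lambda>t. (F' n t)\<^sup>2) \<le> integral {0..L} (\<lambda>t. (F n t)\<^sup>2 * \<rho> t)"
      using snec by blast
    show "(\<lambda>n. integral {0..L} (\<lambda>t. (F n t)\<^sup>2 * \<rho> t)) \<longlonglongrightarrow> integral {0..L} (\<lambda>t. (f t)\<^sup>2 * \<rho> t)"
    proof (rule dominated_convergence(2)[where h = "\<lambda>t. 36 * \<bar>\<rho> t\<bar>"])
      show "(\<lambda>t. (F n t)\<^sup>2 * \<rho> t) integrable_on {0..L}" for n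
        by (intro integrable_continuous_interval continuous_intros continuous_on_subset[OF cF] cont) auto
      show "(\<lambda>t. 36 * \<bar>\<rho> t\<bar>) integrable_on {0..L}"
        by (intro integrable_continuous_interval continuous_intros cont)
      show "norm ((F n t)\<^sup>2 * \<rho> t) \<le> 36 * \<bar>\<rho> t\<bar>" for n t
      proof -
        have "\<bar>F n t\<bar>\<^sup>2 \<le> 6\<^sup>2" by (intro power_mono F_bd) auto
        then show ?thesis by (simp add: abs_mult mult_right_mono)
      qed
      show "(\<lambda>n. (F n t)\<^sup>2 * \<rho> t) \<longlonglongrightarrow> (f t)\<^sup>2 * \<rho> t" for t
        by (intro tendsto_intros F_lim)
    qed
    have "(\<lambda>n. integral {0..L} (\<lambda>t. (F' n t)\<^sup>2)) \<longlonglongrightarrow> integral {0..L} (\<lambda>t. (s t)\<^sup>2)"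
    proof (rule dominated_convergence(2)[where h = "\<lambda>t. (x' - y')\<^sup>2"])
      show "(\<lambda>t. (F' n t)\<^sup>2) integrable_on {0..L}" for n
        by (intro integrable_continuous_interval continuous_intros continuous_on_subset[OF cF']) auto
      show "(\<lambda>t. (x' - y')\<^sup>2) integrable_on {0..L}" by (rule integrable_const_ivl)
      show "norm ((F' n t)\<^sup>2) \<le> (x' - y')\<^sup>2" for n t
      proof -
        \<comment> \<open>\<open>F' n t\<close> is \<open>p\<close> times the convex combination of
          the slopes \<open>x' > 0\<close> and \<open>y' < 0\<close> with weights \<open>q\<close>
          and \<open>1 - q\<close>.\<close>
        define p q where "p = smooth_pos' (2 * e n) (w n t)" and "q = smooth_pos' (e n) (y t - x t)"
        have pq: "0 \<le> p" "p \<le> 1" "0 \<le> q" "q \<le> 1"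
          unfolding p_def q_def using smooth_pos'_bounds e[of n] by auto
        have xy: "x' > 0" "y' < 0" using l by (auto simp: x'_def y'_def)
        have "q * x' \<le> x'" "(1 - q) * (- y') \<le> - y'" "q * x' \<ge> 0" "(1 - q) * (- y') \<ge> 0"
          using pq xy by (auto intro!: mult_left_le_one_le mult_nonneg_nonneg mult_nonneg_nonpos)
        then have "\<bar>y' - q * (y' - x')\<bar> \<le> x' - y'" unfolding abs_le_iff by (simp add: algebra_simps)
        then have "p * \<bar>y' - q * (y' - x')\<bar> \<le> 1 * (x' - y')" using pq by (intro mult_mono) auto
        then have "\<bar>F' n t\<bar> \<le> x' - y'" using pq by (simp add: F'_def p_def[symmetric] q_def[symmetric] abs_mult)
        then have "\<bar>F' n t\<bar>\<^sup>2 \<le> (x' - y')\<^sup>2" by (intro power_mono) auto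
        then show ?thesis by simp
      qed
      fix t assume t: "t \<in> {0..L}"
      have "\<forall>\<^sub>F n in sequentially. F' n t = s t"
      proof -
        consider "t = 0" | "0 < t" "t < l" | "l \<le> t" "t < T" | "T \<le> t" using t by force
        then show ?thesis
        proof cases
          case 1
          have "y t - x t > 0" using 1 l by (simp add: x_def y_def)
          from ev[OF half_gt_zero[OF this]] show ?thesis
          proof (rule eventually_mono)
            fix n assume "e n < (y t - x t) / 2"
            then have "w n t = x t + 3 * e n / 2" unfolding w_def using e by (subst smooth_pos_affine) auto
            then have "w n t \<le> 2 * e n" using 1 e[of n] by (simp add: x_def)
            then show "F' n t = s t" using 1 e[of n] by (simp add: F'_def s_def smooth_pos'_0)
          qed
        next
          case 2
          have "t / l < 1" "(T - t) / (T - l) > 1" using 2 l by auto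
          then have "y t - x t > 0" unfolding x_def y_def by linarith
          moreover have "x t > 0" using 2 l by (simp add: x_def)
          \<comment> \<open>The outer smoothing has slope 1 from \<open>4 * e n\<close> on, and
            \<open>x t + 3 * e n / 2\<close> reaches this once \<open>e n\<close> is at most
            \<open>2 / 5 * x t\<close>.\<close>
          ultimately have "(y t - x t) / 2 > 0" "2 / 5 * x t > 0" by auto
          from eventually_conj[OF ev[OF this(1)] ev[OF this(2)]] show ?thesis
          proof (rule eventually_mono, elim conjE)
            fix n assume n: "e n < (y t - x t) / 2" "e n < 2 / 5 * x t"
            then have "w n t = x t + 3 * e n / 2" unfolding w_def using e by (subst smooth_pos_affine) auto
            then show "F' n t = s t" using 2 e[of n] n by (simp add: F'_def s_def smooth_pos'_1)
          qed
        next
          case 3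
          have "t / l \<ge> 1" "(T - t) / (T - l) \<le> 1" "(T - t) / (T - l) > 0" using 3 l by auto
          then have "y t - x t \<le> 0" "y t > 0" unfolding x_def y_def by linarith+
          then have "y t / 4 > 0" by auto
          from ev[OF this] show ?thesis
          proof (rule eventually_mono)
            fix n assume n: "e n < y t / 4"
            have le: "y t - x t \<le> e n" using \<open>y t - x t \<le> 0\<close> e(1)[of n] by linarith
            then have "w n t = y t" unfolding w_def using e by (simp add: smooth_pos_0)
            then show "F' n t = s t" using 3 l e[of n] n le by (simp add: F'_def s_def smooth_pos'_1 smooth_pos'_0)
          qed
        next
          case 4
          have "t / l \<ge> 1" "(T - t) / (T - l) \<le> 0" using 4 l by (auto simp: divide_nonpos_pos)
          then have "y t \<le> 0" "y t - x t \<le> e n" for n unfolding x_def y_def using e(1)[of n] by linarith+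
          then have "w n t \<le> 2 * e n" for n using wle(1)[of n t] e(1)[of n] by linarith
          then show ?thesis using 4 l e by (simp add: F'_def s_def smooth_pos'_0)
        qed
      qed
      then show "(\<lambda>n. (F' n t)\<^sup>2) \<longlonglongrightarrow> (s t)\<^sup>2"
        by (intro tendsto_power tendsto_eventually)
    qed
    then show "(\<lambda>n. - Q * integral {0..L} (\<lambda>t. (F' n t)\<^sup>2)) \<longlonglongrightarrow> - Q * integral {0..L} (\<lambda>t. (s t)\<^sup>2)"
      by (intro tendsto_mult_left)
  qed
  moreover have "integral {0..L} (\<lambda>t. (s t)\<^sup>2) = 1 / l + 1 / (T - l)"
  proof (rule integral_unique)
    have 1: "((\<lambda>t. (s t)\<^sup>2) has_integral 1 / l) {0..l}"
    proof (rule has_integral_spike_finite[of "{0, l}"])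
      show "((\<lambda>t. x'\<^sup>2) has_integral 1 / l) {0..l}"
        using has_integral_const_real[of "x'\<^sup>2" 0 l] l by (simp add: x'_def power2_eq_square)
    qed (auto simp: s_def)
    have 2: "((\<lambda>t. (s t)\<^sup>2) has_integral 1 / (T - l)) {l..T}"
    proof (rule has_integral_spike_finite[of "{T}"])
      show "((\<lambda>t. y'\<^sup>2) has_integral 1 / (T - l)) {l..T}"
        using has_integral_const_real[of "y'\<^sup>2" l T] l by (simp add: y'_def power2_eq_square)
    qed (use l in \<open>auto simp: s_def\<close>)
    have 3: "((\<lambda>t. (s t)\<^sup>2) has_integral 0) {T..L}"
      by (rule has_integral_is_0) (use l in \<open>auto simp: s_def\<close>)
    show "((\<lambda>t. (s t)\<^sup>2) has_integral 1 / l + 1 / (T - l)) {0..L}"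
      using has_integral_combine[OF _ _ has_integral_combine[OF _ _ 1 2] 3] l by simp
  qed
  moreover have "integral {0..L} (\<lambda>t. (f t)\<^sup>2 * \<rho> t) =
     integral {0..l} (\<lambda>t. (t / l)\<^sup>2 * \<rho> t) + integral {l..T} (\<lambda>t. ((T - t) / (T - l))\<^sup>2 * \<rho> t)"
  proof (rule integral_unique)
    have c: "continuous_on {0..l} \<rho>" "continuous_on {l..T} \<rho>"
      using l by (auto intro: continuous_on_subset[OF cont])
    have 1: "((\<lambda>t. (f t)\<^sup>2 * \<rho> t) has_integral integral {0..l} (\<lambda>t. (t / l)\<^sup>2 * \<rho> t)) {0..l}"
    proof (rule has_integral_eq[OF _ integrable_integral[OF integrable_continuous_interval]])
      fix t assume t: "t \<in> {0..l}"
      have "0 \<le> t / l" "t / l \<le> 1" "(T - t) / (T - l) \<ge> 1" using l t by auto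
      then have "f t = t / l" by (auto simp: f_def x_def y_def)
      then show "(t / l)\<^sup>2 * \<rho> t = (f t)\<^sup>2 * \<rho> t" by simp
    qed (use l c in \<open>auto intro!: continuous_intros\<close>)
    have 2: "((\<lambda>t. (f t)\<^sup>2 * \<rho> t) has_integral integral {l..T} (\<lambda>t. ((T - t) / (T - l))\<^sup>2 * \<rho> t)) {l..T}"
    proof (rule has_integral_eq[OF _ integrable_integral[OF integrable_continuous_interval]])
      fix t assume t: "t \<in> {l..T}"
      have "1 \<le> t / l" "0 \<le> (T - t) / (T - l)" "(T - t) / (T - l) \<le> 1" using l t by auto
      then have "f t = (T - t) / (T - l)" by (auto simp: f_def x_def y_def)
      then show "((T - t) / (T - l))\<^sup>2 * \<rho> t = (f t)\<^sup>2 * \<rho> t" by simp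
    qed (use l c in \<open>auto intro!: continuous_intros\<close>)
    have 3: "((\<lambda>t. (f t)\<^sup>2 * \<rho> t) has_integral 0) {T..L}"
    proof (rule has_integral_is_0)
      fix t assume "t \<in> {T..L}"
      then have "(T - t) / (T - l) \<le> 0" using l by (auto simp: divide_nonpos_pos)
      then have "f t = 0" by (auto simp: f_def y_def)
      then show "(f t)\<^sup>2 * \<rho> t = 0" by simp
    qed
    show "((\<lambda>t. (f t)\<^sup>2 * \<rho> t) has_integral integral {0..l} (\<lambda>t. (t / l)\<^sup>2 * \<rho> t) + integral {l..T} (\<lambda>t. ((T - t) / (T - l))\<^sup>2 * \<rho> t)) {0..L}"
      using has_integral_combine[OF _ _ has_integral_combine[OF _ _ 1 2] 3] l by simp
  qed
  ultimately show ?thesis by simp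
qed

section \<open>The Raychaudhuri inequality\<close>

text \<open>On the linear part \<open>f\<close> of the weight, with slope \<open>d\<close>,
  completing the square gives 2 f d \<theta> - f^2 \<theta>^2 / 2 \<le> 2 d^2. On [0,l] the weight
  is constant and the square of \<theta> is kept for the sake of strictness.\<close>

lemma raychaudhuri_bound:
  fixes \<theta> \<eta> \<rho> :: "real \<Rightarrow> real"
  assumes der: "\<And>t. t \<in> {0..T} \<Longrightarrow> (\<theta> has_real_derivative \<eta> t) (at t within {0..T})"
    and ineq: "\<And>t. t \<in> {0..T} \<Longrightarrow> \<eta> t \<le> - \<rho> t - (\<theta> t)\<^sup>2 / 2"
    and cont: "continuous_on {0..T} \<rho>" and l: "0 < l" "l < T"
  shows "- \<theta> 0 + integral {0..l} (\<lambda>t. (\<theta> t)\<^sup>2) / 2 \<le>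
    2 / (T - l) - integral {0..l} \<rho> - integral {l..T} (\<lambda>t. ((T - t) / (T - l))\<^sup>2 * \<rho> t)"
proof -
  have c\<theta>: "continuous_on {0..T} \<theta>"
    using der by (intro DERIV_continuous_on) auto
  have sub: "continuous_on {0..l} g" "continuous_on {l..T} g" if "continuous_on {0..T} g" for g :: "real \<Rightarrow> real"
    using l by (auto intro: continuous_on_subset[OF that])
  have "\<theta> l - \<theta> 0 \<le> integral {0..l} (\<lambda>t. - \<rho> t - (\<theta> t)\<^sup>2 / 2)"
  proof (rule has_integral_le)
    show "(\<eta> has_integral \<theta> l - \<theta> 0) {0..l}"
      using l by (intro fundamental_theorem_of_calculus)
        (auto simp: has_real_derivative_iff_has_vector_derivative[symmetric] intro!: DERIV_subset[OF der])
    show "((\<lambda>t. - \<rho> t - (\<theta> t)\<^sup>2 / 2) has_integral integral {0..l} (\<lambda>t. - \<rho> t - (\<theta> t)\<^sup>2 / 2)) {0..l}"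
      by (intro integrable_integral integrable_continuous_interval continuous_intros sub cont c\<theta>) auto
  qed (use ineq l in auto)
  also have "\<dots> = - integral {0..l} \<rho> - integral {0..l} (\<lambda>t. (\<theta> t)\<^sup>2) / 2"
    by (subst integral_diff) (auto intro!: integrable_continuous_interval continuous_intros sub cont c\<theta>)
  finally have 1: "\<theta> l - \<theta> 0 \<le> - integral {0..l} \<rho> - integral {0..l} (\<lambda>t. (\<theta> t)\<^sup>2) / 2" .
  define f where "f t = (T - t) / (T - l)" for t
  define d where "d = - 1 / (T - l)"
  have df: "(f has_real_derivative d) (at t within A)" for t A
    unfolding f_def[abs_def] d_def using DERIV_cdivide[OF DERIV_diff[OF DERIV_const DERIV_ident], where c="T - l"] by force
  have cf: "continuous_on A f" for A using df by (intro DERIV_continuous_on) auto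
  have "(f T)\<^sup>2 * \<theta> T - (f l)\<^sup>2 * \<theta> l \<le> integral {l..T} (\<lambda>t. 2 * d\<^sup>2 - (f t)\<^sup>2 * \<rho> t)"
  proof (rule has_integral_le)
    show "((\<lambda>t. 2 * f t * d * \<theta> t + (f t)\<^sup>2 * \<eta> t) has_integral (f T)\<^sup>2 * \<theta> T - (f l)\<^sup>2 * \<theta> l) {l..T}"
    proof (rule fundamental_theorem_of_calculus)
      fix t assume t: "t \<in> {l..T}"
      have "(\<theta> has_real_derivative \<eta> t) (at t within {l..T})"
        by (rule DERIV_subset[OF der]) (use t l in auto)
      then show "((\<lambda>t. (f t)\<^sup>2 * \<theta> t) has_vector_derivative 2 * f t * d * \<theta> t + (f t)\<^sup>2 * \<eta> t) (at t within {l..T})"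
        unfolding has_real_derivative_iff_has_vector_derivative[symmetric]
        by (auto intro!: derivative_eq_intros df)
    qed (use l in simp)
    show "((\<lambda>t. 2 * d\<^sup>2 - (f t)\<^sup>2 * \<rho> t) has_integral integral {l..T} (\<lambda>t. 2 * d\<^sup>2 - (f t)\<^sup>2 * \<rho> t)) {l..T}"
      by (intro integrable_integral integrable_continuous_interval continuous_intros sub cont cf)
    fix t assume t: "t \<in> {l..T}"
    have "(f t)\<^sup>2 * \<eta> t \<le> (f t)\<^sup>2 * (- \<rho> t - (\<theta> t)\<^sup>2 / 2)"
      using ineq[of t] t l by (intro mult_left_mono) auto
    moreover have "0 \<le> (f t * \<theta> t - 2 * d)\<^sup>2" by simp
    ultimately show "2 * f t * d * \<theta> t + (f t)\<^sup>2 * \<eta> t \<le> 2 * d\<^sup>2 - (f t)\<^sup>2 * \<rho> t"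
      by (simp add: power2_eq_square algebra_simps)
  qed
  also have "\<dots> = 2 * d\<^sup>2 * (T - l) - integral {l..T} (\<lambda>t. (f t)\<^sup>2 * \<rho> t)"
    using l by (subst integral_diff) (auto intro!: integrable_continuous_interval continuous_intros sub cont cf)
  also have "\<dots> = 2 / (T - l) - integral {l..T} (\<lambda>t. (f t)\<^sup>2 * \<rho> t)"
  proof -
    have "2 * (- 1 / m)\<^sup>2 * m = 2 / m" if "m \<noteq> 0" for m :: real
      using that by (simp add: power2_eq_square)
    from this[of "T - l"] show ?thesis using l unfolding d_def by simp
  qed
  \<comment> \<open>The weight vanishes at \<open>T\<close>, so the uncontrolled value of \<theta>
    at \<open>T\<close> drops out.\<close>
  finally have "- \<theta> l \<le> 2 / (T - l) - integral {l..T} (\<lambda>t. (f t)\<^sup>2 * \<rho> t)" using l by (simp add: f_def)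
  with 1 show ?thesis by (simp add: f_def)
qed

lemma integral_square_pos:
  fixes f :: "real \<Rightarrow> real"
  assumes "continuous_on {a..b} f" "a < b" "f a \<noteq> 0"
  shows "integral {a..b} (\<lambda>t. (f t)\<^sup>2) > 0"
proof -
  have i: "(\<lambda>t. (f t)\<^sup>2) integrable_on {a..b}"
    by (intro integrable_continuous_interval continuous_intros assms)
  have "integral {a..b} (\<lambda>t. (f t)\<^sup>2) \<noteq> 0"
  proof
    assume "integral {a..b} (\<lambda>t. (f t)\<^sup>2) = 0"
    then have "((\<lambda>t. (f t)\<^sup>2) has_integral 0) (cbox a b)" using i by (simp add: has_integral_iff)
    then have "(f a)\<^sup>2 = 0"
      by (rule has_integral_0_cbox_imp_0[rotated 2]) (use assms in \<open>auto intro!: continuous_intros\<close>)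
    with assms show False by simp
  qed
  moreover have "integral {a..b} (\<lambda>t. (f t)\<^sup>2) \<ge> 0" by (rule integral_nonneg[OF i]) simp
  ultimately show ?thesis by linarith
qed

text \<open>The hypotheses describe the columns \<open>(a, c)\<close> and \<open>(b, d)\<close> of a matrix solution \<open>A\<close> of the transverse
  Jacobi equation; its determinant \<open>D\<close> has logarithmic derivative \<open>\<theta>\<close>, the expansion. The conserved
  Wronskian vanishes (no twist), which makes \<open>\<theta>\<^sup>2 - 4 det A' / D\<close> a sum of squares.\<close>

theorem jacobi_determinant_zero:
  fixes a b c d a' b' c' d' K11 K12 K22 :: "real \<Rightarrow> real" and l L \<rho>0 Q :: real
  defines "\<rho> \<equiv> \<lambda>t. K11 t + K22 t"
  assumes da: "\<And>t. t \<in> {0..L} \<Longrightarrow> (a has_real_derivative a' t) (at t within {0..L})"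
    and db: "\<And>t. t \<in> {0..L} \<Longrightarrow> (b has_real_derivative b' t) (at t within {0..L})"
    and dc: "\<And>t. t \<in> {0..L} \<Longrightarrow> (c has_real_derivative c' t) (at t within {0..L})"
    and dd: "\<And>t. t \<in> {0..L} \<Longrightarrow> (d has_real_derivative d' t) (at t within {0..L})"
    and da': "\<And>t. t \<in> {0..L} \<Longrightarrow> (a' has_real_derivative - (K11 t * a t + K12 t * c t)) (at t within {0..L})"
    and dc': "\<And>t. t \<in> {0..L} \<Longrightarrow> (c' has_real_derivative - (K12 t * a t + K22 t * c t)) (at t within {0..L})"
    and db': "\<And>t. t \<in> {0..L} \<Longrightarrow> (b' has_real_derivative - (K11 t * b t + K12 t * d t)) (at t within {0..L})"
    and dd': "\<And>t. t \<in> {0..L} \<Longrightarrow> (d' has_real_derivative - (K12 t * b t + K22 t * d t)) (at t within {0..L})"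
    and init: "a 0 = 1" "b 0 = 0" "c 0 = 0" "d 0 = 1" "b' 0 = c' 0"
    and neg: "a' 0 + d' 0 < 0"
    and cont: "continuous_on {0..L} \<rho>"
    and smeared: "\<And>g g' :: real \<Rightarrow> real.
           (\<And>t. (g has_real_derivative g' t) (at t)) \<Longrightarrow> continuous_on UNIV g' \<Longrightarrow>
           compact (closure {t. g t \<noteq> 0}) \<Longrightarrow> closure {t. g t \<noteq> 0} \<subseteq> {0<..<L} \<Longrightarrow>
           integral {0..L} (\<lambda>t. (g t)\<^sup>2 * \<rho> t) \<ge> - Q * integral {0..L} (\<lambda>t. (g' t)\<^sup>2)"
    and l: "0 < l" "l < L"
    and \<rho>0: "\<And>t. t \<in> {0..l} \<Longrightarrow> \<rho> t \<ge> \<rho>0"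
    and contraction: "- (a' 0 + d' 0) \<ge> - (2/3) * \<rho>0 * l + Q / l + (2 + Q) / (L - l)"
  shows "\<exists>r. 0 < r \<and> r < L \<and> a r * d r = b r * c r"
proof (rule ccontr)
  assume no: "\<not> ?thesis"
  define D where "D t = a t * d t - b t * c t" for t
  define E where "E t = a' t * d t + a t * d' t - b' t * c t - b t * c' t" for t
  define \<theta> where "\<theta> t = E t / D t" for t
  define \<eta> where "\<eta> t = (- \<rho> t * D t + 2 * (a' t * d' t - b' t * c' t)) / D t - (\<theta> t)\<^sup>2" for t
  have dD: "(D has_real_derivative E t) (at t within {0..L})" if "t \<in> {0..L}" for t
    unfolding D_def[abs_def] E_def using da[OF that] db[OF that] dc[OF that] dd[OF that]
    by (auto intro!: derivative_eq_intros)
  have dE: "(E has_real_derivative - \<rho> t * D t + 2 * (a' t * d' t - b' t * c' t)) (at t within {0..L})" if "t \<in> {0..L}" for t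
    unfolding D_def E_def[abs_def] \<rho>_def
    using da[OF that] db[OF that] dc[OF that] dd[OF that] da'[OF that] db'[OF that] dc'[OF that] dd'[OF that]
    by (auto intro!: derivative_eq_intros simp: algebra_simps)
  have cD: "continuous_on {0..L} D" using dD by (intro DERIV_continuous_on) auto
  have Dpos: "D t > 0" if "t \<in> {0..<L}" for t
  proof (rule ccontr)
    assume "\<not> D t > 0"
    moreover have "D 0 = 1" by (simp add: D_def init)
    moreover have "continuous_on {0..t} D" using that by (intro continuous_on_subset[OF cD]) auto
    ultimately have "\<exists>r\<ge>0. r \<le> t \<and> D r = 0"
      using that by (intro IVT2') auto
    then obtain r where "0 \<le> r" "r \<le> t" "D r = 0" by blast
    moreover from this have "r \<noteq> 0" using \<open>D 0 = 1\<close> by auto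
    ultimately show False using no that by (force simp: D_def)
  qed
  \<comment> \<open>Conserved because the matrix \<open>K\<close> is symmetric, and zero at the
    start because \<open>b' 0 = c' 0\<close>.\<close>
  have wronskian: "a t * b' t + c t * d' t = b t * a' t + d t * c' t" if "t \<in> {0..L}" for t
  proof -
    define W where "W t = a t * b' t + c t * d' t - (b t * a' t + d t * c' t)" for t
    have "(W has_real_derivative 0) (at t within {0..L})" if "t \<in> {0..L}" for t
      unfolding W_def[abs_def]
      using da[OF that] db[OF that] dc[OF that] dd[OF that] da'[OF that] db'[OF that] dc'[OF that] dd'[OF that]
      by (auto intro!: derivative_eq_intros simp: algebra_simps)
    then have "W t = W 0" using has_field_derivative_zero_constant[of "{0..L}" W] that by (metis atLeastAtMost_iff convex_real_interval(5) order_refl order_trans)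
    then show ?thesis using init by (simp add: W_def)
  qed
  have d\<theta>: "(\<theta> has_real_derivative \<eta> t) (at t within {0..T})" if "t \<in> {0..T}" "T < L" for t T
  proof -
    have D0: "D t > 0" using Dpos that by simp
    have "((\<lambda>t. E t / D t) has_real_derivative
       ((- \<rho> t * D t + 2 * (a' t * d' t - b' t * c' t)) * D t - E t * E t) / (D t * D t)) (at t within {0..T})"
      using that D0 by (intro DERIV_divide DERIV_subset[OF dE] DERIV_subset[OF dD]) auto
    moreover have "((- \<rho> t * D t + 2 * (a' t * d' t - b' t * c' t)) * D t - E t * E t) / (D t * D t) = \<eta> t"
      using D0 by (simp add: \<eta>_def \<theta>_def power2_eq_square field_simps)
    ultimately show ?thesis unfolding \<theta>_def[abs_def] by simp
  qed
  have ineq: "\<eta> t \<le> - \<rho> t - (\<theta> t)\<^sup>2 / 2" if "t \<in> {0..<L}" for t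
  proof -
    \<comment> \<open>The entries of A' times the adjugate of A: \<open>p\<close>, \<open>q\<close>
      on the diagonal and \<open>u\<close>, \<open>v\<close> off it. Divided by \<open>D t\<close>
      this is A' A^{-1}, symmetric since \<open>u = v\<close>. The gap
      \<open>(p - q)\<^sup>2 + 4 * (u * v)\<close> between the squared trace and four times the
      determinant is the shear term.\<close>
    define p q u v where "p = a' t * d t - b' t * c t" and "q = a t * d' t - b t * c' t"
      and "u = a t * b' t - b t * a' t" and "v = c' t * d t - d' t * c t"
    have "u = v" using wronskian[of t] that by (simp add: u_def v_def algebra_simps)
    have "D t * (a' t * d' t - b' t * c' t) = p * q - u * v"
      by (simp add: p_def q_def u_def v_def D_def algebra_simps)
    moreover have "(E t)\<^sup>2 = (p - q)\<^sup>2 + 4 * (p * q)"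
      by (simp add: p_def q_def E_def power2_eq_square algebra_simps)
    moreover have "u * v \<ge> 0" by (simp add: \<open>u = v\<close>)
    ultimately have "4 * (D t * (a' t * d' t - b' t * c' t)) \<le> (E t)\<^sup>2"
      using zero_le_power2[of "p - q"] by linarith
    moreover have "2 * X / D t \<le> (E t / D t)\<^sup>2 / 2" if "4 * (D t * X) \<le> (E t)\<^sup>2" for X
      using divide_right_mono[OF that, of "2 * (D t * D t)"] Dpos[OF \<open>t \<in> {0..<L}\<close>]
      by (simp add: power2_eq_square)
    ultimately have "2 * (a' t * d' t - b' t * c' t) / D t \<le> (E t / D t)\<^sup>2 / 2" by blast
    moreover have "\<eta> t = - \<rho> t + 2 * (a' t * d' t - b' t * c' t) / D t - (E t / D t)\<^sup>2"
      unfolding \<eta>_def \<theta>_def add_divide_distrib using Dpos[OF that] by simp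
    ultimately show ?thesis unfolding \<theta>_def by linarith
  qed
  define \<delta> where "\<delta> = integral {0..l} (\<lambda>t. (\<theta> t)\<^sup>2) / 2"
  have \<theta>0: "\<theta> 0 = a' 0 + d' 0" by (simp add: \<theta>_def E_def D_def init)
  have "continuous_on {0..l} \<theta>" using d\<theta>[of _ l] l by (intro DERIV_continuous_on) auto
  then have "\<delta> > 0" using integral_square_pos[of 0 l \<theta>] l neg \<theta>0 by (simp add: \<delta>_def)
  have bound: "- \<theta> 0 + \<delta> \<le> - (2/3) * \<rho>0 * l + Q / l + (2 + Q) / (T - l)" if T: "l < T" "T < L" for T
  proof -
    have c0: "continuous_on {0..l} \<rho>" "continuous_on {0..T} \<rho>"
      using T l by (auto intro: continuous_on_subset[OF cont])
    have 1: "- \<theta> 0 + \<delta> \<le> 2 / (T - l) - integral {0..l} \<rho> - integral {l..T} (\<lambda>t. ((T - t) / (T - l))\<^sup>2 * \<rho> t)"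
      unfolding \<delta>_def using T l c0
      by (intro raychaudhuri_bound[where \<eta> = \<eta>] d\<theta> ineq) auto
    have 2: "integral {0..l} (\<lambda>t. (t / l)\<^sup>2 * \<rho> t) + integral {l..T} (\<lambda>t. ((T - t) / (T - l))\<^sup>2 * \<rho> t)
      \<ge> - Q * (1 / l + 1 / (T - l))"
      by (rule smeared_tent[OF cont smeared l(1) T(1)]) (use T in auto)
    \<comment> \<open>Part of the integral of \<rho> over [0,l] is spent on completing the tent. The
      lower bound \<open>\<rho>0\<close> is applied to the remaining weight
      \<open>1 - (t / l)\<^sup>2\<close>, which is nonnegative there and has integral
      \<open>2 * l / 3\<close>.\<close>
    have "((\<lambda>t. \<rho>0 * (1 - (t / l)\<^sup>2)) has_integral \<rho>0 * (l - l ^ 3 / (3 * l\<^sup>2)) - \<rho>0 * (0 - 0 ^ 3 / (3 * l\<^sup>2))) {0..l}"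
    proof (rule fundamental_theorem_of_calculus)
      fix t
      have "((\<lambda>t. \<rho>0 * (t - t ^ 3 / (3 * l\<^sup>2))) has_real_derivative \<rho>0 * (1 - 3 * t\<^sup>2 / (3 * l\<^sup>2))) (at t within {0..l})"
        by (rule DERIV_cmult, rule DERIV_diff[OF DERIV_ident DERIV_cdivide])
          (auto intro!: derivative_eq_intros)
      then show "((\<lambda>t. \<rho>0 * (t - t ^ 3 / (3 * l\<^sup>2))) has_vector_derivative \<rho>0 * (1 - (t / l)\<^sup>2)) (at t within {0..l})"
        by (simp add: has_real_derivative_iff_has_vector_derivative power_divide)
    qed (use l in simp)
    moreover have "((\<lambda>t. \<rho> t - (t / l)\<^sup>2 * \<rho> t) has_integral integral {0..l} \<rho> - integral {0..l} (\<lambda>t. (t / l)\<^sup>2 * \<rho> t)) {0..l}"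
      using l by (intro has_integral_diff integrable_integral integrable_continuous_interval continuous_intros c0) auto
    ultimately have "\<rho>0 * (l - l ^ 3 / (3 * l\<^sup>2)) - \<rho>0 * (0 - 0 ^ 3 / (3 * l\<^sup>2)) \<le>
      integral {0..l} \<rho> - integral {0..l} (\<lambda>t. (t / l)\<^sup>2 * \<rho> t)"
    proof (rule has_integral_le)
      fix t assume t: "t \<in> {0..l}"
      have "(t / l)\<^sup>2 \<le> 1" using t l by (intro power_le_one) auto
      then have "\<rho>0 * (1 - (t / l)\<^sup>2) \<le> \<rho> t * (1 - (t / l)\<^sup>2)" using \<rho>0[OF t] by (intro mult_right_mono) auto
      then show "\<rho>0 * (1 - (t / l)\<^sup>2) \<le> \<rho> t - (t / l)\<^sup>2 * \<rho> t" by (simp add: algebra_simps)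
    qed
    moreover have "l ^ 3 / (3 * l\<^sup>2) = l / 3" using l by (simp add: power3_eq_cube power2_eq_square)
    ultimately have 3: "(2/3) * \<rho>0 * l \<le> integral {0..l} \<rho> - integral {0..l} (\<lambda>t. (t / l)\<^sup>2 * \<rho> t)"
      by (simp add: algebra_simps)
    have e: "(2 + Q) / (T - l) = 2 / (T - l) + Q / (T - l)" "- Q * (1 / l + 1 / (T - l)) = - (Q / l) - Q / (T - l)"
      by (simp_all add: add_divide_distrib algebra_simps)
    show ?thesis using 1 2 3 unfolding e by linarith
  qed
  have "- \<theta> 0 + \<delta> \<le> - (2/3) * \<rho>0 * l + Q / l + (2 + Q) / (L - l)"
  proof (rule tendsto_le)
    show "((\<lambda>T. - (2/3) * \<rho>0 * l + Q / l + (2 + Q) / (T - l)) \<longlongrightarrow> - (2/3) * \<rho>0 * l + Q / l + (2 + Q) / (L - l)) (at_left L)"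
      using l by (intro tendsto_intros) auto
    show "((\<lambda>T. - \<theta> 0 + \<delta>) \<longlongrightarrow> - \<theta> 0 + \<delta>) (at_left L)" by simp
    show "\<forall>\<^sub>F T in at_left L. - \<theta> 0 + \<delta> \<le> - (2/3) * \<rho>0 * l + Q / l + (2 + Q) / (T - l)"
      using eventually_at_left_field[of _ L] bound l(2) by blast
  qed simp
  then show False using contraction \<theta>0 \<open>\<delta> > 0\<close> by linarith
qed

section \<open>Tangent vectors\<close>

context spacetime
begin

lemma chart_at_atlas: "chart_at M p \<in> atlas M" "p \<in> cdom (chart_at M p)"
  using chart_at[of p] by (auto simp: charts_at_iff)

lemma tangentD:
  "tangent M p v \<Longrightarrow> c \<in> charts_at M p \<Longrightarrow> d \<in> charts_at M p \<Longrightarrow> v d = dirder (v c) (transition c d) (cmap c p)"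
  unfolding tangent_def by blast

lemma metric_form_change:
  assumes "c \<in> charts_at M p" "d \<in> charts_at M p"
  shows "metric_form M c (cmap c p) u v = metric_form M d (cmap d p)
    (dirder u (transition c d) (cmap c p)) (dirder v (transition c d) (cmap c p))"
  using lorentz assms unfolding lorentz_metric_def Let_def by blast

text \<open>\<open>ip\<close> is evaluated in an arbitrarily chosen chart that may jump along a
  curve. For tangent vectors any chart around \<open>p\<close> gives the same value, so locally one
  chart can be used throughout.\<close>

lemma ip_chart:
  assumes "tangent M p v" "tangent M p w" "c \<in> charts_at M p"
  shows "ip M p v w = metric_form M c (cmap c p) (v c) (w c)"
  using metric_form_change[OF chart_at assms(3)] tangentD[OF assms(1) chart_at assms(3)]
    tangentD[OF assms(2) chart_at assms(3)] by (simp add: ip_def Let_def)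

lemma transition_linear:
  assumes "c \<in> charts_at M p" "d \<in> charts_at M p"
  shows "linear (\<lambda>v. dirder v (transition c d) (cmap c p))"
  by (rule smooth_on_linear[OF smooth_transition]) (use assms in \<open>auto simp: charts_at_iff\<close>)

lemma tangent_add:
  assumes "tangent M p v" "tangent M p w" shows "tangent M p (\<lambda>c. v c + w c)"
  unfolding tangent_def
proof (intro ballI)
  fix c d assume cd: "c \<in> charts_at M p" "d \<in> charts_at M p"
  show "v d + w d = dirder (v c + w c) (transition c d) (cmap c p)"
    using tangentD[OF assms(1) cd] tangentD[OF assms(2) cd] linear_add[OF transition_linear[OF cd]] by simp
qed

lemma tangent_scale:
  assumes "tangent M p v" shows "tangent M p (\<lambda>c. r *\<^sub>R v c)"
  unfolding tangent_def
proof (intro ballI)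
  fix c d assume cd: "c \<in> charts_at M p" "d \<in> charts_at M p"
  show "r *\<^sub>R v d = dirder (r *\<^sub>R v c) (transition c d) (cmap c p)"
    using tangentD[OF assms cd] linear_cmul[OF transition_linear[OF cd]] by simp
qed

lemma tangent_cong:
  assumes "vec_eq M p v w" "tangent M p v" shows "tangent M p w"
  unfolding tangent_def
proof (intro ballI)
  fix c d assume cd: "c \<in> charts_at M p" "d \<in> charts_at M p"
  then have "v c = w c" "v d = w d" using assms(1) by (auto simp: vec_eq_def)
  then show "w d = dirder (w c) (transition c d) (cmap c p)" using tangentD[OF assms(2) cd] by simp
qed

text \<open>The tensor law \<open>Rm_change\<close>, read in terms of families of
  components.\<close>

lemma tangent_curv:
  assumes "tangent M p u" "tangent M p v" "tangent M p w"
  shows "tangent M p (\<lambda>c. curv M c (cmap c p) (u c) (v c) (w c))"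
  unfolding tangent_def
proof (intro ballI)
  fix c d assume cd: "c \<in> charts_at M p" "d \<in> charts_at M p"
  then have a: "c \<in> atlas M" "d \<in> atlas M" "p \<in> cdom c" "p \<in> cdom d" by (auto simp: charts_at_iff)
  interpret coord_change "cimg c" "metric_form M c" "Gam M c" "cimg d" "metric_form M d" "Gam M d"
    "cmap c ` (cdom c \<inter> cdom d)" "transition c d" by (rule coord_change[OF a(1,2)])
  have "cmap c p \<in> cmap c ` (cdom c \<inter> cdom d)" using a by auto
  from Rm_change[OF this, of "u c" "v c" "w c"]
  show "curv M d (cmap d p) (u d) (v d) (w d) = dirder (curv M c (cmap c p) (u c) (v c) (w c)) (transition c d) (cmap c p)"
    using tangentD[OF assms(1) cd] tangentD[OF assms(2) cd] tangentD[OF assms(3) cd] a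
    by (simp add: curv_eq_Rm transition_cmap)
qed

text \<open>The tangent vector whose components in the chart \<open>c\<close> are \<open>v\<close>;
  it turns a solution computed in one chart into a field with components in all charts.\<close>

definition push :: "'a chart \<Rightarrow> 'a \<Rightarrow> real^4 \<Rightarrow> 'a tvec" where
  "push c p v = (\<lambda>d. dirder v (transition c d) (cmap c p))"

text \<open>The chain rule for transitions on the triple overlap of \<open>c\<close>,
  \<open>d\<close> and \<open>e\<close>.\<close>

lemma tangent_push:
  assumes c: "c \<in> charts_at M p" shows "tangent M p (push c p v)"
  unfolding tangent_def
proof (intro ballI)
  fix d e assume de: "d \<in> charts_at M p" "e \<in> charts_at M p"
  have a: "c \<in> atlas M" "d \<in> atlas M" "e \<in> atlas M" "p \<in> cdom c" "p \<in> cdom d" "p \<in> cdom e"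
    using c de by (auto simp: charts_at_iff)
  let ?N = "cmap c ` (cdom c \<inter> (cdom d \<inter> cdom e))"
  have N: "open ?N" "cmap c p \<in> ?N" using a open_cdom by (auto intro!: open_cmap_image)
  have 1: "(transition c d has_derivative frechet_derivative (transition c d) (at (cmap c p))) (at (cmap c p))"
    by (rule smooth_on_has_derivative[OF smooth_transition]) (use a in auto)
  have 2: "(transition d e has_derivative frechet_derivative (transition d e) (at (cmap d p))) (at (transition c d (cmap c p)))"
    unfolding transition_cmap[OF a(1,4)]
    by (rule smooth_on_has_derivative[OF smooth_transition]) (use a in auto)
  have "frechet_derivative (transition c e) (at (cmap c p)) = frechet_derivative (\<lambda>y. transition d e (transition c d y)) (at (cmap c p))"
    by (rule frechet_derivative_cong_open[OF N]) (use a in \<open>auto simp: transition_cmap\<close>)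
  also have "\<dots> = (\<lambda>h. dirder (dirder h (transition c d) (cmap c p)) (transition d e) (cmap d p))"
    using frechet_derivative_at[OF has_derivative_compose[OF 1 2]] by simp
  finally show "push c p v e = dirder (push c p v d) (transition d e) (cmap d p)"
    by (simp add: push_def)
qed

lemma push_tangent: "tangent M p w \<Longrightarrow> c \<in> charts_at M p \<Longrightarrow> vec_eq M p (push c p (w c)) w"
  unfolding vec_eq_def push_def using tangentD by fastforce

lemma smooth_riemann: "c \<in> atlas M \<Longrightarrow> smooth_on (cimg c) (\<lambda>x. riemann M c x i j k l)"
  unfolding riemann_def pderiv_at_def
  by (intro smooth_on_sum smooth_on_mult smooth_on_add smooth_on_diff smooth_on_dirder smooth_christoffel open_cimg)

lemma continuous_on_curv:
  assumes c: "c \<in> atlas M" and x: "continuous_on S x" "x ` S \<subseteq> cimg c"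
    and u: "continuous_on S u" and v: "continuous_on S v" and w: "continuous_on S w"
  shows "continuous_on S (\<lambda>s. curv M c (x s) (u s) (v s) (w s))"
  unfolding curv_def
  by (intro continuous_on_vec_lambda continuous_intros u v w
     continuous_on_compose2[OF smooth_on_continuous[OF smooth_riemann[OF c]] x])

lemma continuous_on_metric_form:
  assumes c: "c \<in> atlas M" and x: "continuous_on S x" "x ` S \<subseteq> cimg c"
    and u: "continuous_on S u" and v: "continuous_on S v"
  shows "continuous_on S (\<lambda>s. metric_form M c (x s) (u s) (v s))"
  unfolding metric_form_sum
  by (intro continuous_intros u v continuous_on_compose2[OF smooth_on_continuous[OF smooth_metric[OF c]] x])

lemma continuous_on_Gam:
  assumes c: "c \<in> atlas M" and x: "continuous_on S x" "x ` S \<subseteq> cimg c"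
    and u: "continuous_on S u" and v: "continuous_on S v"
  shows "continuous_on S (\<lambda>s. Gam M c (x s) (u s) (v s))"
  unfolding Gam_def
  by (intro continuous_on_vec_lambda continuous_intros u v continuous_on_compose2[OF smooth_on_continuous[OF smooth_christoffel[OF c]] x])

end

section \<open>Parallel transport along a geodesic\<close>

lemma has_vector_derivative_bot: "at t within S = bot \<Longrightarrow> (f has_vector_derivative D) (at t within S)"
  unfolding has_vector_derivative_def has_derivative_def using bounded_linear_scaleR_left by auto

lemma at_within_Int_open: "open N \<Longrightarrow> t \<in> N \<Longrightarrow> at t within S \<inter> N = at t within (S :: real set)"
  by (rule at_within_nhd[of _ N]) auto

locale geodesic_segment = spacetime M for M :: "'a::{t2_space,second_countable_topology} spacetime" +
  fixes L :: real and \<gamma> :: "real \<Rightarrow> 'a"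
  assumes L: "0 < L" and geod: "geodesic M {0..L} \<gamma>"
begin

abbreviation k where "k \<equiv> velocity {0..L} \<gamma>"

text \<open>The equation is restricted to a subinterval, with derivatives within
  \<open>{a..b}\<close>, so that solutions can be glued; the velocity \<open>k\<close> is always
  that of the whole curve.\<close>

definition parallel_on :: "real \<Rightarrow> real \<Rightarrow> (real \<Rightarrow> 'a tvec) \<Rightarrow> bool" where
  "parallel_on a b V \<longleftrightarrow> (\<forall>t\<in>{a..b}. tangent M (\<gamma> t) (V t) \<and> (\<forall>c\<in>charts_at M (\<gamma> t).
     ((\<lambda>s. V s c) has_vector_derivative - Gam M c (cmap c (\<gamma> t)) (k t c) (V t c)) (at t within {a..b})))"

lemma continuous_\<gamma>: "continuous_on {0..L} \<gamma>"
  using geod by (simp add: geodesic_def differentiable_curve_def)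

lemma chart_nbhd:
  assumes "t \<in> {0..L}" "c \<in> charts_at M (\<gamma> t)"
  obtains N where "open N" "t \<in> N" "\<And>s. s \<in> {0..L} \<inter> N \<Longrightarrow> c \<in> charts_at M (\<gamma> s)"
proof -
  have c: "c \<in> atlas M" "\<gamma> t \<in> cdom c" using assms(2) by (auto simp: charts_at_iff)
  obtain N where N: "open N" "N \<inter> {0..L} = \<gamma> -` cdom c \<inter> {0..L}"
    using continuous_\<gamma> open_cdom[OF c(1)] unfolding continuous_on_open_invariant by blast
  show thesis
  proof (rule that[of N])
    have "t \<in> \<gamma> -` cdom c \<inter> {0..L}" using assms(1) c by simp
    then show "t \<in> N" using N(2) by blast
    fix s assume "s \<in> {0..L} \<inter> N"
    then have "s \<in> \<gamma> -` cdom c \<inter> {0..L}" using N(2) by blast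
    then show "c \<in> charts_at M (\<gamma> s)" using c by (simp add: charts_at_iff)
  qed (rule N(1))
qed

lemma coord_deriv:
  assumes "t \<in> {0..L}" "c \<in> charts_at M (\<gamma> t)"
  shows "((\<lambda>s. cmap c (\<gamma> s)) has_vector_derivative k t c) (at t within {0..L})"
  using geod assms unfolding geodesic_def differentiable_curve_def velocity_def
  by (auto simp: vector_derivative_works[symmetric] o_def)

lemma continuous_on_coord:
  assumes "S \<subseteq> {0..L}" "\<And>s. s \<in> S \<Longrightarrow> c \<in> charts_at M (\<gamma> s)"
  shows "continuous_on S (\<lambda>s. cmap c (\<gamma> s))"
proof (cases "S = {}")
  case False
  then have "c \<in> atlas M" using assms(2) by (auto simp: charts_at_iff)
  then show ?thesis
    using assms by (intro continuous_on_compose2[OF continuous_on_cmap continuous_on_subset[OF continuous_\<gamma>]])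
      (auto simp: charts_at_iff)
qed simp

lemma parallel_field_iff:
  "parallel_field M {0..L} \<gamma> V \<longleftrightarrow> parallel_on 0 L V"
proof
  assume p: "parallel_field M {0..L} \<gamma> V"
  show "parallel_on 0 L V"
    unfolding parallel_on_def
  proof (intro ballI conjI)
    fix t assume t: "t \<in> {0..L}"
    then show "tangent M (\<gamma> t) (V t)" using p by (simp add: parallel_field_def differentiable_field_def)
    fix c assume c: "c \<in> charts_at M (\<gamma> t)"
    have "((\<lambda>s. V s c) has_vector_derivative vector_derivative (\<lambda>s. V s c) (at t within {0..L})) (at t within {0..L})"
      using p t c by (simp add: parallel_field_def differentiable_field_def vector_derivative_works[symmetric])
    moreover have "vector_derivative (\<lambda>s. V s c) (at t within {0..L}) = - Gam M c (cmap c (\<gamma> t)) (k t c) (V t c)"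
      using p t c by (simp add: parallel_field_def vec_zero_def cov_deriv_def eq_neg_iff_add_eq_0)
    ultimately show "((\<lambda>s. V s c) has_vector_derivative - Gam M c (cmap c (\<gamma> t)) (k t c) (V t c)) (at t within {0..L})"
      by simp
  qed
next
  assume p: "parallel_on 0 L V"
  have d: "((\<lambda>s. V s c) has_vector_derivative - Gam M c (cmap c (\<gamma> t)) (k t c) (V t c)) (at t within {0..L})"
    if "t \<in> {0..L}" "c \<in> charts_at M (\<gamma> t)" for t c
    using p that unfolding parallel_on_def by blast
  have "(\<lambda>s. V s c) differentiable (at t within {0..L})"
    "vector_derivative (\<lambda>s. V s c) (at t within {0..L}) = - Gam M c (cmap c (\<gamma> t)) (k t c) (V t c)"
    if "t \<in> {0..L}" "c \<in> charts_at M (\<gamma> t)" for t c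
    using d[OF that] vector_derivative_within_closed_interval[OF L that(1)] by (auto intro: differentiableI_vector)
  then show "parallel_field M {0..L} \<gamma> V"
    unfolding parallel_field_def differentiable_field_def vec_zero_def cov_deriv_def
    using p unfolding parallel_on_def by simp
qed

lemma parallel_k: "parallel_on 0 L k"
  using geod unfolding geodesic_def parallel_field_iff by blast

lemma parallel_onD:
  assumes "parallel_on a b V" "t \<in> {a..b}"
  shows "tangent M (\<gamma> t) (V t)" "c \<in> charts_at M (\<gamma> t) \<Longrightarrow>
     ((\<lambda>s. V s c) has_vector_derivative - Gam M c (cmap c (\<gamma> t)) (k t c) (V t c)) (at t within {a..b})"
  using assms unfolding parallel_on_def by blast+

lemma continuous_on_field:
  assumes V: "\<And>t. t \<in> {0..L} \<Longrightarrow> c \<in> charts_at M (\<gamma> t) \<Longrightarrow> \<exists>D. ((\<lambda>s. V s c) has_vector_derivative D) (at t within {0..L})"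
    and S: "S \<subseteq> {0..L}" "\<And>s. s \<in> S \<Longrightarrow> c \<in> charts_at M (\<gamma> s)"
  shows "continuous_on S (\<lambda>s. V s c)"
  unfolding continuous_on_eq_continuous_within
proof
  fix s assume "s \<in> S"
  then obtain D where "((\<lambda>s. V s c) has_vector_derivative D) (at s within {0..L})" using V S by blast
  then show "continuous (at s within S) (\<lambda>s. V s c)"
    using has_vector_derivative_continuous continuous_within_subset S(1) by blast
qed

lemma continuous_on_parallel:
  assumes "parallel_on 0 L V" "S \<subseteq> {0..L}" "\<And>s. s \<in> S \<Longrightarrow> c \<in> charts_at M (\<gamma> s)"
  shows "continuous_on S (\<lambda>s. V s c)"
  by (rule continuous_on_field) (use parallel_onD[OF assms(1)] assms in blast)+

text \<open>Differentiating \<open>DT\<close> along the curve produces a \<open>D2T\<close> term,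
  and the inhomogeneous part of \<open>G_change\<close> cancels it: the transport equation has the
  same form in every chart.\<close>

lemma push_parallel:
  assumes ab: "0 \<le> a" "b \<le> L" and t: "t \<in> {a..b}" and cd: "c \<in> charts_at M (\<gamma> t)" "d \<in> charts_at M (\<gamma> t)"
    and y: "(y has_vector_derivative - Gam M c (cmap c (\<gamma> t)) (k t c) (y t)) (at t within {a..b})"
  shows "((\<lambda>s. push c (\<gamma> s) (y s) d) has_vector_derivative
     - Gam M d (cmap d (\<gamma> t)) (k t d) (push c (\<gamma> t) (y t) d)) (at t within {a..b})"
proof -
  have tI: "t \<in> {0..L}" and sub: "{a..b} \<subseteq> {0..L}" using ab t by auto
  have a: "c \<in> atlas M" "d \<in> atlas M" "\<gamma> t \<in> cdom c" "\<gamma> t \<in> cdom d" using cd by (auto simp: charts_at_iff)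
  interpret coord_change "cimg c" "metric_form M c" "Gam M c" "cimg d" "metric_form M d" "Gam M d"
    "cmap c ` (cdom c \<inter> cdom d)" "transition c d" by (rule coord_change[OF a(1,2)])
  let ?x = "cmap c (\<gamma> t)"
  have x: "?x \<in> cmap c ` (cdom c \<inter> cdom d)" using a by auto
  obtain O1 O2 where N: "open O1" "t \<in> O1" "\<And>s. s \<in> {0..L} \<inter> O1 \<Longrightarrow> c \<in> charts_at M (\<gamma> s)"
    "open O2" "t \<in> O2" "\<And>s. s \<in> {0..L} \<inter> O2 \<Longrightarrow> d \<in> charts_at M (\<gamma> s)"
    using chart_nbhd[OF tI cd(1)] chart_nbhd[OF tI cd(2)] by metis
  let ?S = "{a..b} \<inter> (O1 \<inter> O2)"
  have at: "at t within ?S = at t within {a..b}" using N by (intro at_within_Int_open) auto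
  have xd: "((\<lambda>s. cmap c (\<gamma> s)) has_derivative (\<lambda>h. h *\<^sub>R k t c)) (at t within ?S)"
    unfolding at using has_vector_derivative_within_subset[OF coord_deriv[OF tI cd(1)] sub]
    by (simp add: has_vector_derivative_def)
  have "((\<lambda>s. DT (cmap c (\<gamma> s)) (y s)) has_derivative (\<lambda>h. D2T ?x (h *\<^sub>R k t c) (y t)
     + DT ?x (h *\<^sub>R - Gam M c ?x (k t c) (y t)))) (at t within ?S)"
  proof (rule has_derivative_apply_linear[where B' = "\<lambda>v h. D2T ?x (h *\<^sub>R k t c) v"])
    show "((\<lambda>s. DT (cmap c (\<gamma> s)) v) has_derivative (\<lambda>h. D2T ?x (h *\<^sub>R k t c) v)) (at t within ?S)" for v
      by (rule has_derivative_compose[OF xd DT_deriv[OF x]])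
    show "linear (DT (cmap c (\<gamma> s)))" if "s \<in> ?S" for s
      by (rule DT_linear) (use N that sub in \<open>auto simp: charts_at_iff\<close>)
    show "(y has_derivative (\<lambda>h. h *\<^sub>R - Gam M c ?x (k t c) (y t))) (at t within ?S)"
      unfolding at using y by (simp add: has_vector_derivative_def)
  qed (use t N in auto)
  moreover have "D2T ?x (h *\<^sub>R k t c) (y t) + DT ?x (h *\<^sub>R - Gam M c ?x (k t c) (y t)) =
     h *\<^sub>R - Gam M d (cmap d (\<gamma> t)) (k t d) (push c (\<gamma> t) (y t) d)" for h
  proof -
    have "k t d = DT ?x (k t c)" using tangentD[OF parallel_onD(1)[OF parallel_k tI] cd] .
    then have "DT ?x (Gam M c ?x (k t c) (y t)) = Gam M d (cmap d (\<gamma> t)) (k t d) (push c (\<gamma> t) (y t) d)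
        + D2T ?x (k t c) (y t)"
      using G_change[OF x] transition_cmap[OF a(1,3)] by (simp add: push_def)
    moreover have "D2T ?x (h *\<^sub>R k t c) (y t) = h *\<^sub>R D2T ?x (k t c) (y t)"
      using linear_cmul[OF smooth_on_linear[OF smooth_on_dirder[OF T_smooth] x]] .
    moreover have "DT ?x (h *\<^sub>R - Gam M c ?x (k t c) (y t)) = - h *\<^sub>R DT ?x (Gam M c ?x (k t c) (y t))"
      using linear_cmul[OF DT_linear[OF x], of "- h"] by simp
    ultimately show ?thesis by (simp add: algebra_simps)
  qed
  ultimately show ?thesis unfolding at by (simp add: has_vector_derivative_def push_def)
qed

text \<open>The premise on \<open>a\<close> and \<open>b\<close> makes the notion vacuous for
  intervals that leave \<open>{0..L}\<close>, since the subdivision argument \<open>Bolzano\<close>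
  also quantifies over these.\<close>

definition transportable :: "real \<Rightarrow> real \<Rightarrow> bool" where
  "transportable a b \<longleftrightarrow> (0 \<le> a \<and> a \<le> b \<and> b \<le> L \<longrightarrow>
     (\<forall>v. tangent M (\<gamma> a) v \<longrightarrow> (\<exists>V. parallel_on a b V \<and> vec_eq M (\<gamma> a) (V a) v)))"

lemma transportable_in_chart:
  assumes ab: "0 \<le> a" "a \<le> b" "b \<le> L" and c: "\<And>s. s \<in> {a..b} \<Longrightarrow> c \<in> charts_at M (\<gamma> s)"
  shows "transportable a b"
  unfolding transportable_def
proof (intro impI allI)
  fix v assume v: "tangent M (\<gamma> a) v"
  have ca: "c \<in> atlas M" "c \<in> charts_at M (\<gamma> a)" using c ab by (auto simp: charts_at_iff)
  have sub: "{a..b} \<subseteq> {0..L}" using ab by auto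
  have cont: "continuous_on {a..b} (\<lambda>s. - Gam M c (cmap c (\<gamma> s)) (k s c) w)" for w
    using continuous_on_coord[OF sub c] continuous_on_parallel[OF parallel_k sub c] c
    by (intro continuous_on_minus continuous_on_Gam ca continuous_on_const) (auto simp: charts_at_iff)
  have lin: "linear (\<lambda>w. - Gam M c (cmap c (\<gamma> s)) (k s c) w)" for s
    using bilinear_Gam[of M c "cmap c (\<gamma> s)"] by (intro linear_compose_neg) (simp add: bilinear_def)
  obtain y where y: "y a = v c" "\<And>t. t \<in> {a..b} \<Longrightarrow>
      (y has_vector_derivative - Gam M c (cmap c (\<gamma> t)) (k t c) (y t)) (at t within {a..b})"
    using linear_ode_exists[OF ab(2) lin cont, of "v c"] by metis
  have "parallel_on a b (\<lambda>s. push c (\<gamma> s) (y s))"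
    unfolding parallel_on_def using push_parallel[OF ab(1,3) _ c _ y(2)] tangent_push[OF c] by blast
  moreover have "vec_eq M (\<gamma> a) (push c (\<gamma> a) (y a)) v"
    using push_tangent[OF v ca(2)] y(1) by simp
  ultimately show "\<exists>V. parallel_on a b V \<and> vec_eq M (\<gamma> a) (V a) v" by blast
qed

text \<open>The concatenation satisfies the equation from either side of \<open>b\<close>, and a
  derivative within a union of two sets only requires the derivatives within each of them.\<close>

lemma transportable_trans:
  assumes 1: "transportable a b" and 2: "transportable b c" and "a \<le> b" "b \<le> c"
  shows "transportable a c"
  unfolding transportable_def
proof (intro impI allI)
  fix v assume r: "0 \<le> a \<and> a \<le> c \<and> c \<le> L" and v: "tangent M (\<gamma> a) v"
  obtain V where V: "parallel_on a b V" "vec_eq M (\<gamma> a) (V a) v"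
    using 1 v r assms(3,4) unfolding transportable_def by auto
  have "tangent M (\<gamma> b) (V b)" using parallel_onD(1)[OF V(1)] assms(3) by simp
  then obtain W where W: "parallel_on b c W" "vec_eq M (\<gamma> b) (W b) (V b)"
    using 2 r assms(3,4) unfolding transportable_def by auto
  define Z where "Z s = (if s \<le> b then V s else W s)" for s
  have "parallel_on a c Z"
    unfolding parallel_on_def
  proof (intro ballI conjI)
    fix t assume t: "t \<in> {a..c}"
    show "tangent M (\<gamma> t) (Z t)"
      using parallel_onD(1)[OF V(1)] parallel_onD(1)[OF W(1)] t by (auto simp: Z_def)
    fix d assume d: "d \<in> charts_at M (\<gamma> t)"
    let ?D = "- Gam M d (cmap d (\<gamma> t)) (k t d) (Z t d)"
    have ZW: "Z s d = W s d" if "s \<in> {b..c}" "d \<in> charts_at M (\<gamma> s)" for s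
      using W(2) that by (auto simp: Z_def vec_eq_def)
    have L1: "((\<lambda>s. Z s d) has_vector_derivative ?D) (at t within {a..b})"
    \<comment> \<open>For \<open>t\<close> outside the subinterval the filter is trivial and the
      one-sided claim is void.\<close>
    proof (cases "t \<le> b")
      case True
      show ?thesis
        by (rule has_vector_derivative_transform[OF _ _ parallel_onD(2)[OF V(1) _ d, THEN has_vector_derivative_eq_rhs]])
          (use True t in \<open>auto simp: Z_def\<close>)
    next
      case False
      then have "at t within {a..b} = bot" by (auto simp: at_within_eq_bot_iff)
      then show ?thesis by (rule has_vector_derivative_bot)
    qed
    have L2: "((\<lambda>s. Z s d) has_vector_derivative ?D) (at t within {b..c})"
    proof (cases "b \<le> t")
      case True
      have tI: "t \<in> {0..L}" "t \<in> {b..c}" using t r True assms by auto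
      \<comment> \<open>At the junction \<open>Z\<close> and \<open>W\<close> agree only in charts
        around the base point, so the comparison is confined to parameters for which
        \<open>d\<close> is such a chart.\<close>
      obtain N where N: "open N" "t \<in> N" "\<And>s. s \<in> {0..L} \<inter> N \<Longrightarrow> d \<in> charts_at M (\<gamma> s)"
        using chart_nbhd[OF tI(1) d] by metis
      have at: "at t within {b..c} \<inter> N = at t within {b..c}" by (rule at_within_Int_open[OF N(1,2)])
      have "((\<lambda>s. W s d) has_vector_derivative ?D) (at t within {b..c} \<inter> N)"
        unfolding at using parallel_onD(2)[OF W(1) tI(2) d] ZW[OF tI(2) d] by simp
      then show ?thesis unfolding at[symmetric]
        by (rule has_vector_derivative_transform[rotated 2]) (use N tI r assms ZW in auto)
    next
      case False
      then have "at t within {b..c} = bot" by (auto simp: at_within_eq_bot_iff)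
      then show ?thesis by (rule has_vector_derivative_bot)
    qed
    have "{a..c} = {a..b} \<union> {b..c}" using assms by auto
    then show "((\<lambda>s. Z s d) has_vector_derivative ?D) (at t within {a..c})"
      using L1 L2 unfolding has_vector_derivative_def has_derivative_within by (simp add: Lim_within_Un)
  qed
  moreover have "vec_eq M (\<gamma> a) (Z a) v" using V(2) assms(3) by (simp add: Z_def)
  ultimately show "\<exists>V. parallel_on a c V \<and> vec_eq M (\<gamma> a) (V a) v" by blast
qed

text \<open>Near each parameter one chart covers \<gamma>, and transport composes, so bisection
  extends it to the whole segment.\<close>

lemma parallel_transport:
  assumes "tangent M (\<gamma> 0) v"
  obtains V where "parallel_on 0 L V" "vec_eq M (\<gamma> 0) (V 0) v"
proof -
  have "transportable 0 L"
  proof (rule Bolzano[where P = transportable])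
    show "0 \<le> L" using L by simp
    show "transportable a c" if "transportable a b" "transportable b c" "a \<le> b" "b \<le> c" for a b c
      by (rule transportable_trans[OF that])
    fix x assume x: "0 \<le> x" "x \<le> L"
    obtain N where N: "open N" "x \<in> N" "\<And>s. s \<in> {0..L} \<inter> N \<Longrightarrow> chart_at M (\<gamma> x) \<in> charts_at M (\<gamma> s)"
      using chart_nbhd[OF _ chart_at, of x] x by auto
    then obtain \<delta> where \<delta>: "\<delta> > 0" "ball x \<delta> \<subseteq> N" using openE by blast
    show "\<exists>d>0. \<forall>a b. a \<le> x \<and> x \<le> b \<and> b - a < d \<longrightarrow> transportable a b"
    proof (intro exI[of _ \<delta>] conjI allI impI \<delta>(1))
      fix a b assume ab: "a \<le> x \<and> x \<le> b \<and> b - a < \<delta>"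
      show "transportable a b"
      proof (cases "0 \<le> a \<and> b \<le> L")
        case True
        show ?thesis
        proof (rule transportable_in_chart)
          fix s assume s: "s \<in> {a..b}"
          then have "s \<in> ball x \<delta>" using ab by (auto simp: dist_real_def)
          then show "chart_at M (\<gamma> x) \<in> charts_at M (\<gamma> s)" using \<delta>(2) N(3) s True by auto
        qed (use True ab in auto)
      qed (auto simp: transportable_def)
    qed
  qed
  then show thesis using assms that L unfolding transportable_def by auto
qed

text \<open>Near \<open>t\<close> the product is computed in the fixed chart at \<gamma> t, where
  metric compatibility makes its derivative vanish.\<close>

lemma ip_parallel:
  assumes V: "parallel_on 0 L V" and W: "parallel_on 0 L W" and t: "t \<in> {0..L}"
  shows "ip M (\<gamma> t) (V t) (W t) = ip M (\<gamma> 0) (V 0) (W 0)"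
proof -
  have "((\<lambda>s. ip M (\<gamma> s) (V s) (W s)) has_vector_derivative 0) (at t within {0..L})" if t: "t \<in> {0..L}" for t
  proof -
    let ?c = "chart_at M (\<gamma> t)"
    note c = chart_at[of "\<gamma> t"] chart_at_atlas[of "\<gamma> t"]
    interpret coord_metric "cimg ?c" "metric_form M ?c" "Gam M ?c" by (rule coord_metric[OF c(2)])
    have x: "cmap ?c (\<gamma> t) \<in> cimg ?c" using c by auto
    obtain N where N: "open N" "t \<in> N" "\<And>s. s \<in> {0..L} \<inter> N \<Longrightarrow> ?c \<in> charts_at M (\<gamma> s)"
      using chart_nbhd[OF t c(1)] by metis
    have at: "at t within {0..L} \<inter> N = at t within {0..L}" by (rule at_within_Int_open[OF N(1,2)])
    let ?x = "cmap ?c (\<gamma> t)"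
    have xd: "((\<lambda>s. cmap ?c (\<gamma> s)) has_derivative (\<lambda>h. h *\<^sub>R k t ?c)) (at t within {0..L})"
      using coord_deriv[OF t c(1)] by (simp add: has_vector_derivative_def)
    have "((\<lambda>s. metric_form M ?c (cmap ?c (\<gamma> s)) (V s ?c) (W s ?c)) has_derivative
      (\<lambda>h. dg ?x (h *\<^sub>R k t ?c) (V t ?c) (W t ?c)
       + metric_form M ?c ?x (h *\<^sub>R - Gam M ?c ?x (k t ?c) (V t ?c)) (W t ?c)
       + metric_form M ?c ?x (V t ?c) (h *\<^sub>R - Gam M ?c ?x (k t ?c) (W t ?c)))) (at t within {0..L})"
    proof (rule has_derivative_apply_bilinear[where B' = "\<lambda>u v h. dg ?x (h *\<^sub>R k t ?c) u v"])
      show "((\<lambda>s. metric_form M ?c (cmap ?c (\<gamma> s)) u v) has_derivative (\<lambda>h. dg ?x (h *\<^sub>R k t ?c) u v)) (at t within {0..L})" for u v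
        by (rule has_derivative_compose[OF xd smooth_on_has_derivative[OF g_smooth x]])
    qed (use parallel_onD(2)[OF V t c(1)] parallel_onD(2)[OF W t c(1)] g_bil t in \<open>auto simp: has_vector_derivative_def\<close>)
    moreover have "dg ?x (h *\<^sub>R k t ?c) (V t ?c) (W t ?c)
       + metric_form M ?c ?x (h *\<^sub>R - Gam M ?c ?x (k t ?c) (V t ?c)) (W t ?c)
       + metric_form M ?c ?x (V t ?c) (h *\<^sub>R - Gam M ?c ?x (k t ?c) (W t ?c)) = h *\<^sub>R 0" for h
      unfolding compat[OF x] by (simp add: G_simps g_simps)
    ultimately have "((\<lambda>s. metric_form M ?c (cmap ?c (\<gamma> s)) (V s ?c) (W s ?c)) has_vector_derivative 0) (at t within {0..L} \<inter> N)"
      unfolding at by (simp add: has_vector_derivative_def)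
    then show ?thesis unfolding at[symmetric]
      by (rule has_vector_derivative_transform[rotated 2])
        (use N t c parallel_onD(1)[OF V] parallel_onD(1)[OF W] in \<open>auto intro!: ip_chart\<close>)
  qed
  then obtain C where "\<And>t. t \<in> {0..L} \<Longrightarrow> ip M (\<gamma> t) (V t) (W t) = C"
    using has_derivative_zero_constant[of "{0..L}" "\<lambda>s. ip M (\<gamma> s) (V s) (W s)"]
    by (auto simp: has_vector_derivative_def)
  then show ?thesis using t L by simp
qed

end

section \<open>Jacobi fields in a parallel frame\<close>

context geodesic_segment
begin

lemma continuous_on_ip:
  assumes V: "\<And>t. t \<in> {0..L} \<Longrightarrow> tangent M (\<gamma> t) (V t)" and W: "\<And>t. t \<in> {0..L} \<Longrightarrow> tangent M (\<gamma> t) (W t)"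
    and cV: "\<And>S c. S \<subseteq> {0..L} \<Longrightarrow> (\<And>s. s \<in> S \<Longrightarrow> c \<in> charts_at M (\<gamma> s)) \<Longrightarrow> continuous_on S (\<lambda>s. V s c)"
    and cW: "\<And>S c. S \<subseteq> {0..L} \<Longrightarrow> (\<And>s. s \<in> S \<Longrightarrow> c \<in> charts_at M (\<gamma> s)) \<Longrightarrow> continuous_on S (\<lambda>s. W s c)"
  shows "continuous_on {0..L} (\<lambda>t. ip M (\<gamma> t) (V t) (W t))"
  unfolding continuous_on_eq_continuous_within
proof
  fix t assume t: "t \<in> {0..L}"
  let ?c = "chart_at M (\<gamma> t)"
  note c = chart_at[of "\<gamma> t"] chart_at_atlas[of "\<gamma> t"]
  obtain N where N: "open N" "t \<in> N" "\<And>s. s \<in> {0..L} \<inter> N \<Longrightarrow> ?c \<in> charts_at M (\<gamma> s)"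
    using chart_nbhd[OF t c(1)] by metis
  have sub: "{0..L} \<inter> N \<subseteq> {0..L}" by blast
  have "continuous_on ({0..L} \<inter> N) (\<lambda>s. metric_form M ?c (cmap ?c (\<gamma> s)) (V s ?c) (W s ?c))"
    using N(3) by (intro continuous_on_metric_form c continuous_on_coord cV cW sub) (auto simp: charts_at_iff)
  then have "continuous_on ({0..L} \<inter> N) (\<lambda>t. ip M (\<gamma> t) (V t) (W t))"
    by (rule continuous_on_eq) (use ip_chart[OF V W N(3)] in auto)
  then have "continuous (at t within {0..L} \<inter> N) (\<lambda>t. ip M (\<gamma> t) (V t) (W t))"
    using t N(2) unfolding continuous_on_eq_continuous_within by blast
  then show "continuous (at t within {0..L}) (\<lambda>t. ip M (\<gamma> t) (V t) (W t))"
    unfolding at_within_Int_open[OF N(1,2)] .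
qed

end

text \<open>The field \<open>h\<close> completes \<open>e1\<close>, \<open>e2\<close>,
  \<open>k\<close> to a basis. Its products with \<open>e1\<close>, \<open>e2\<close> and itself are
  left open, so the frame need not be adapted to \<open>h\<close>.\<close>

locale null_frame = geodesic_segment +
  fixes e1 e2 h :: "real \<Rightarrow> 'a tvec"
  assumes e1: "parallel_on 0 L e1" and e2: "parallel_on 0 L e2" and h: "parallel_on 0 L h"
    and ip_frame: "\<And>t. t \<in> {0..L} \<Longrightarrow> ip M (\<gamma> t) (e1 t) (e1 t) = -1" "\<And>t. t \<in> {0..L} \<Longrightarrow> ip M (\<gamma> t) (e2 t) (e2 t) = -1"
      "\<And>t. t \<in> {0..L} \<Longrightarrow> ip M (\<gamma> t) (e1 t) (e2 t) = 0" "\<And>t. t \<in> {0..L} \<Longrightarrow> ip M (\<gamma> t) (e1 t) (k t) = 0"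
      "\<And>t. t \<in> {0..L} \<Longrightarrow> ip M (\<gamma> t) (e2 t) (k t) = 0" "\<And>t. t \<in> {0..L} \<Longrightarrow> ip M (\<gamma> t) (k t) (k t) = 0"
      "\<And>t. t \<in> {0..L} \<Longrightarrow> ip M (\<gamma> t) (h t) (k t) = 1"
begin

definition tidal :: "(real \<Rightarrow> 'a tvec) \<Rightarrow> real \<Rightarrow> 'a tvec" where
  "tidal u t = (\<lambda>c. curv M c (cmap c (\<gamma> t)) (u t c) (k t c) (k t c))"

text \<open>The coefficients of \<open>e\<^sub>i\<close> in \<open>R(e\<^sub>j,k)k\<close>; the sign is due to \<open>g(e\<^sub>i,e\<^sub>i) = -1\<close>.\<close>

definition K :: "(real \<Rightarrow> 'a tvec) \<Rightarrow> (real \<Rightarrow> 'a tvec) \<Rightarrow> real \<Rightarrow> real" where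
  "K u v t = - ip M (\<gamma> t) (tidal u t) (v t)"

text \<open>The coefficient of \<open>k\<close> in R(u,k)k. Pairing with \<open>h\<close> isolates
  it because g(h,k) = 1, after subtracting what the components along \<open>e1\<close> and
  \<open>e2\<close> contribute.\<close>

definition \<kappa> :: "(real \<Rightarrow> 'a tvec) \<Rightarrow> real \<Rightarrow> real" where
  "\<kappa> u t = ip M (\<gamma> t) (tidal u t) (h t) - K u e1 t * ip M (\<gamma> t) (e1 t) (h t) - K u e2 t * ip M (\<gamma> t) (e2 t) (h t)"

lemma tangent_k: "t \<in> {0..L} \<Longrightarrow> tangent M (\<gamma> t) (k t)"
  using parallel_onD(1)[OF parallel_k] .

lemma tangent_tidal: "parallel_on 0 L u \<Longrightarrow> t \<in> {0..L} \<Longrightarrow> tangent M (\<gamma> t) (tidal u t)"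
  unfolding tidal_def using tangent_curv parallel_onD(1) tangent_k by blast

lemma continuous_on_tidal:
  assumes u: "parallel_on 0 L u" and S: "S \<subseteq> {0..L}" "\<And>s. s \<in> S \<Longrightarrow> c \<in> charts_at M (\<gamma> s)"
  shows "continuous_on S (\<lambda>s. tidal u s c)"
proof (cases "S = {}")
  case False
  then have "c \<in> atlas M" using S by (auto simp: charts_at_iff)
  then show ?thesis
    unfolding tidal_def using S
    by (intro continuous_on_curv continuous_on_coord continuous_on_parallel[OF u] continuous_on_parallel[OF parallel_k])
      (auto simp: charts_at_iff)
qed simp

lemma continuous_on_K: "parallel_on 0 L u \<Longrightarrow> parallel_on 0 L v \<Longrightarrow> continuous_on {0..L} (K u v)"
  unfolding K_def[abs_def]
  by (intro continuous_on_minus continuous_on_ip tangent_tidal continuous_on_tidal continuous_on_parallel)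
    (use parallel_onD(1) in auto)

lemma continuous_on_\<kappa>: "parallel_on 0 L u \<Longrightarrow> continuous_on {0..L} (\<kappa> u)"
  unfolding \<kappa>_def[abs_def]
  by (intro continuous_intros continuous_on_ip tangent_tidal continuous_on_tidal continuous_on_parallel continuous_on_K e1 e2 h)
    (use parallel_onD(1) e1 e2 h in auto)

context
  fixes t c assumes t: "t \<in> {0..L}" and c: "c \<in> charts_at M (\<gamma> t)"
begin

interpretation coord_metric "cimg c" "metric_form M c" "Gam M c"
  by (rule coord_metric) (use c in \<open>simp add: charts_at_iff\<close>)

lemma x_in: "cmap c (\<gamma> t) \<in> cimg c" and c_atlas: "c \<in> atlas M"
  using c by (auto simp: charts_at_iff)

lemma metric_form_frame:
  defines "G \<equiv> metric_form M c (cmap c (\<gamma> t))"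
  shows "G (e1 t c) (e1 t c) = -1" "G (e2 t c) (e2 t c) = -1" "G (e1 t c) (e2 t c) = 0" "G (e2 t c) (e1 t c) = 0"
    "G (e1 t c) (k t c) = 0" "G (e2 t c) (k t c) = 0" "G (k t c) (k t c) = 0" "G (h t c) (k t c) = 1"
    "G (k t c) (e1 t c) = 0" "G (k t c) (e2 t c) = 0" "G (k t c) (h t c) = 1"
proof -
  note tan = parallel_onD(1)[OF e1 t] parallel_onD(1)[OF e2 t] parallel_onD(1)[OF h t] parallel_onD(1)[OF parallel_k t]
  show 1: "G (e1 t c) (e1 t c) = -1" "G (e2 t c) (e2 t c) = -1" "G (e1 t c) (e2 t c) = 0"
    "G (e1 t c) (k t c) = 0" "G (e2 t c) (k t c) = 0" "G (k t c) (k t c) = 0" "G (h t c) (k t c) = 1"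
    using ip_frame[OF t] ip_chart[OF tan(1,1) c] ip_chart[OF tan(2,2) c] ip_chart[OF tan(1,2) c]
      ip_chart[OF tan(1,4) c] ip_chart[OF tan(2,4) c] ip_chart[OF tan(4,4) c] ip_chart[OF tan(3,4) c]
    unfolding G_def by simp_all
  show "G (e2 t c) (e1 t c) = 0" "G (k t c) (e1 t c) = 0" "G (k t c) (e2 t c) = 0" "G (k t c) (h t c) = 1"
    using 1 g_sym[OF x_in] unfolding G_def by simp_all
qed

text \<open>Pairing a vanishing combination with \<open>k\<close>, \<open>e1\<close>,
  \<open>e2\<close> and finally \<open>h\<close> isolates the coefficients of \<open>h\<close>,
  \<open>e1\<close>, \<open>e2\<close> and \<open>k\<close> in turn; a dimension count does the
  rest.\<close>

lemma frame_basis: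
  obtains y :: "real^4" where "w = y $ 1 *\<^sub>R e1 t c + y $ 2 *\<^sub>R e2 t c + y $ 3 *\<^sub>R k t c + y $ 4 *\<^sub>R h t c"
proof -
  let ?F = "\<lambda>y :: real^4. y $ 1 *\<^sub>R e1 t c + y $ 2 *\<^sub>R e2 t c + y $ 3 *\<^sub>R k t c + y $ 4 *\<^sub>R h t c"
  have L: "linear ?F" by (auto intro!: linearI simp: algebra_simps)
  have "inj ?F"
    unfolding linear_injective_0[OF L]
  proof safe
    fix y assume y: "?F y = 0"
    let ?g = "metric_form M c (cmap c (\<gamma> t))"
    have "?g (?F y) (k t c) = 0" "?g (?F y) (e1 t c) = 0" "?g (?F y) (e2 t c) = 0" "?g (?F y) (h t c) = 0"
      unfolding y by (simp_all add: g_simps)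
    then have "y $ 4 = 0" "y $ 1 = 0" "y $ 2 = 0" "y $ 3 = 0"
      by (simp_all add: g_simps metric_form_frame)
    then show "y = 0" by (simp add: vec_eq_iff forall_4)
  qed
  then have "surj ?F" by (rule linear_inj_imp_surj[OF L])
  then obtain y where "w = ?F y" by (rule surjE)
  then show thesis by (rule that)
qed

lemma tidal_eq_Rm: "tidal u t c = Rm (cmap c (\<gamma> t)) (u t c) (k t c) (k t c)"
  unfolding tidal_def using curv_eq_Rm[OF c_atlas x_in] .

lemma tidal_k: "metric_form M c (cmap c (\<gamma> t)) (tidal u t c) (k t c) = 0"
  unfolding tidal_eq_Rm using Rm_anti34[OF x_in, of "u t c" "k t c" "k t c" "k t c"] g_sym[OF x_in] by simp

lemma K_chart: "parallel_on 0 L u \<Longrightarrow> parallel_on 0 L v \<Longrightarrow> K u v t = - metric_form M c (cmap c (\<gamma> t)) (tidal u t c) (v t c)"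
  unfolding K_def using ip_chart[OF tangent_tidal[OF _ t] parallel_onD(1)[OF _ t] c] by simp

lemma \<kappa>_chart: "parallel_on 0 L u \<Longrightarrow> \<kappa> u t = metric_form M c (cmap c (\<gamma> t)) (tidal u t c) (h t c)
   - K u e1 t * metric_form M c (cmap c (\<gamma> t)) (e1 t c) (h t c) - K u e2 t * metric_form M c (cmap c (\<gamma> t)) (e2 t c) (h t c)"
  unfolding \<kappa>_def using ip_chart[OF tangent_tidal[OF _ t] parallel_onD(1)[OF h t] c]
     ip_chart[OF parallel_onD(1)[OF e1 t] parallel_onD(1)[OF h t] c] ip_chart[OF parallel_onD(1)[OF e2 t] parallel_onD(1)[OF h t] c]
  by simp

text \<open>Both sides have the same products with the four basis vectors. A component along
  \<open>h\<close> is absent since the tidal vector is orthogonal to \<open>k\<close> by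
  \<open>tidal_k\<close>.\<close>

lemma tidal_decomp:
  assumes u: "parallel_on 0 L u"
  shows "tidal u t c = K u e1 t *\<^sub>R e1 t c + K u e2 t *\<^sub>R e2 t c + \<kappa> u t *\<^sub>R k t c"
proof (rule g_cancel[OF x_in])
  fix w
  obtain y :: "real^4" where w: "w = y $ 1 *\<^sub>R e1 t c + y $ 2 *\<^sub>R e2 t c + y $ 3 *\<^sub>R k t c + y $ 4 *\<^sub>R h t c"
    by (rule frame_basis)
  let ?g = "metric_form M c (cmap c (\<gamma> t))" and ?R = "tidal u t c"
    and ?S = "K u e1 t *\<^sub>R e1 t c + K u e2 t *\<^sub>R e2 t c + \<kappa> u t *\<^sub>R k t c"
  have "?g ?R (e1 t c) = ?g ?S (e1 t c)" "?g ?R (e2 t c) = ?g ?S (e2 t c)" "?g ?R (k t c) = ?g ?S (k t c)"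
    by (simp_all add: g_simps metric_form_frame K_chart u e1 e2 tidal_k)
  moreover have "?g ?R (h t c) = ?g ?S (h t c)"
    by (simp add: g_simps metric_form_frame \<kappa>_chart u)
  ultimately show "?g ?R w = ?g ?S w" unfolding w g_simps(2) g_simps(8) by simp
qed

text \<open>Pair symmetry of the curvature. Both the conserved Wronskian and the use of a single
  off-diagonal coefficient \<open>K e1 e2\<close> rest on it.\<close>

lemma K_sym:
  assumes u: "parallel_on 0 L u" and v: "parallel_on 0 L v" shows "K u v t = K v u t"
proof -
  let ?g = "metric_form M c (cmap c (\<gamma> t))" and ?R = "Rm (cmap c (\<gamma> t))"
  have "?g (?R (u t c) (k t c) (k t c)) (v t c) = ?g (?R (k t c) (v t c) (u t c)) (k t c)"
    by (rule Rm_pair[OF x_in])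
  also have "\<dots> = - ?g (?R (v t c) (k t c) (u t c)) (k t c)"
    by (subst Rm_anti12) (simp add: g_simps)
  also have "\<dots> = ?g (?R (v t c) (k t c) (k t c)) (u t c)"
    using Rm_anti34[OF x_in, of "v t c" "k t c" "u t c" "k t c"]
      g_sym[OF x_in, of "u t c" "?R (v t c) (k t c) (k t c)"] by linarith
  finally show ?thesis using K_chart u v by (simp add: tidal_eq_Rm)
qed

lemma tidal_zero: "tidal k t c = 0"
  unfolding tidal_eq_Rm Rm_def by simp

end

text \<open>The Ricci term is the trace of \<open>u\<close> \<mapsto> R(u,k)k, here evaluated in the
  frame. The diagonal entries for \<open>k\<close> and \<open>h\<close> vanish: R(k,k)k = 0, and
  every value of the map is orthogonal to \<open>k\<close>.\<close>

lemma ricci_eq_trace: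
  assumes t: "t \<in> {0..L}" shows "ricci M (\<gamma> t) (k t) (k t) = K e1 e1 t + K e2 e2 t"
proof -
  let ?c = "chart_at M (\<gamma> t)"
  note c = chart_at[of "\<gamma> t"]
  let ?x = "cmap ?c (\<gamma> t)"
  let ?T = "\<lambda>u. curv M ?c ?x u (k t ?c) (k t ?c)"
  define A where "A = matrix ?T"
  have A: "A *v u = ?T u" for u
    unfolding A_def by (rule fun_cong[OF matrix_vector_mul(2)[OF linear_curv]])
  have "ricci M (\<gamma> t) (k t) (k t) = trace A"
  proof -
    have "A $ i $ i = (\<Sum>j\<in>UNIV. \<Sum>l\<in>UNIV. riemann M ?c ?x i j i l * k t ?c $ j * k t ?c $ l)" for i
    proof -
      have "A $ i $ i = (\<Sum>j\<in>UNIV. \<Sum>m\<in>UNIV. \<Sum>l\<in>UNIV. riemann M ?c ?x i j m l * k t ?c $ j * (axis i 1 :: real^4) $ m * k t ?c $ l)"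
        by (simp add: A_def matrix_def curv_def)
      also have "\<dots> = (\<Sum>j\<in>UNIV. \<Sum>m\<in>UNIV. if m = i then \<Sum>l\<in>UNIV. riemann M ?c ?x i j m l * k t ?c $ j * k t ?c $ l else 0)"
        by (intro sum.cong refl) (simp add: axis_def)
      finally show ?thesis by simp
    qed
    then have "trace A = (\<Sum>i\<in>UNIV. \<Sum>j\<in>UNIV. \<Sum>l\<in>UNIV. riemann M ?c ?x i j i l * k t ?c $ j * k t ?c $ l)"
      by (simp add: trace_def)
    also have "\<dots> = (\<Sum>j\<in>UNIV. \<Sum>l\<in>UNIV. \<Sum>i\<in>UNIV. riemann M ?c ?x i j i l * k t ?c $ j * k t ?c $ l)"
      by (rule sum_swap3)
    finally show ?thesis by (simp add: ricci_def Let_def sum_distrib_right)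
  qed
  \<comment> \<open>Of the column belonging to \<open>h\<close> only the diagonal entry
    \<open>y $ 4\<close> enters the trace.\<close>
  obtain y :: "real^4" where y: "tidal h t ?c = y $ 1 *\<^sub>R e1 t ?c + y $ 2 *\<^sub>R e2 t ?c + y $ 3 *\<^sub>R k t ?c + y $ 4 *\<^sub>R h t ?c"
    by (rule frame_basis[OF t c])
  have y4: "y $ 4 = 0"
  proof -
    interpret coord_metric "cimg ?c" "metric_form M ?c" "Gam M ?c"
      by (rule coord_metric) (use c in \<open>simp add: charts_at_iff\<close>)
    show ?thesis using tidal_k[OF t c, of h] unfolding y by (simp add: g_simps metric_form_frame[OF t c])
  qed
  let ?F = "\<lambda>z :: real^4. z $ 1 *\<^sub>R e1 t ?c + z $ 2 *\<^sub>R e2 t ?c + z $ 3 *\<^sub>R k t ?c + z $ 4 *\<^sub>R h t ?c"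
  define E where "E = matrix ?F"
  have lF: "linear ?F" by (auto intro!: linearI simp: algebra_simps)
  have E: "E *v z = ?F z" for z unfolding E_def using fun_cong[OF matrix_vector_mul(2)[OF lF], of z] by simp
  have "\<exists>z. E *v z = w" for w unfolding E using frame_basis[OF t c, of w] by metis
  then have "surj ((*v) E)" by (metis surjI surj_def)
  then obtain E' where E': "E ** E' = mat 1" using matrix_right_invertible_surjective by blast
  \<comment> \<open>\<open>B\<close> is the matrix of the map with respect to the frame, and the
    columns of \<open>E\<close> are the frame vectors, so A E = E B.\<close>
  define B :: "real^4^4" where "B = (\<chi> i j. 
     if j = 1 then (if i = 1 then K e1 e1 t else if i = 2 then K e1 e2 t else if i = 3 then \<kappa> e1 t else 0)
     else if j = 2 then (if i = 1 then K e2 e1 t else if i = 2 then K e2 e2 t else if i = 3 then \<kappa> e2 t else 0)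
     else if j = 3 then 0 else y $ i)"
  have "A *v (E *v z) = E *v (B *v z)" for z
  proof -
    have T: "?T (e1 t ?c) = tidal e1 t ?c" "?T (e2 t ?c) = tidal e2 t ?c" "?T (k t ?c) = tidal k t ?c" "?T (h t ?c) = tidal h t ?c"
      by (simp_all add: tidal_def)
    have "A *v (E *v z) = z $ 1 *\<^sub>R tidal e1 t ?c + z $ 2 *\<^sub>R tidal e2 t ?c + z $ 3 *\<^sub>R tidal k t ?c + z $ 4 *\<^sub>R tidal h t ?c"
      unfolding A E by (simp add: linear_add[OF linear_curv] linear_cmul[OF linear_curv] T)
    also have "\<dots> = ?F (B *v z)"
      unfolding tidal_decomp[OF t c e1] tidal_decomp[OF t c e2] tidal_zero[OF t c] y
      by (simp add: matrix_vector_mult_def B_def sum_4 algebra_simps)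
    finally show ?thesis unfolding E .
  qed
  then have "A ** E = E ** B" by (metis matrix_eq matrix_vector_mul_assoc)
  then have "trace A = trace (E ** (B ** E'))"
    by (metis E' matrix_mul_assoc matrix_mul_rid)
  also have "\<dots> = trace (B ** (E' ** E))" by (metis trace_mul_sym matrix_mul_assoc)
  also have "E' ** E = mat 1" using E' matrix_left_right_inverse by blast
  also have "trace (B ** mat 1) = K e1 e1 t + K e2 e2 t"
    by (simp add: trace_def sum_4 B_def y4)
  finally show ?thesis using \<open>ricci M (\<gamma> t) (k t) (k t) = trace A\<close> by simp
qed

section \<open>Covariant derivatives of combinations of the parallel frame\<close>

definition comb :: "(real \<Rightarrow> real) \<Rightarrow> (real \<Rightarrow> real) \<Rightarrow> (real \<Rightarrow> real) \<Rightarrow> real \<Rightarrow> 'a tvec" where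
  "comb f1 f2 b t = (\<lambda>c. f1 t *\<^sub>R e1 t c + f2 t *\<^sub>R e2 t c + b t *\<^sub>R k t c)"

lemma tangent_comb: "t \<in> {0..L} \<Longrightarrow> tangent M (\<gamma> t) (comb f1 f2 b t)"
  unfolding comb_def
  using parallel_onD(1)[OF e1] parallel_onD(1)[OF e2] parallel_onD(1)[OF parallel_k]
  by (intro tangent_add tangent_scale) auto

context
  fixes f1 f2 b f1' f2' b' :: "real \<Rightarrow> real"
  assumes d1: "\<And>t. t \<in> {0..L} \<Longrightarrow> (f1 has_real_derivative f1' t) (at t within {0..L})"
    and d2: "\<And>t. t \<in> {0..L} \<Longrightarrow> (f2 has_real_derivative f2' t) (at t within {0..L})"
    and db: "\<And>t. t \<in> {0..L} \<Longrightarrow> (b has_real_derivative b' t) (at t within {0..L})"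
begin

lemma comb_deriv:
  assumes t: "t \<in> {0..L}" and c: "c \<in> charts_at M (\<gamma> t)"
  shows "((\<lambda>s. comb f1 f2 b s c) has_vector_derivative
    comb f1' f2' b' t c - Gam M c (cmap c (\<gamma> t)) (k t c) (comb f1 f2 b t c)) (at t within {0..L})"
proof -
  have lin: "linear (Gam M c (cmap c (\<gamma> t)) (k t c))" using bilinear_Gam[of M c "cmap c (\<gamma> t)"] by (simp add: bilinear_def)
  have "((\<lambda>s. f1 s *\<^sub>R e1 s c + f2 s *\<^sub>R e2 s c + b s *\<^sub>R k s c) has_vector_derivative
    f1 t *\<^sub>R - Gam M c (cmap c (\<gamma> t)) (k t c) (e1 t c) + f1' t *\<^sub>R e1 t c
    + (f2 t *\<^sub>R - Gam M c (cmap c (\<gamma> t)) (k t c) (e2 t c) + f2' t *\<^sub>R e2 t c)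
    + (b t *\<^sub>R - Gam M c (cmap c (\<gamma> t)) (k t c) (k t c) + b' t *\<^sub>R k t c)) (at t within {0..L})"
    by (intro has_vector_derivative_add has_vector_derivative_scaleR d1 d2 db t
      parallel_onD(2)[OF e1 t c] parallel_onD(2)[OF e2 t c] parallel_onD(2)[OF parallel_k t c])
  then show ?thesis
    unfolding comb_def by (simp add: linear_add[OF lin] linear_cmul[OF lin] algebra_simps)
qed

lemma cov_deriv_comb:
  assumes t: "t \<in> {0..L}" and c: "c \<in> charts_at M (\<gamma> t)"
  shows "cov_deriv M {0..L} \<gamma> (comb f1 f2 b) t c = comb f1' f2' b' t c"
  unfolding cov_deriv_def using vector_derivative_within_closed_interval[OF L t comb_deriv[OF t c]] by simp

lemma differentiable_field_comb: "differentiable_field M {0..L} \<gamma> (comb f1 f2 b)"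
  unfolding differentiable_field_def using tangent_comb comb_deriv differentiableI_vector by blast

end

text \<open>Covariant derivatives act on coefficients only, since the frame is parallel, and
  \<open>tidal_decomp\<close> turns the curvature term into the coefficient matrix.\<close>

lemma jacobi_field_comb:
  assumes d: "\<And>t. t \<in> {0..L} \<Longrightarrow> (f1 has_real_derivative f1' t) (at t within {0..L})"
      "\<And>t. t \<in> {0..L} \<Longrightarrow> (f2 has_real_derivative f2' t) (at t within {0..L})"
      "\<And>t. t \<in> {0..L} \<Longrightarrow> (b has_real_derivative b' t) (at t within {0..L})"
    and d': "\<And>t. t \<in> {0..L} \<Longrightarrow> (f1' has_real_derivative - (K e1 e1 t * f1 t + K e1 e2 t * f2 t)) (at t within {0..L})"
      "\<And>t. t \<in> {0..L} \<Longrightarrow> (f2' has_real_derivative - (K e1 e2 t * f1 t + K e2 e2 t * f2 t)) (at t within {0..L})"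
      "\<And>t. t \<in> {0..L} \<Longrightarrow> (b' has_real_derivative - (\<kappa> e1 t * f1 t + \<kappa> e2 t * f2 t)) (at t within {0..L})"
  shows "jacobi_field M {0..L} \<gamma> (comb f1 f2 b)"
proof -
  let ?V = "comb f1 f2 b" and ?V' = "comb f1' f2' b'"
  let ?V'' = "comb (\<lambda>t. - (K e1 e1 t * f1 t + K e1 e2 t * f2 t)) (\<lambda>t. - (K e1 e2 t * f1 t + K e2 e2 t * f2 t)) (\<lambda>t. - (\<kappa> e1 t * f1 t + \<kappa> e2 t * f2 t))"
  let ?D = "cov_deriv M {0..L} \<gamma> ?V"
  have cov: "?D t c = ?V' t c" if "t \<in> {0..L}" "c \<in> charts_at M (\<gamma> t)" for t c
    by (rule cov_deriv_comb[OF d that])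
  have der: "((\<lambda>s. ?D s c) has_vector_derivative ?V'' t c - Gam M c (cmap c (\<gamma> t)) (k t c) (?V' t c)) (at t within {0..L})"
    if t: "t \<in> {0..L}" and c: "c \<in> charts_at M (\<gamma> t)" for t c
  proof -
    \<comment> \<open>\<open>cov_deriv\<close> is identified with a combination of the frame only in
      charts around the base point, so it is differentiated again within such a
      neighbourhood.\<close>
    obtain N where N: "open N" "t \<in> N" "\<And>s. s \<in> {0..L} \<inter> N \<Longrightarrow> c \<in> charts_at M (\<gamma> s)"
      using chart_nbhd[OF t c] by metis
    have "((\<lambda>s. ?V' s c) has_vector_derivative ?V'' t c - Gam M c (cmap c (\<gamma> t)) (k t c) (?V' t c)) (at t within {0..L} \<inter> N)"
      unfolding at_within_Int_open[OF N(1,2)] by (rule comb_deriv[OF d' t c])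
    then show ?thesis unfolding at_within_Int_open[where S = "{0..L}", OF N(1,2), symmetric]
      by (rule has_vector_derivative_transform[rotated 2]) (use t N cov in auto)
  qed
  show ?thesis
    unfolding jacobi_field_def
  proof (intro conjI ballI)
    show "differentiable_field M {0..L} \<gamma> ?V" by (rule differentiable_field_comb[OF d])
    show "differentiable_field M {0..L} \<gamma> ?D"
      unfolding differentiable_field_def
    proof (intro ballI conjI)
      fix t assume t: "t \<in> {0..L}"
      show "tangent M (\<gamma> t) (?D t)"
        by (rule tangent_cong[OF _ tangent_comb[OF t, of f1' f2' b']]) (use cov[OF t] in \<open>simp add: vec_eq_def\<close>)
      show "(\<lambda>s. ?D s c) differentiable at t within {0..L}" if "c \<in> charts_at M (\<gamma> t)" for c
        using der[OF t that] differentiableI_vector by blast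
    qed
    fix t c assume t: "t \<in> {0..L}" and c: "c \<in> charts_at M (\<gamma> t)"
    have "cov_deriv M {0..L} \<gamma> ?D t c = vector_derivative (\<lambda>s. ?D s c) (at t within {0..L})
      + Gam M c (cmap c (\<gamma> t)) (k t c) (?D t c)"
      by (rule fun_cong[OF cov_deriv_def])
    then have "cov_deriv M {0..L} \<gamma> ?D t c = ?V'' t c"
      using vector_derivative_within_closed_interval[OF L t der[OF t c]] cov[OF t c] by simp
    moreover have "curv M c (cmap c (\<gamma> t)) (?V t c) (k t c) (k t c) = - ?V'' t c"
    proof -
      have "curv M c (cmap c (\<gamma> t)) (?V t c) (k t c) (k t c) =
        f1 t *\<^sub>R tidal e1 t c + f2 t *\<^sub>R tidal e2 t c + b t *\<^sub>R tidal k t c"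
        unfolding comb_def tidal_def
        by (simp add: linear_add[OF linear_curv] linear_cmul[OF linear_curv])
      also have "\<dots> = - ?V'' t c"
        unfolding tidal_decomp[OF t c e1] tidal_decomp[OF t c e2] tidal_zero[OF t c] K_sym[OF t c e2 e1] comb_def
        by (simp add: algebra_simps)
      finally show ?thesis .
    qed
    ultimately show "cov_deriv M {0..L} \<gamma> ?D t c + curv M c (cmap c (\<gamma> t)) (?V t c) (k t c) (k t c) = 0" by simp
  qed
qed

end

section \<open>The spacelike surface\<close>

context spacetime
begin

lemma ip_cong: "vec_eq M p v v' \<Longrightarrow> vec_eq M p w w' \<Longrightarrow> ip M p v w = ip M p v' w'"
  using chart_at[of p] by (simp add: vec_eq_def ip_def Let_def)

lemma ip_sym: "ip M p v w = ip M p w v"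
  unfolding ip_def Let_def by (rule metric_form_sym[OF chart_at_atlas(1)]) (use chart_at_atlas(2) in blast)

lemmas metric_form_simps = bilinear_ladd[OF bilinear_metric_form] bilinear_radd[OF bilinear_metric_form]
  bilinear_lmul[OF bilinear_metric_form] bilinear_rmul[OF bilinear_metric_form]

lemma ip_add: "ip M p (\<lambda>c. v c + w c) z = ip M p v z + ip M p w z"
  and ip_scale: "ip M p (\<lambda>c. r *\<^sub>R v c) z = r * ip M p v z"
  by (simp_all add: ip_def Let_def metric_form_simps)

end

locale surface_point = spacetime M for M :: "'a::{t2_space,second_countable_topology} spacetime" +
  fixes P :: "'a set" and p :: 'a
  assumes P: "spacelike_submanifold M P" and p: "p \<in> P"
begin

definition X where "X = fst (param_at M P p)"
definition u where "u = snd (param_at M P p)"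

lemma param_at: "param_at M P p = (X, u)"
  by (simp add: X_def u_def)

lemma param: obtains W where "local_param M P W X" "u \<in> W" "X u = p"
proof -
  obtain W Y where "local_param M P W Y" "p \<in> Y ` W"
    using P p by (auto simp: spacelike_submanifold_def codim2_submanifold_def)
  then have "\<exists>z. case z of (Y, v) \<Rightarrow> \<exists>W. local_param M P W Y \<and> v \<in> W \<and> Y v = p" by auto
  then have "case param_at M P p of (Y, v) \<Rightarrow> \<exists>W. local_param M P W Y \<and> v \<in> W \<and> Y v = p"
    unfolding param_at_def by (rule someI_ex)
  then show thesis using that unfolding param_at by auto
qed

lemma param_smooth:
  assumes "c \<in> charts_at M p" "d \<in> charts_at M p"
  obtains W where "open W" "u \<in> W" "smooth_on W (cmap c \<circ> X)" "\<And>w. w \<in> W \<Longrightarrow> X w \<in> cdom c" "\<And>w. w \<in> W \<Longrightarrow> X w \<in> cdom d"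
proof -
  have a: "c \<in> atlas M" "d \<in> atlas M" "p \<in> cdom c" "p \<in> cdom d" using assms by (auto simp: charts_at_iff)
  obtain W where W: "local_param M P W X" "u \<in> W" "X u = p" using param .
  then obtain \<psi> where "open W" "homeomorphism W (X ` W) X \<psi>" by (auto simp: local_param_def)
  then have "open (W \<inter> X -` (cdom c \<inter> cdom d))"
    by (intro continuous_open_preimage homeomorphism_cont1 open_Int open_cdom a)
  moreover have "smooth_on (W \<inter> X -` (cdom c \<inter> cdom d)) (cmap c \<circ> X)"
    by (rule smooth_on_subset[of "W \<inter> X -` cdom c"]) (use W a in \<open>auto simp: local_param_def\<close>)
  ultimately show thesis using that[of "W \<inter> X -` (cdom c \<inter> cdom d)"] W a by auto
qed

lemma X_u: "X u = p"
  using param by metis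

abbreviation T where "T \<equiv> surf_tan M P p"

lemma surf_tan_eq: "T a c = dirder a (cmap c \<circ> X) u"
  by (simp add: surf_tan_def param_at)

lemma surf_tan_linear:
  assumes c: "c \<in> charts_at M p" shows "linear (\<lambda>a. T a c)"
proof -
  obtain W where "u \<in> W" "smooth_on W (cmap c \<circ> X)" using param_smooth[OF c c] by metis
  then show ?thesis unfolding surf_tan_eq using smooth_on_linear by blast
qed

lemma tangent_surf_tan: "tangent M p (T a)"
  unfolding tangent_def
proof (intro ballI)
  fix c d assume cd: "c \<in> charts_at M p" "d \<in> charts_at M p"
  have a: "c \<in> atlas M" "d \<in> atlas M" "p \<in> cdom c" "p \<in> cdom d" using cd by (auto simp: charts_at_iff)
  obtain W where W: "open W" "u \<in> W" "smooth_on W (cmap c \<circ> X)" "\<And>w. w \<in> W \<Longrightarrow> X w \<in> cdom c" "\<And>w. w \<in> W \<Longrightarrow> X w \<in> cdom d"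
    using param_smooth[OF cd] by metis
  have 1: "(cmap c \<circ> X has_derivative frechet_derivative (cmap c \<circ> X) (at u)) (at u)"
    by (rule smooth_on_has_derivative[OF W(3,2)])
  have 2: "(transition c d has_derivative frechet_derivative (transition c d) (at (cmap c p))) (at ((cmap c \<circ> X) u))"
    unfolding o_def X_u by (rule smooth_on_has_derivative[OF smooth_transition]) (use a in auto)
  have "frechet_derivative (cmap d \<circ> X) (at u) = frechet_derivative (\<lambda>w. transition c d ((cmap c \<circ> X) w)) (at u)"
    by (rule frechet_derivative_cong_open[OF W(1,2)]) (use a W in \<open>auto simp: transition_cmap\<close>)
  also have "\<dots> = (\<lambda>h. dirder (dirder h (cmap c \<circ> X) u) (transition c d) (cmap c p))"
    using frechet_derivative_at[OF has_derivative_compose[OF 1 2]] by simp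
  finally show "T a d = dirder (T a c) (transition c d) (cmap c p)" by (simp add: surf_tan_eq)
qed

text \<open>The first fundamental form of \<open>P\<close> at \<open>p\<close> in parameter
  components; it is negative definite in this signature.\<close>

definition q :: "real^2 \<Rightarrow> real^2 \<Rightarrow> real" where "q a b = ip M p (T a) (T b)"

lemma q_bilinear: "bilinear q"
  unfolding q_def[abs_def] ip_def Let_def bilinear_def
  using linear_add[OF surf_tan_linear[OF chart_at]] linear_cmul[OF surf_tan_linear[OF chart_at]]
  by (auto intro!: linearI simp: metric_form_simps)

lemmas q_simps = bilinear_ladd[OF q_bilinear] bilinear_radd[OF q_bilinear]
  bilinear_lmul[OF q_bilinear] bilinear_rmul[OF q_bilinear]

lemma q_sym: "q a b = q b a"
  unfolding q_def by (rule ip_sym)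

lemma q_neg: "a \<noteq> 0 \<Longrightarrow> q a a < 0"
  using P p unfolding spacelike_submanifold_def q_def by blast

definition \<alpha> where "\<alpha> = fst (surf_frame M P p)"
definition \<beta> where "\<beta> = snd (surf_frame M P p)"

lemma surf_frame_eq: "surf_frame M P p = (\<alpha>, \<beta>)"
  by (simp add: \<alpha>_def \<beta>_def)

text \<open>\<open>surf_frame\<close> is a choice, so a frame must be shown to exist: Gram-Schmidt
  for the negative definite form \<open>q\<close>.\<close>

lemma frame_normalized: "q \<alpha> \<alpha> = -1" "q \<beta> \<beta> = -1" "q \<alpha> \<beta> = 0"
proof -
  have normal: "\<exists>s. q (s *\<^sub>R a) (s *\<^sub>R a) = -1" if "a \<noteq> 0" for a
    using q_neg[OF that] by (intro exI[of _ "1 / sqrt (- q a a)"]) (simp add: q_simps field_simps)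
  obtain s where s: "q (s *\<^sub>R axis 1 1) (s *\<^sub>R axis 1 1) = -1" using normal[of "axis 1 1"] by auto
  define a where "a = s *\<^sub>R (axis 1 1 :: real^2)"
  \<comment> \<open>The projection is added instead of subtracted because
    \<open>q a a = -1\<close>.\<close>
  define b where "b = axis 2 1 + q (axis 2 1) a *\<^sub>R a"
  have "b $ 2 = 1" by (simp add: b_def a_def axis_def)
  then have "b \<noteq> 0" by auto
  then obtain r where r: "q (r *\<^sub>R b) (r *\<^sub>R b) = -1" using normal by blast
  have "q a b = q a (axis 2 1) + q (axis 2 1) a * q a a" by (simp add: b_def q_simps)
  then have "q a b = 0" using s q_sym[of a "axis 2 1"] by (simp add: a_def[symmetric])
  then have "q a (r *\<^sub>R b) = 0" by (simp add: q_simps)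
  with s r have "\<exists>z. case z of (a, b) \<Rightarrow> q a a = -1 \<and> q b b = -1 \<and> q a b = 0"
    unfolding a_def[symmetric] by auto
  then have "case surf_frame M P p of (a, b) \<Rightarrow> q a a = -1 \<and> q b b = -1 \<and> q a b = 0"
    unfolding surf_frame_def q_def by (rule someI_ex)
  then show "q \<alpha> \<alpha> = -1" "q \<beta> \<beta> = -1" "q \<alpha> \<beta> = 0" unfolding surf_frame_eq by auto
qed

lemma frame_span: obtains y z where "b = y *\<^sub>R \<alpha> + z *\<^sub>R \<beta>"
proof -
  let ?F = "\<lambda>y :: real^2. y $ 1 *\<^sub>R \<alpha> + y $ 2 *\<^sub>R \<beta>"
  have L: "linear ?F" by (auto intro!: linearI simp: algebra_simps)
  have "inj ?F"
    unfolding linear_injective_0[OF L]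
  proof safe
    fix y assume y: "?F y = 0"
    have "q (?F y) \<alpha> = 0" "q (?F y) \<beta> = 0" unfolding y by (simp_all add: bilinear_lzero[OF q_bilinear])
    then have "y $ 1 = 0" "y $ 2 = 0"
      by (simp_all add: q_simps frame_normalized q_sym[of \<beta> \<alpha>])
    then show "y = 0" by (simp add: vec_eq_iff forall_2)
  qed
  then have "surj ?F" by (rule linear_inj_imp_surj[OF L])
  then obtain y where "b = ?F y" by (rule surjE)
  then show thesis by (rule that)
qed

text \<open>Symmetry combines commuting second derivatives of the parametrization with torsion
  freeness; linearity in one argument then carries over to the other.\<close>

lemma surf_cov_bilinear:
  assumes c: "c \<in> charts_at M p" shows "bilinear (\<lambda>a b. surf_cov M P p a b c)"
    and "surf_cov M P p a b c = surf_cov M P p b a c"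
proof -
  obtain W where W: "open W" "u \<in> W" "smooth_on W (cmap c \<circ> X)" using param_smooth[OF c c] by metis
  have ca: "c \<in> atlas M" "cmap c p \<in> cimg c" using c by (auto simp: charts_at_iff)
  interpret coord_metric "cimg c" "metric_form M c" "Gam M c" by (rule coord_metric[OF ca(1)])
  have eq: "surf_cov M P p a b c = dirder a (dirder b (cmap c \<circ> X)) u + Gam M c (cmap c p) (T a c) (T b c)" for a b
    by (simp add: surf_cov_def param_at)
  have sym: "surf_cov M P p a b c = surf_cov M P p b a c" for a b
    unfolding eq using dirder_commute[OF W(1,3,2)] G_sym[OF ca(2)] by metis
  then show "surf_cov M P p a b c = surf_cov M P p b a c" .
  have l: "linear (\<lambda>a. surf_cov M P p a b c)" for b
    unfolding eq
    using linear_add[OF smooth_on_linear[OF smooth_on_dirder[OF W(3), of b] W(2)]]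
      linear_cmul[OF smooth_on_linear[OF smooth_on_dirder[OF W(3), of b] W(2)]]
      linear_add[OF surf_tan_linear[OF c]] linear_cmul[OF surf_tan_linear[OF c]]
    by (auto intro!: linearI simp: G_simps algebra_simps)
  moreover have "(\<lambda>b. surf_cov M P p a b c) = (\<lambda>b. surf_cov M P p b a c)" for a using sym by blast
  ultimately show "bilinear (\<lambda>a b. surf_cov M P p a b c)" unfolding bilinear_def by simp
qed

context
  fixes k0 :: "'a tvec" assumes normal: "normal_to M P p k0"
begin

text \<open>The second fundamental form paired with the normal \<open>k0\<close>. The tangential
  correction in \<open>second_ff\<close> is orthogonal to \<open>k0\<close>, so
  \<open>surf_cov\<close> may be used directly.\<close>

definition II where "II a b = ip M p (surf_cov M P p a b) k0"

lemma II_bilinear: "bilinear II"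
proof -
  note S = surf_cov_bilinear(1)[OF chart_at]
  show ?thesis
    unfolding II_def[abs_def] ip_def Let_def bilinear_def
    by (auto intro!: linearI simp: metric_form_simps bilinear_ladd[OF S] bilinear_radd[OF S]
      bilinear_lmul[OF S] bilinear_rmul[OF S])
qed

lemma II_sym: "II a b = II b a"
  unfolding II_def ip_def Let_def using surf_cov_bilinear(2)[OF chart_at] by metis

lemma ip_T_normal: "ip M p (T a) k0 = 0"
  using normal ip_sym unfolding normal_to_def by metis

lemma ip_second_ff: "ip M p (second_ff M P p a b) k0 = II a b"
  unfolding second_ff_def normal_part_def surf_frame_eq Let_def prod.case
  by (simp only: ip_add ip_scale ip_T_normal II_def mult_zero_right add_0_right)

lemma ip_mean_curvature: "ip M p (mean_curvature M P p) k0 = (II \<alpha> \<alpha> + II \<beta> \<beta>) / 2"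
  unfolding mean_curvature_def surf_frame_eq Let_def prod.case
  by (simp add: ip_scale ip_add ip_second_ff)

end

end

context null_frame
begin

text \<open>The second-order system as a first-order linear one for the pair of coefficient triple
  and derivative triple.\<close>

lemma frame_ode:
  obtains f1 f2 b f1' f2' b' where "f1 0 = x" "f2 0 = y" "b 0 = 0" "f1' 0 = x'" "f2' 0 = y'" "b' 0 = 0"
    "\<And>t. t \<in> {0..L} \<Longrightarrow> (f1 has_real_derivative f1' t) (at t within {0..L})"
    "\<And>t. t \<in> {0..L} \<Longrightarrow> (f2 has_real_derivative f2' t) (at t within {0..L})"
    "\<And>t. t \<in> {0..L} \<Longrightarrow> (b has_real_derivative b' t) (at t within {0..L})"
    "\<And>t. t \<in> {0..L} \<Longrightarrow> (f1' has_real_derivative - (K e1 e1 t * f1 t + K e1 e2 t * f2 t)) (at t within {0..L})"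
    "\<And>t. t \<in> {0..L} \<Longrightarrow> (f2' has_real_derivative - (K e1 e2 t * f1 t + K e2 e2 t * f2 t)) (at t within {0..L})"
    "\<And>t. t \<in> {0..L} \<Longrightarrow> (b' has_real_derivative - (\<kappa> e1 t * f1 t + \<kappa> e2 t * f2 t)) (at t within {0..L})"
proof -
  define A :: "real \<Rightarrow> (real \<times> real \<times> real) \<times> (real \<times> real \<times> real) \<Rightarrow> (real \<times> real \<times> real) \<times> (real \<times> real \<times> real)"
    where "A t v = (snd v, - (K e1 e1 t * fst (fst v) + K e1 e2 t * fst (snd (fst v))),
     - (K e1 e2 t * fst (fst v) + K e2 e2 t * fst (snd (fst v))),
     - (\<kappa> e1 t * fst (fst v) + \<kappa> e2 t * fst (snd (fst v))))" for t v
  have "linear (A t)" for t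
    by (rule linearI) (auto simp: A_def algebra_simps)
  moreover have "continuous_on {0..L} (\<lambda>t. A t v)" for v
    unfolding A_def by (intro continuous_intros continuous_on_K continuous_on_\<kappa> e1 e2)
  ultimately obtain z where z: "z 0 = ((x, y, 0), (x', y', 0))"
    "\<And>t. t \<in> {0..L} \<Longrightarrow> (z has_vector_derivative A t (z t)) (at t within {0..L})"
    using linear_ode_exists[of 0 L A] L by (metis less_imp_le)
  note F = bounded_linear.has_vector_derivative[OF bounded_linear_fst]
    and S = bounded_linear.has_vector_derivative[OF bounded_linear_snd]
  show thesis
    by (rule that[of "\<lambda>t. fst (fst (z t))" "\<lambda>t. fst (snd (fst (z t)))" "\<lambda>t. snd (snd (fst (z t)))"
          "\<lambda>t. fst (snd (z t))" "\<lambda>t. fst (snd (snd (z t)))" "\<lambda>t. snd (snd (snd (z t)))"])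
      (use z(1) F[OF F[OF z(2)]] F[OF S[OF F[OF z(2)]]] S[OF S[OF F[OF z(2)]]]
         F[OF S[OF z(2)]] F[OF S[OF S[OF z(2)]]] S[OF S[OF S[OF z(2)]]]
       in \<open>simp_all add: has_real_derivative_iff_has_vector_derivative A_def\<close>)
qed

end

section \<open>Focal points\<close>

lemma singular_matrix_kernel:
  fixes a b c d :: real
  assumes "a * d = b * c"
  obtains x y where "x \<noteq> 0 \<or> y \<noteq> 0" "x * a + y * b = 0" "x * c + y * d = 0"
proof (cases "a = 0 \<and> b = 0")
  case True
  show thesis
  proof (cases "c = 0 \<and> d = 0")
    case True
    with \<open>a = 0 \<and> b = 0\<close> show thesis by (intro that[of 1 0]) auto
  next
    case False
    with \<open>a = 0 \<and> b = 0\<close> show thesis by (intro that[of d "- c"]) auto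
  qed
next
  case False
  then show thesis by (intro that[of b "- a"]) (use assms in auto)
qed

text \<open>The columns of the matrix solution start at \<open>e1\<close> and \<open>e2\<close> with
  the second fundamental form as initial derivative. A kernel vector of the matrix at a zero of its
  determinant selects a combination that vanishes there up to its component along
  \<open>k\<close>.\<close>

lemma (in null_frame) focal_point_exists:
  fixes P :: "'a set" and \<theta> \<rho>0 l Q :: real and \<rho> :: "real \<Rightarrow> real"
  assumes P: "spacelike_submanifold M P" "\<gamma> 0 \<in> P" and normal: "normal_to M P (\<gamma> 0) (k 0)"
    and e1_0: "vec_eq M (\<gamma> 0) (e1 0) (surf_tan M P (\<gamma> 0) (fst (surf_frame M P (\<gamma> 0))))"
    and e2_0: "vec_eq M (\<gamma> 0) (e2 0) (surf_tan M P (\<gamma> 0) (snd (surf_frame M P (\<gamma> 0))))"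
    and \<theta>: "\<theta> = 2 * ip M (\<gamma> 0) (mean_curvature M P (\<gamma> 0)) (k 0)" "\<theta> < 0"
    and \<rho>: "\<rho> = (\<lambda>t. ricci M (\<gamma> t) (k t) (k t))"
    and smeared: "\<And>g g' :: real \<Rightarrow> real.
           (\<And>t. (g has_real_derivative g' t) (at t)) \<Longrightarrow> continuous_on UNIV g' \<Longrightarrow>
           compact (closure {t. g t \<noteq> 0}) \<Longrightarrow> closure {t. g t \<noteq> 0} \<subseteq> {0<..<L} \<Longrightarrow>
           integral {0..L} (\<lambda>t. (g t)\<^sup>2 * \<rho> t) \<ge> - Q * integral {0..L} (\<lambda>t. (g' t)\<^sup>2)"
    and l: "0 < l" "l < L"
    and \<rho>0: "\<And>t. t \<in> {0..l} \<Longrightarrow> \<rho> t \<ge> \<rho>0"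
    and contraction: "- \<theta> \<ge> - (2/3) * \<rho>0 * l + Q / l + (2 + Q) / (L - l)"
  shows "\<exists>r. 0 < r \<and> r < L \<and> focal_point M P L \<gamma> r"
proof -
  interpret S: surface_point M P "\<gamma> 0" by unfold_locales (rule P)+
  have e0: "vec_eq M (\<gamma> 0) (e1 0) (S.T S.\<alpha>)" "vec_eq M (\<gamma> 0) (e2 0) (S.T S.\<beta>)"
    using e1_0 e2_0 by (simp_all add: S.\<alpha>_def S.\<beta>_def)
  define II where "II = S.II (k 0)"
  note II_bil = S.II_bilinear[OF normal, folded II_def] and II_sym = S.II_sym[OF normal, folded II_def]
  \<comment> \<open>The condition on a P-Jacobi field reads g(V'(0),w) = - g(II(V(0),w),k); since
    g(e1,e1) = -1, the coefficients of V'(0) are \<open>+ II\<close>.\<close>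
  obtain a c z a' c' z' where 1: "a 0 = 1" "c 0 = 0" "z 0 = 0" "a' 0 = II S.\<alpha> S.\<alpha>" "c' 0 = II S.\<alpha> S.\<beta>"
    and d1: "\<And>t. t \<in> {0..L} \<Longrightarrow> (a has_real_derivative a' t) (at t within {0..L})"
      "\<And>t. t \<in> {0..L} \<Longrightarrow> (c has_real_derivative c' t) (at t within {0..L})"
      "\<And>t. t \<in> {0..L} \<Longrightarrow> (z has_real_derivative z' t) (at t within {0..L})"
      "\<And>t. t \<in> {0..L} \<Longrightarrow> (a' has_real_derivative - (K e1 e1 t * a t + K e1 e2 t * c t)) (at t within {0..L})"
      "\<And>t. t \<in> {0..L} \<Longrightarrow> (c' has_real_derivative - (K e1 e2 t * a t + K e2 e2 t * c t)) (at t within {0..L})"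
      "\<And>t. t \<in> {0..L} \<Longrightarrow> (z' has_real_derivative - (\<kappa> e1 t * a t + \<kappa> e2 t * c t)) (at t within {0..L})"
    by (rule frame_ode[of 1 0 "II S.\<alpha> S.\<alpha>" "II S.\<alpha> S.\<beta>"]) blast
  obtain b d w b' d' w' where 2: "b 0 = 0" "d 0 = 1" "w 0 = 0" "b' 0 = II S.\<alpha> S.\<beta>" "d' 0 = II S.\<beta> S.\<beta>"
    and d2: "\<And>t. t \<in> {0..L} \<Longrightarrow> (b has_real_derivative b' t) (at t within {0..L})"
      "\<And>t. t \<in> {0..L} \<Longrightarrow> (d has_real_derivative d' t) (at t within {0..L})"
      "\<And>t. t \<in> {0..L} \<Longrightarrow> (w has_real_derivative w' t) (at t within {0..L})"
      "\<And>t. t \<in> {0..L} \<Longrightarrow> (b' has_real_derivative - (K e1 e1 t * b t + K e1 e2 t * d t)) (at t within {0..L})"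
      "\<And>t. t \<in> {0..L} \<Longrightarrow> (d' has_real_derivative - (K e1 e2 t * b t + K e2 e2 t * d t)) (at t within {0..L})"
      "\<And>t. t \<in> {0..L} \<Longrightarrow> (w' has_real_derivative - (\<kappa> e1 t * b t + \<kappa> e2 t * d t)) (at t within {0..L})"
    by (rule frame_ode[of 0 1 "II S.\<alpha> S.\<beta>" "II S.\<beta> S.\<beta>"]) blast
  have \<rho>K: "\<rho> t = K e1 e1 t + K e2 e2 t" if "t \<in> {0..L}" for t
    using ricci_eq_trace[OF that] by (simp add: \<rho>)
  \<comment> \<open>The trace of the second fundamental form is twice the mean curvature paired with
    \<open>k\<close>, which is the initial expansion.\<close>
  have \<theta>': "a' 0 + d' 0 = \<theta>"
    using S.ip_mean_curvature[OF normal] by (simp add: \<theta>(1) 1 2 II_def)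
  have "\<exists>r. 0 < r \<and> r < L \<and> a r * d r = b r * c r"
  proof (rule jacobi_determinant_zero[where a' = a' and b' = b' and c' = c' and d' = d' and ?K11.0 = "K e1 e1"
        and ?K12.0 = "K e1 e2" and ?K22.0 = "K e2 e2" and l = l and Q = Q and ?\<rho>0.0 = \<rho>0])
    show "continuous_on {0..L} (\<lambda>t. K e1 e1 t + K e2 e2 t)"
      by (intro continuous_on_add continuous_on_K e1 e2)
    show "integral {0..L} (\<lambda>t. (g t)\<^sup>2 * (K e1 e1 t + K e2 e2 t)) \<ge> - Q * integral {0..L} (\<lambda>t. (g' t)\<^sup>2)"
      if "\<And>t. (g has_real_derivative g' t) (at t)" "continuous_on UNIV g'"
       "compact (closure {t. g t \<noteq> 0})" "closure {t. g t \<noteq> 0} \<subseteq> {0<..<L}" for g g' :: "real \<Rightarrow> real"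
    proof -
      have "integral {0..L} (\<lambda>t. (g t)\<^sup>2 * (K e1 e1 t + K e2 e2 t)) = integral {0..L} (\<lambda>t. (g t)\<^sup>2 * \<rho> t)"
        by (intro integral_cong) (simp add: \<rho>K)
      then show ?thesis using smeared[OF that] by simp
    qed
    show "K e1 e1 t + K e2 e2 t \<ge> \<rho>0" if "t \<in> {0..l}" for t
      using \<rho>0[OF that] \<rho>K[of t] that l by simp
    show "b' 0 = c' 0" by (simp add: 1 2)
    show "a' 0 + d' 0 < 0" "- (a' 0 + d' 0) \<ge> - (2/3) * \<rho>0 * l + Q / l + (2 + Q) / (L - l)"
      unfolding \<theta>' by (fact \<theta>(2) contraction)+
  qed (fact 1 2 l | rule d1 d2, assumption)+
  then obtain r where r: "0 < r" "r < L" "a r * d r = b r * c r" by blast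
  obtain x y where xy: "x \<noteq> 0 \<or> y \<noteq> 0" "x * a r + y * b r = 0" "x * c r + y * d r = 0"
    using singular_matrix_kernel[OF r(3)] .
  text \<open>Adding a multiple of the Jacobi field \<open>\<lambda>t. t *\<^sub>R k t\<close> makes the component along \<open>k\<close> vanish at \<open>r\<close>, too.\<close>
  define m where "m = (x * z r + y * w r) / r"
  let ?f1 = "\<lambda>t. x * a t + y * b t" and ?f2 = "\<lambda>t. x * c t + y * d t" and ?f3 = "\<lambda>t. x * z t + y * w t - m * t"
    and ?f1' = "\<lambda>t. x * a' t + y * b' t" and ?f2' = "\<lambda>t. x * c' t + y * d' t" and ?f3' = "\<lambda>t. x * z' t + y * w' t - m"
  let ?V = "comb ?f1 ?f2 ?f3"
  have D: "(?f1 has_real_derivative ?f1' t) (at t within {0..L})"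
    "(?f2 has_real_derivative ?f2' t) (at t within {0..L})"
    "(?f3 has_real_derivative ?f3' t) (at t within {0..L})" if "t \<in> {0..L}" for t
    using d1(1-3)[OF that] d2(1-3)[OF that] by (auto intro!: derivative_eq_intros)
  have jac: "jacobi_field M {0..L} \<gamma> ?V"
  proof (rule jacobi_field_comb[OF D])
    fix t assume t: "t \<in> {0..L}"
    show "(?f1' has_real_derivative - (K e1 e1 t * ?f1 t + K e1 e2 t * ?f2 t)) (at t within {0..L})"
      "(?f2' has_real_derivative - (K e1 e2 t * ?f1 t + K e2 e2 t * ?f2 t)) (at t within {0..L})"
      "(?f3' has_real_derivative - (\<kappa> e1 t * ?f1 t + \<kappa> e2 t * ?f2 t)) (at t within {0..L})"
      using d1(4-6)[OF t] d2(4-6)[OF t] by (auto intro!: derivative_eq_intros simp: algebra_simps)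
  qed
  have L0: "0 \<in> {0..L}" using L by simp
  have V0: "vec_eq M (\<gamma> 0) (?V 0) (S.T (x *\<^sub>R S.\<alpha> + y *\<^sub>R S.\<beta>))"
    unfolding vec_eq_def
  proof
    fix c assume c: "c \<in> charts_at M (\<gamma> 0)"
    show "?V 0 c = S.T (x *\<^sub>R S.\<alpha> + y *\<^sub>R S.\<beta>) c"
      using e0 c linear_add[OF S.surf_tan_linear[OF c]] linear_cmul[OF S.surf_tan_linear[OF c]]
      by (simp add: comb_def 1 2 vec_eq_def)
  qed
  have "P_jacobi_field M P L \<gamma> ?V"
    unfolding P_jacobi_field_def
  proof (intro conjI jac exI[of _ "x *\<^sub>R S.\<alpha> + y *\<^sub>R S.\<beta>"] V0 allI)
    fix b'' :: "real^2"
    obtain y1 y2 where b'': "b'' = y1 *\<^sub>R S.\<alpha> + y2 *\<^sub>R S.\<beta>" by (rule S.frame_span)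
    have "vec_eq M (\<gamma> 0) (cov_deriv M {0..L} \<gamma> ?V 0) (\<lambda>c. (\<lambda>c. ?f1' 0 *\<^sub>R S.T S.\<alpha> c + ?f2' 0 *\<^sub>R S.T S.\<beta> c) c + ?f3' 0 *\<^sub>R k 0 c)"
      unfolding vec_eq_def
    proof
      fix c assume c: "c \<in> charts_at M (\<gamma> 0)"
      have "cov_deriv M {0..L} \<gamma> ?V 0 c = comb ?f1' ?f2' ?f3' 0 c"
        by (rule cov_deriv_comb[OF D L0 c])
      also have "\<dots> = ?f1' 0 *\<^sub>R S.T S.\<alpha> c + ?f2' 0 *\<^sub>R S.T S.\<beta> c + ?f3' 0 *\<^sub>R k 0 c"
        using e0 c by (simp add: comb_def vec_eq_def)
      finally show "cov_deriv M {0..L} \<gamma> ?V 0 c = (\<lambda>c. ?f1' 0 *\<^sub>R S.T S.\<alpha> c + ?f2' 0 *\<^sub>R S.T S.\<beta> c) c + ?f3' 0 *\<^sub>R k 0 c" .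
    qed
    then have "ip M (\<gamma> 0) (cov_deriv M {0..L} \<gamma> ?V 0) (S.T b'') =
      ip M (\<gamma> 0) (\<lambda>c. (\<lambda>c. ?f1' 0 *\<^sub>R S.T S.\<alpha> c + ?f2' 0 *\<^sub>R S.T S.\<beta> c) c + ?f3' 0 *\<^sub>R k 0 c) (S.T b'')"
      by (rule ip_cong) (simp add: vec_eq_def)
    also have "\<dots> = ?f1' 0 * S.q S.\<alpha> b'' + ?f2' 0 * S.q S.\<beta> b'' + ?f3' 0 * ip M (\<gamma> 0) (k 0) (S.T b'')"
      unfolding ip_add ip_scale S.q_def ..
    also have "ip M (\<gamma> 0) (k 0) (S.T b'') = 0" using normal by (simp add: normal_to_def)
    also have "?f1' 0 * S.q S.\<alpha> b'' + ?f2' 0 * S.q S.\<beta> b'' + ?f3' 0 * 0 = - (?f1' 0 * y1 + ?f2' 0 * y2)"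
      unfolding b'' by (simp add: S.q_simps S.frame_normalized S.q_sym[of S.\<beta> S.\<alpha>])
    also have "\<dots> = - II (x *\<^sub>R S.\<alpha> + y *\<^sub>R S.\<beta>) b''"
      unfolding b'' 1 2
      by (simp add: bilinear_ladd[OF II_bil] bilinear_radd[OF II_bil] bilinear_lmul[OF II_bil] bilinear_rmul[OF II_bil]
         II_sym[of S.\<beta> S.\<alpha>] algebra_simps)
    also have "\<dots> = - ip M (\<gamma> 0) (second_ff M P (\<gamma> 0) (x *\<^sub>R S.\<alpha> + y *\<^sub>R S.\<beta>) b'') (k 0)"
      using S.ip_second_ff[OF normal] by (simp add: II_def)
    finally show "ip M (\<gamma> 0) (cov_deriv M {0..L} \<gamma> ?V 0) (S.T b'') =
       - ip M (\<gamma> 0) (second_ff M P (\<gamma> 0) (x *\<^sub>R S.\<alpha> + y *\<^sub>R S.\<beta>) b'') (k 0)" .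
  qed
  \<comment> \<open>The field is nontrivial already at 0, where its square is
    \<open>- (x * x + y * y)\<close>.\<close>
  moreover have "\<not> vec_zero M (\<gamma> 0) (?V 0)"
  proof
    assume "vec_zero M (\<gamma> 0) (?V 0)"
    then have "vec_eq M (\<gamma> 0) (S.T (x *\<^sub>R S.\<alpha> + y *\<^sub>R S.\<beta>)) (\<lambda>c. 0 *\<^sub>R S.T S.\<alpha> c)"
      using V0 by (simp add: vec_eq_def vec_zero_def)
    from ip_cong[OF this this]
    have "S.q (x *\<^sub>R S.\<alpha> + y *\<^sub>R S.\<beta>) (x *\<^sub>R S.\<alpha> + y *\<^sub>R S.\<beta>) = 0"
      unfolding S.q_def ip_scale by simp
    moreover have "S.q (x *\<^sub>R S.\<alpha> + y *\<^sub>R S.\<beta>) (x *\<^sub>R S.\<alpha> + y *\<^sub>R S.\<beta>) = - (x * x + y * y)"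
      by (simp add: S.q_simps S.frame_normalized S.q_sym[of S.\<beta> S.\<alpha>])
    ultimately have "x * x + y * y = 0" by linarith
    then show False using xy(1) unfolding sum_squares_eq_zero_iff by blast
  qed
  moreover have "vec_zero M (\<gamma> r) (?V r)"
    using xy r by (simp add: vec_zero_def comb_def m_def)
  ultimately have "focal_point M P L \<gamma> r"
    unfolding focal_point_def using r(1,2) L0 by (intro conjI exI[of _ ?V] bexI[of _ 0]) auto
  then show ?thesis using r(1,2) by blast
qed

theorem lemma4p1:
  fixes M :: "'a::{t2_space,second_countable_topology} spacetime"
    and P :: "'a set"
    and H :: "'a \<Rightarrow> real" and Hhat :: "'a \<Rightarrow> 'a tvec"
    and \<gamma> :: "real \<Rightarrow> 'a" and h k :: "real \<Rightarrow> 'a tvec" and \<rho> :: "real \<Rightarrow> real"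
    and L L\<^sub>0 \<rho>\<^sub>0 B Q\<^sub>1 :: real
  assumes spacetime: "is_spacetime M"
    and P: "spacelike_submanifold M P" "achronal M P" "future_converging M P"
    and Hhat: "\<And>p. p \<in> P \<Longrightarrow> tangent M p (Hhat p) \<and> ip M p (Hhat p) (Hhat p) = 1 \<and>
                 future_pointing M p (Hhat p)"
    and H: "\<And>p. p \<in> P \<Longrightarrow> vec_eq M p (mean_curvature M P p) (\<lambda>c. H p *\<^sub>R Hhat p c)"
    and geod: "geodesic M {0..L} \<gamma>"
    and k: "k = velocity {0..L} \<gamma>"
    and null: "\<And>t. t \<in> {0..L} \<Longrightarrow> null_vec M (\<gamma> t) (k t) \<and> future_pointing M (\<gamma> t) (k t)"
    and start: "\<gamma> 0 \<in> P" "normal_to M P (\<gamma> 0) (k 0)"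
    and transport: "parallel_field M {0..L} \<gamma> h" "vec_eq M (\<gamma> 0) (h 0) (Hhat (\<gamma> 0))"
    and affine: "\<And>t. t \<in> {0..L} \<Longrightarrow> ip M (\<gamma> t) (h t) (k t) = 1"
    and \<rho>: "\<rho> = (\<lambda>t. ricci M (\<gamma> t) (k t) (k t))"
    and B: "B > 0" and Q1: "Q\<^sub>1 = 32 * pi * B"
    and smeared: "\<And>g g' :: real \<Rightarrow> real.
           (\<And>t. (g has_real_derivative g' t) (at t)) \<Longrightarrow> continuous_on UNIV g' \<Longrightarrow>
           compact (closure {t. g t \<noteq> 0}) \<Longrightarrow> closure {t. g t \<noteq> 0} \<subseteq> {0<..<L} \<Longrightarrow>
           integral {0..L} (\<lambda>t. (g t)\<^sup>2 * \<rho> t) \<ge> - Q\<^sub>1 * integral {0..L} (\<lambda>t. (g' t)\<^sup>2)"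
    and l0: "0 < L\<^sub>0" "L\<^sub>0 < L"
    and rho0: "\<rho>\<^sub>0 \<ge> 0" "\<And>t. t \<in> {0..L\<^sub>0} \<Longrightarrow> \<rho> t \<ge> \<rho>\<^sub>0"
    and contraction: "- 2 * H (\<gamma> 0) \<ge>
           - (2/3) * \<rho>\<^sub>0 * L\<^sub>0 + Q\<^sub>1 / L\<^sub>0 + (2 + Q\<^sub>1) / (L - L\<^sub>0)"
  shows "\<exists>r. 0 < r \<and> r < L \<and> focal_point M P L \<gamma> r"
proof -
  interpret G: geodesic_segment M L \<gamma>
    by unfold_locales (use spacetime geod l0 in auto)
  interpret S: surface_point M P "\<gamma> 0"
    by unfold_locales (use P start in auto)
  have L0: "0 \<in> {0..L}" using l0 by simp
  \<comment> \<open>Transporting an orthonormal basis of the tangent plane of \<open>P\<close>,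
    which is orthogonal to \<open>k 0\<close>, gives the two transverse frame fields; the given
    \<open>h\<close> is the fourth.\<close>
  obtain e1 where e1: "G.parallel_on 0 L e1" "vec_eq M (\<gamma> 0) (e1 0) (S.T S.\<alpha>)"
    using G.parallel_transport[OF S.tangent_surf_tan] .
  obtain e2 where e2: "G.parallel_on 0 L e2" "vec_eq M (\<gamma> 0) (e2 0) (S.T S.\<beta>)"
    using G.parallel_transport[OF S.tangent_surf_tan] .
  have h: "G.parallel_on 0 L h" using transport(1) by (simp add: G.parallel_field_iff)
  note normal = start(2)[unfolded k]
  have e0: "ip M (\<gamma> 0) (e1 0) (e1 0) = -1" "ip M (\<gamma> 0) (e2 0) (e2 0) = -1" "ip M (\<gamma> 0) (e1 0) (e2 0) = 0"
    using S.frame_normalized G.ip_cong[OF e1(2) e1(2)] G.ip_cong[OF e2(2) e2(2)] G.ip_cong[OF e1(2) e2(2)]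
    by (simp_all add: S.q_def)
  have ek: "ip M (\<gamma> 0) (e1 0) (G.k 0) = 0" "ip M (\<gamma> 0) (e2 0) (G.k 0) = 0"
    using S.ip_T_normal[OF normal] G.ip_cong[OF e1(2), of "G.k 0" "G.k 0"] G.ip_cong[OF e2(2), of "G.k 0" "G.k 0"]
    by (simp_all add: vec_eq_def)
  interpret F: null_frame M L \<gamma> e1 e2 h
  proof unfold_locales
    show "ip M (\<gamma> t) (G.k t) (G.k t) = 0" if "t \<in> {0..L}" for t
      using null[OF that] k by (simp add: null_vec_def)
    show "ip M (\<gamma> t) (h t) (G.k t) = 1" if "t \<in> {0..L}" for t
      using affine[OF that] k by simp
    show "ip M (\<gamma> t) (e1 t) (e1 t) = -1" "ip M (\<gamma> t) (e2 t) (e2 t) = -1" "ip M (\<gamma> t) (e1 t) (e2 t) = 0"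
      "ip M (\<gamma> t) (e1 t) (G.k t) = 0" "ip M (\<gamma> t) (e2 t) (G.k t) = 0" if "t \<in> {0..L}" for t
      unfolding G.ip_parallel[OF e1(1) e1(1) that] G.ip_parallel[OF e2(1) e2(1) that] G.ip_parallel[OF e1(1) e2(1) that]
        G.ip_parallel[OF e1(1) G.parallel_k that] G.ip_parallel[OF e2(1) G.parallel_k that]
      by (fact e0 ek)+
  qed (fact e1(1) e2(1) h)+
  note Hp = H[OF start(1)] and Hh = Hhat[OF start(1)]
  have "ip M (\<gamma> 0) (mean_curvature M P (\<gamma> 0)) (G.k 0) = H (\<gamma> 0) * ip M (\<gamma> 0) (Hhat (\<gamma> 0)) (G.k 0)"
    using G.ip_cong[OF Hp, of "G.k 0" "G.k 0"] by (simp add: vec_eq_def G.ip_scale)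
  also have "ip M (\<gamma> 0) (Hhat (\<gamma> 0)) (G.k 0) = 1"
    using G.ip_cong[OF transport(2), of "G.k 0" "G.k 0"] affine[OF L0] k by (simp add: vec_eq_def)
  finally have \<theta>: "2 * H (\<gamma> 0) = 2 * ip M (\<gamma> 0) (mean_curvature M P (\<gamma> 0)) (G.k 0)" by simp
  \<comment> \<open>Pairing with the time orientation fixes the sign of \<open>H\<close>: the mean
    curvature vector points to the past, \<open>Hhat\<close> to the future. So the initial expansion
    is nonzero, as strictness demands.\<close>
  have "ip M (\<gamma> 0) (mean_curvature M P (\<gamma> 0)) (time_dir M (\<gamma> 0)) = H (\<gamma> 0) * ip M (\<gamma> 0) (Hhat (\<gamma> 0)) (time_dir M (\<gamma> 0))"
    using G.ip_cong[OF Hp, of "time_dir M (\<gamma> 0)" "time_dir M (\<gamma> 0)"] by (simp add: vec_eq_def G.ip_scale)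
  moreover have "ip M (\<gamma> 0) (mean_curvature M P (\<gamma> 0)) (time_dir M (\<gamma> 0)) < 0"
    using P(3) start(1) by (simp add: future_converging_def past_pointing_def)
  moreover have "ip M (\<gamma> 0) (Hhat (\<gamma> 0)) (time_dir M (\<gamma> 0)) > 0"
    using Hh by (simp add: future_pointing_def)
  ultimately have "2 * H (\<gamma> 0) < 0" by (simp add: mult_less_0_iff)
  then show ?thesis
    using F.focal_point_exists[OF P(1) start(1) normal e1(2)[unfolded S.\<alpha>_def] e2(2)[unfolded S.\<beta>_def] \<theta> _ \<rho>[unfolded k] smeared l0 rho0(2)]
      contraction by simp
qed

end
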